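(* For each $n$, let $G=G_{n,p}$ and let $Q$ be the event that every edge of $G$ lies in a triangle of $G$. Then $$\max_{p\in[0,1]}\Pr\big(G \text{ satisfies } Q \text{ and } \mathcal{T}(G)\neq \mathcal{C}(G)\big)\to 0 \quad (n\to\infty).$$
   Context: $G_{n,p}$ is the binomial random graph on vertex set $[n]$ in which each of the $\binom n2$ possible edges is present independently with probability $p$. For a graph $G$, the edge space $\mathcal{E}(G)=(\mathbb{Z}/2)^{E(G)}$ is identified with the set of edge subsets of $G$, with addition being symmetric difference. The cycle space $\mathcal{C}(G)$ is the subspace of $\mathcal{E}(G)$ spanned by the cycles of $G$, and the triangle space $\mathcal{T}(G)$ is the subspace spanned by the triangles of $G$. *)

theory Defs
  imports Complex_Main
begin

text \<open>Graphs on vertex set [n] = {1..n}; an edge is a 2-element subset of [n];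
  a graph is identified with its edge set E \<subseteq> all_edges n.\<close>

definition all_edges :: "nat \<Rightarrow> nat set set" where
  "all_edges n = {e. e \<subseteq> {1..n} \<and> card e = 2}"

definition sym_diff :: "'a set \<Rightarrow> 'a set \<Rightarrow> 'a set" where
  "sym_diff A B = (A - B) \<union> (B - A)"

inductive_set gf2_span :: "'a set set \<Rightarrow> 'a set set" for S :: "'a set set" where
  zero: "{} \<in> gf2_span S"
| add: "x \<in> S \<Longrightarrow> a \<in> gf2_span S \<Longrightarrow> sym_diff x a \<in> gf2_span S"

definition cycle_edges :: "nat list \<Rightarrow> nat set set" where
  "cycle_edges vs = {{vs ! i, vs ! ((i + 1) mod length vs)} | i. i < length vs}"

definition cycles :: "nat set set \<Rightarrow> nat set set set" where
  "cycles E = {cycle_edges vs | vs. length vs \<ge> 3 \<and> distinct vs \<and> cycle_edges vs \<subseteq> E}"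

definition triangles :: "nat set set \<Rightarrow> nat set set set" where
  "triangles E = {{{a,b},{b,c},{a,c}} | a b c. a \<noteq> b \<and> b \<noteq> c \<and> a \<noteq> c
                   \<and> {a,b} \<in> E \<and> {b,c} \<in> E \<and> {a,c} \<in> E}"

definition cycle_space :: "nat set set \<Rightarrow> nat set set set" where
  "cycle_space E = gf2_span (cycles E)"

definition triangle_space :: "nat set set \<Rightarrow> nat set set set" where
  "triangle_space E = gf2_span (triangles E)"

definition every_edge_in_triangle :: "nat set set \<Rightarrow> bool" where
  "every_edge_in_triangle E \<longleftrightarrow> (\<forall>e\<in>E. \<exists>T\<in>triangles E. e \<in> T)"

definition gnp_prob :: "nat \<Rightarrow> real \<Rightarrow> (nat set set \<Rightarrow> bool) \<Rightarrow> real" where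
  "gnp_prob n p P = (\<Sum>E\<in>{E. E \<subseteq> all_edges n \<and> P E}.
      p ^ card E * (1 - p) ^ (card (all_edges n) - card E))"

end

theory Submission
  imports Defs "HOL-Real_Asymp.Real_Asymp"
begin

text \<open>By duality over the two-element field, a graph whose triangles do not span its cycle space has
  an edge set F that meets every triangle evenly and some cycle oddly. Take such an F of least
  size; as adding a cut preserves both properties, F contains at most half of the edges at
  each vertex.

  If np^2 is at most (5/4) ln n, then either there are no triangles, or a second moment computation
  gives an edge in no triangle, so that Q fails. Now let np^2 be larger.

  F is small: fix a vertex set S of small linear size. The restriction of F to the edges at S forces
  whether an edge with a common neighbour of its ends in S lies in F. Hence it suffices to
  consider exp(eps n^2 p) colourings of pairs, each determined before the graph outside S is
  exposed. If such a colouring has many odd triangles, the random graph avoids them only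
  with probability exp(-c n^2 p). Otherwise some vertex x lies in few odd triangles, so that the
  colouring is almost the cut defined by the colours of the pairs at x, and minimality of F
  yields |F| <= eps n^2 p.

  F is not small: each triangle that meets F contains two F-edges, so the sum of the codegrees of the
  F-edges is twice the sum over all x of e(N_F(x)). A vertex of small F-degree contributes
  little to the right-hand side, and any other vertex x contributes at most about half of
  np^2 d_F(x). As there are few such heavy vertices, almost all F-edges at them have a
  light end and a codegree close to np^2, which makes the left-hand side too large. Edges of
  very small codegree form a matching, and Q provides for each of them in F an adjacent
  F-edge of larger codegree.\<close>

section \<open>Random subsets of a finite set\<close>

text \<open>The maximum over p forces all estimates to be uniform in p, hence limit statements of
  the form: eventually in n, for all p. The split at np^2 = (5/4) ln n lies strictly between two
  thresholds. There are about n^2 p exp(-np^2) edges in no triangle, and near this density they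
  persist up to (3/2) ln n; two edges of very small codegree at one vertex occur about n (np)^2
  exp(-2np^2) times and die out beyond roughly ln n. Thus 5/4 leaves room on both sides. A direct
  union bound over F fails: there are exponentially many F in n^2 p, while avoiding odd triangles
  gains only a factor exp(-c n^2 p). This is why F is encoded by its few edges at S. Minimality
  under cuts is essential for the counting: if a heavy vertex x could have N_F(x) = N(x), both sides
  of the count would be about 2 np^2 times the sum of the heavy F-degrees. Halving the F-degrees
  halves the upper bound, and the constants 0.8 and 0.9 are placed in the resulting gap.\<close>

definition expect :: "real \<Rightarrow> 'a set \<Rightarrow> ('a set \<Rightarrow> real) \<Rightarrow> real" where
  "expect p U f = (\<Sum>E\<in>Pow U. p ^ card E * (1 - p) ^ (card U - card E) * f E)"

definition prob :: "real \<Rightarrow> 'a set \<Rightarrow> ('a set \<Rightarrow> bool) \<Rightarrow> real" where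
  "prob p U P = expect p U (\<lambda>E. of_bool (P E))"

lemma expect_cong: "(\<And>E. E \<subseteq> U \<Longrightarrow> f E = g E) \<Longrightarrow> expect p U f = expect p U g"
  unfolding expect_def by (rule sum.cong) auto

lemma expect_empty [simp]: "expect p {} f = f {}"
  by (simp add: expect_def)

text \<open>Conditioning on whether a is chosen. Several identities that follow are inductions over
  this recursion.\<close>

lemma expect_insert:
  assumes "finite U" "a \<notin> U"
  shows "expect p (insert a U) f = p * expect p U (\<lambda>E. f (insert a E)) + (1 - p) * expect p U f"
proof -
  let ?g = "\<lambda>E. p ^ card E * (1 - p) ^ (card (insert a U) - card E) * f E"
  have "expect p (insert a U) f = sum ?g (Pow U) + sum ?g (insert a ` Pow U)"
    unfolding expect_def Pow_insert by (rule sum.union_disjoint) (use assms in auto)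
  also have "sum ?g (Pow U) = (1 - p) * expect p U f"
    unfolding expect_def sum_distrib_left
  proof (rule sum.cong[OF refl])
    fix E assume "E \<in> Pow U"
    then have "card E \<le> card U" using assms card_mono by auto
    then show "?g E = (1 - p) * (p ^ card E * (1 - p) ^ (card U - card E) * f E)"
      using assms by (simp add: Suc_diff_le)
  qed
  also have "sum ?g (insert a ` Pow U) = sum (\<lambda>E. ?g (insert a E)) (Pow U)"
    by (subst sum.reindex) (use assms in \<open>auto simp: inj_on_def\<close>)
  also have "\<dots> = p * expect p U (\<lambda>E. f (insert a E))"
    unfolding expect_def sum_distrib_left
  proof (rule sum.cong[OF refl])
    fix E assume E: "E \<in> Pow U"
    then have "finite E" "a \<notin> E" using assms finite_subset by auto
    then show "?g (insert a E) = p * (p ^ card E * (1 - p) ^ (card U - card E) * f (insert a E))"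
      using assms by simp
  qed
  finally show ?thesis by simp
qed

lemma expect_const [simp]: "finite U \<Longrightarrow> expect p U (\<lambda>_. c) = c"
  by (induction U rule: finite_induct) (simp_all add: expect_insert algebra_simps)

lemma expect_cmult: "expect p U (\<lambda>E. c * f E) = c * expect p U f"
  unfolding expect_def sum_distrib_left by (simp add: mult_ac)

lemma expect_multc: "expect p U (\<lambda>E. f E * c) = expect p U f * c"
  unfolding expect_def sum_distrib_right by (simp add: mult_ac)

lemma expect_add: "expect p U (\<lambda>E. f E + g E) = expect p U f + expect p U g"
  unfolding expect_def by (simp add: sum.distrib algebra_simps)

lemma expect_sum: "expect p U (\<lambda>E. \<Sum>i\<in>I. f i E) = (\<Sum>i\<in>I. expect p U (f i))"
  unfolding expect_def sum_distrib_left by (rule sum.swap)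

text \<open>Exposure in two rounds: first the part in U, then, independently, the part in W. This
  replaces conditional probability throughout.\<close>

lemma expect_union:
  assumes "finite U" "finite W" "U \<inter> W = {}"
  shows "expect p (U \<union> W) f = expect p U (\<lambda>A. expect p W (\<lambda>B. f (A \<union> B)))"
  using assms
proof (induction U arbitrary: f rule: finite_induct)
  case (insert a U)
  then have "a \<notin> U \<union> W" "finite (U \<union> W)" "U \<inter> W = {}" by auto
  then show ?case using insert by (simp add: expect_insert)
qed simp

lemma expect_restrict:
  assumes "finite U" "A \<subseteq> U"
  shows "expect p U (\<lambda>E. f (E \<inter> A)) = expect p A f"
proof -
  have U: "U = A \<union> (U - A)" and fin: "finite A" "finite (U - A)"
    using assms finite_subset by auto
  have "expect p (A \<union> (U - A)) (\<lambda>E. f (E \<inter> A))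
      = expect p A (\<lambda>B. expect p (U - A) (\<lambda>C. f ((B \<union> C) \<inter> A)))"
    using fin by (intro expect_union) auto
  also have "\<dots> = expect p A (\<lambda>B. expect p (U - A) (\<lambda>C. f B))"
    by (intro expect_cong arg_cong[where f = f]) auto
  finally show ?thesis using U fin by simp
qed

lemma expect_image:
  assumes "finite U" "inj_on g U"
  shows "expect p (g ` U) f = expect p U (\<lambda>A. f (g ` A))"
  using assms
proof (induction U arbitrary: f rule: finite_induct)
  case (insert a U)
  then have "g a \<notin> g ` U" by (auto simp: inj_on_def)
  with insert show ?case by (simp add: expect_insert)
qed simp

lemma expect_prod:
  assumes "finite A"
  shows "expect p A (\<lambda>E. \<Prod>y\<in>E. h y) = (\<Prod>y\<in>A. 1 - p + p * h y)"
  using assms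
proof (induction A rule: finite_induct)
  case (insert a A)
  have "expect p A (\<lambda>E. \<Prod>y\<in>insert a E. h y) = expect p A (\<lambda>E. h a * (\<Prod>y\<in>E. h y))"
  proof (rule expect_cong)
    fix E assume "E \<subseteq> A"
    then have "finite E" "a \<notin> E" using insert finite_subset by auto
    then show "(\<Prod>y\<in>insert a E. h y) = h a * (\<Prod>y\<in>E. h y)" by simp
  qed
  then show ?case using insert by (simp add: expect_insert expect_cmult algebra_simps)
qed simp

lemma expect_power:
  assumes "finite A"
  shows "expect p A (\<lambda>E. z ^ card E) = (1 - p + p * z) ^ card A"
  using expect_prod[OF assms, of p "\<lambda>_. z"] by simp

text \<open>Independence of the traces on disjoint blocks. It is applied later with one block per
  vertex i, made of the pairs that join i to a few fixed vertices.\<close>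

lemma expect_blocks:
  assumes "finite I" "\<And>i. i \<in> I \<Longrightarrow> finite (B i)"
    and "\<And>i j. i \<in> I \<Longrightarrow> j \<in> I \<Longrightarrow> i \<noteq> j \<Longrightarrow> B i \<inter> B j = {}"
  shows "expect p (\<Union>i\<in>I. B i) (\<lambda>E. \<Prod>i\<in>I. f i (E \<inter> B i)) = (\<Prod>i\<in>I. expect p (B i) (f i))"
  using assms
proof (induction I rule: finite_induct)
  case (insert a I)
  let ?U = "\<Union>i\<in>I. B i"
  have disj: "B a \<inter> ?U = {}" using insert by fastforce
  have "expect p (\<Union>i\<in>insert a I. B i) (\<lambda>E. \<Prod>i\<in>insert a I. f i (E \<inter> B i))
      = expect p (B a) (\<lambda>A. expect p ?U (\<lambda>C. \<Prod>i\<in>insert a I. f i ((A \<union> C) \<inter> B i)))"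
    using insert disj by (simp only: Union_image_insert) (intro expect_union, auto)
  also have "\<dots> = expect p (B a) (\<lambda>A. expect p ?U (\<lambda>C. f a A * (\<Prod>i\<in>I. f i (C \<inter> B i))))"
  proof (intro expect_cong)
    fix A C assume *: "A \<subseteq> B a" "C \<subseteq> ?U"
    have "(A \<union> C) \<inter> B a = A" using * disj by auto
    moreover have "(A \<union> C) \<inter> B i = C \<inter> B i" if "i \<in> I" for i using * disj that by auto
    ultimately show "(\<Prod>i\<in>insert a I. f i ((A \<union> C) \<inter> B i)) = f a A * (\<Prod>i\<in>I. f i (C \<inter> B i))"
      using insert by simp
  qed
  also have "\<dots> = (\<Prod>i\<in>insert a I. expect p (B i) (f i))"
  proof -
    have "expect p ?U (\<lambda>C. \<Prod>i\<in>I. f i (C \<inter> B i)) = (\<Prod>i\<in>I. expect p (B i) (f i))"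
      using insert by auto
    then show ?thesis using insert
      by (simp add: expect_cmult expect_multc mult.commute)
  qed
  finally show ?case .
qed simp

lemma prob_union:
  assumes "finite U" "finite W" "U \<inter> W = {}"
  shows "prob p (U \<union> W) P = expect p U (\<lambda>A. prob p W (\<lambda>B. P (A \<union> B)))"
  unfolding prob_def by (rule expect_union[OF assms])

lemma prob_restrict:
  assumes "finite U" "A \<subseteq> U"
  shows "prob p U (\<lambda>E. P (E \<inter> A)) = prob p A P"
  unfolding prob_def by (rule expect_restrict[OF assms])

lemma prob_cong: "(\<And>E. E \<subseteq> U \<Longrightarrow> P E \<longleftrightarrow> Q E) \<Longrightarrow> prob p U P = prob p U Q"
  unfolding prob_def by (rule expect_cong) simp

lemma gnp_prob_eq_prob: "gnp_prob n p P = prob p (all_edges n) P"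
proof -
  have fin: "finite (all_edges n)" by (simp add: all_edges_def)
  have "prob p (all_edges n) P = (\<Sum>E\<in>Pow (all_edges n). if P E
      then p ^ card E * (1 - p) ^ (card (all_edges n) - card E) else 0)"
    unfolding prob_def expect_def by (rule sum.cong) auto
  also have "\<dots> = gnp_prob n p P"
    unfolding gnp_prob_def using fin
    by (subst sum.inter_filter[symmetric]) (auto intro!: sum.cong)
  finally show ?thesis by simp
qed

section \<open>Union bounds, first moments and Chernoff bounds\<close>

context
  fixes p :: real
  assumes p01: "0 \<le> p" "p \<le> 1"
begin

lemma expect_mono:
  assumes "\<And>E. E \<subseteq> U \<Longrightarrow> f E \<le> g E"
  shows "expect p U f \<le> expect p U g"
  unfolding expect_def by (intro sum_mono mult_left_mono) (use assms p01 in auto)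

lemma expect_le_const:
  assumes "finite U" "\<And>E. E \<subseteq> U \<Longrightarrow> f E \<le> c"
  shows "expect p U f \<le> c"
  using expect_mono[of U f "\<lambda>_. c"] assms by simp

lemma expect_nonneg:
  assumes "\<And>E. E \<subseteq> U \<Longrightarrow> 0 \<le> f E"
  shows "0 \<le> expect p U f"
  unfolding expect_def by (intro sum_nonneg mult_nonneg_nonneg) (use assms p01 in auto)

lemma prob_nonneg: "0 \<le> prob p U P"
  unfolding prob_def by (rule expect_nonneg) simp

lemma prob_mono:
  assumes "\<And>E. E \<subseteq> U \<Longrightarrow> P E \<Longrightarrow> Q E"
  shows "prob p U P \<le> prob p U Q"
  unfolding prob_def by (rule expect_mono) (use assms in auto)

text \<open>The function f is free: an exponential gives the Chernoff bounds, a count gives Markov's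
  inequality, a square gives Chebyshev's.\<close>

lemma prob_markov:
  assumes "\<And>E. E \<subseteq> U \<Longrightarrow> 0 \<le> f E" "\<And>E. E \<subseteq> U \<Longrightarrow> P E \<Longrightarrow> 1 \<le> f E"
  shows "prob p U P \<le> expect p U f"
  unfolding prob_def by (rule expect_mono) (use assms in auto)

lemma prob_disj:
  assumes "\<And>E. E \<subseteq> U \<Longrightarrow> P E \<Longrightarrow> Q E \<or> R E"
  shows "prob p U P \<le> prob p U Q + prob p U R"
proof -
  have "prob p U P \<le> expect p U (\<lambda>E. of_bool (Q E) + of_bool (R E))"
    unfolding prob_def by (rule expect_mono) (use assms in \<open>auto simp: of_bool_def\<close>)
  then show ?thesis by (simp add: expect_add prob_def)
qed

lemma prob_Bex:
  assumes "finite I" "\<And>E. E \<subseteq> U \<Longrightarrow> P E \<Longrightarrow> \<exists>i\<in>I. Q i E"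
  shows "prob p U P \<le> (\<Sum>i\<in>I. prob p U (Q i))"
proof -
  have "prob p U P \<le> expect p U (\<lambda>E. \<Sum>i\<in>I. of_bool (Q i E))"
  proof (rule prob_markov)
    fix E assume "E \<subseteq> U" "P E"
    then obtain i where "i \<in> I" "Q i E" using assms(2) by blast
    then show "(1::real) \<le> (\<Sum>i\<in>I. of_bool (Q i E))"
      using member_le_sum[of i I "\<lambda>i. of_bool (Q i E) :: real"] assms(1) by simp
  qed (simp add: sum_nonneg)
  then show ?thesis by (simp add: expect_sum prob_def)
qed

lemma prob_Bex_le:
  assumes "finite I" "\<And>E. E \<subseteq> U \<Longrightarrow> P E \<Longrightarrow> \<exists>i\<in>I. Q i E" "\<And>i. i \<in> I \<Longrightarrow> prob p U (Q i) \<le> b"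
    "real (card I) \<le> k" "0 \<le> b"
  shows "prob p U P \<le> k * b"
proof -
  have "prob p U P \<le> (\<Sum>i\<in>I. prob p U (Q i))" by (rule prob_Bex) (use assms in auto)
  also have "\<dots> \<le> card I * b" using assms sum_bounded_above[of I "\<lambda>i. prob p U (Q i)" b] by simp
  also have "\<dots> \<le> k * b" using assms by (intro mult_right_mono) auto
  finally show ?thesis .
qed

text \<open>Exponential moments: \<open>z ^ card (E \<inter> A)\<close> has mean (1 - p + pz)^|A|,
  at most exp(p(z - 1)|A|). The deviation is stated after multiplication by ln z, so that z \<ge> 1
  and z \<le> 1 give the upper and the lower tail from one proof.\<close>

lemma chernoff_aux:
  fixes a z :: real
  assumes "finite U" "A \<subseteq> U" "z > 0"
    "\<And>E. E \<subseteq> U \<Longrightarrow> P E \<Longrightarrow> a * ln z \<le> card (E \<inter> A) * ln z"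
  shows "prob p U P \<le> exp (p * (z - 1) * card A - a * ln z)"
proof -
  have finA: "finite A" using assms finite_subset by blast
  have "prob p U P \<le> expect p U (\<lambda>E. exp (- a * ln z) * z ^ card (E \<inter> A))"
  proof (rule prob_markov)
    fix E assume "E \<subseteq> U" "P E"
    then have "1 \<le> exp (- a * ln z + card (E \<inter> A) * ln z)" using assms(4) by simp
    also have "\<dots> = exp (- a * ln z) * z ^ card (E \<inter> A)"
      using \<open>z > 0\<close> exp_of_nat_mult[of "card (E \<inter> A)" "ln z"]
      by (simp only: exp_add) simp
    finally show "1 \<le> exp (- a * ln z) * z ^ card (E \<inter> A)" .
  qed (use assms in auto)
  also have "\<dots> = exp (- a * ln z) * (1 - p + p * z) ^ card A"
    using expect_restrict[OF assms(1,2), of p "\<lambda>B. z ^ card B"] finA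
    by (simp add: expect_cmult expect_power)
  also have "(1 - p + p * z) ^ card A \<le> exp (p * (z - 1)) ^ card A"
  proof (rule power_mono)
    show "1 - p + p * z \<le> exp (p * (z - 1))"
      using exp_ge_add_one_self[of "p * (z - 1)"] by (simp add: algebra_simps)
    show "0 \<le> 1 - p + p * z" using p01 \<open>z > 0\<close> by simp
  qed
  also have "exp (- a * ln z) * exp (p * (z - 1)) ^ card A = exp (p * (z - 1) * card A - a * ln z)"
    by (simp add: exp_of_nat_mult[symmetric] exp_add[symmetric] mult_ac exp_diff exp_minus field_simps)
  finally show ?thesis by simp
qed

lemma chernoff_upper:
  fixes a z :: real
  assumes "finite U" "A \<subseteq> U" "z \<ge> 1" "\<And>E. E \<subseteq> U \<Longrightarrow> P E \<Longrightarrow> a \<le> card (E \<inter> A)"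
  shows "prob p U P \<le> exp (p * (z - 1) * card A - a * ln z)"
  by (rule chernoff_aux) (use assms in \<open>auto intro!: mult_right_mono\<close>)

lemma chernoff_lower:
  fixes a z :: real
  assumes "finite U" "A \<subseteq> U" "0 < z" "z \<le> 1" "\<And>E. E \<subseteq> U \<Longrightarrow> P E \<Longrightarrow> card (E \<inter> A) \<le> a"
  shows "prob p U P \<le> exp (p * (z - 1) * card A - a * ln z)"
  by (rule chernoff_aux) (use assms in \<open>auto intro!: mult_right_mono_neg\<close>)

end

section \<open>Edge sets dual to the triangles\<close>

text \<open>For a two-element edge an odd intersection with A means exactly one end in A; the parity
  form fits the parity counts along cycles.\<close>

definition cut :: "nat set set \<Rightarrow> nat set \<Rightarrow> nat set set" where
  "cut E A = {e \<in> E. odd (card (e \<inter> A))}"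

definition triangle_even :: "nat set set \<Rightarrow> nat set set \<Rightarrow> bool" where
  "triangle_even E F \<longleftrightarrow> (\<forall>a b c. {a, b} \<in> E \<longrightarrow> {b, c} \<in> E \<longrightarrow> {a, c} \<in> E \<longrightarrow>
     ({a, c} \<in> F \<longleftrightarrow> ({a, b} \<in> F) \<noteq> ({b, c} \<in> F)))"

text \<open>Of the odd cycle only a consequence is kept: a finite nonempty F that is minimal under
  adding cuts is not itself a cut, since adding F to itself would leave the empty set.\<close>

definition witness :: "nat set set \<Rightarrow> nat set set \<Rightarrow> bool" where
  "witness E F \<longleftrightarrow> F \<subseteq> E \<and> F \<noteq> {} \<and> triangle_even E F \<and> (\<forall>A. card F \<le> card (sym_diff F (cut E A)))"

section \<open>Duality over the two-element field\<close>

lemma gf2_span_sym_diff: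
  assumes "a \<in> gf2_span S" "b \<in> gf2_span S"
  shows "sym_diff a b \<in> gf2_span S"
  using assms
proof (induction a rule: gf2_span.induct)
  case (add x a)
  have "sym_diff (sym_diff x a) b = sym_diff x (sym_diff a b)" by (auto simp: sym_diff_def)
  then show ?case using add gf2_span.add by metis
qed (simp add: sym_diff_def)

lemma gf2_span_least:
  assumes "S \<subseteq> gf2_span S'"
  shows "gf2_span S \<subseteq> gf2_span S'"
proof
  fix a assume "a \<in> gf2_span S"
  then show "a \<in> gf2_span S'"
    by (induction rule: gf2_span.induct) (use assms gf2_span_sym_diff gf2_span.zero in blast)+
qed

lemma gf2_span_superset: "x \<in> S \<Longrightarrow> x \<in> gf2_span S"
  using gf2_span.add[OF _ gf2_span.zero, of x S] by (simp add: sym_diff_def)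

text \<open>Among the subspaces that contain S and miss c, a maximal one W has index two. It is the
  kernel of a linear functional on the subsets of U, and F collects the elements whose singletons
  have value one.\<close>

lemma gf2_separation:
  fixes U :: "'a set"
  assumes "finite U" "S \<subseteq> Pow U" "c \<subseteq> U" "c \<notin> gf2_span S"
  shows "\<exists>F\<subseteq>U. (\<forall>s\<in>S. even (card (F \<inter> s))) \<and> odd (card (F \<inter> c))"
proof -
  define Q where "Q = {W. W \<subseteq> Pow U \<and> S \<subseteq> W \<and> {} \<in> W \<and> c \<notin> W \<and> (\<forall>a\<in>W. \<forall>b\<in>W. sym_diff a b \<in> W)}"
  have sub: "gf2_span S \<subseteq> Pow U"
  proof
    fix a assume "a \<in> gf2_span S"
    then show "a \<in> Pow U"
      by (induction rule: gf2_span.induct) (use assms(2) in \<open>auto simp: sym_diff_def\<close>)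
  qed
  have "Q \<subseteq> Pow (Pow U)" by (auto simp: Q_def)
  then have "finite Q" using assms(1) finite_subset by blast
  moreover have "gf2_span S \<in> Q"
    using sub assms gf2_span_superset gf2_span.zero gf2_span_sym_diff by (auto simp: Q_def)
  ultimately obtain W where W: "W \<in> Q" and max: "\<And>W'. W' \<in> Q \<Longrightarrow> W \<subseteq> W' \<Longrightarrow> W' = W"
    using finite_has_maximal[of Q] by blast
  have cl: "sym_diff a b \<in> W" if "a \<in> W" "b \<in> W" for a b using W that by (auto simp: Q_def)
  \<comment> \<open>The union of W and x + W is closed and larger than W, so maximality forces c
    into it: c = x + w, which says that x + c lies in W.\<close>
  have coset: "sym_diff x c \<in> W" if "x \<subseteq> U" "x \<notin> W" for x
  proof -
    define W' where "W' = W \<union> sym_diff x ` W"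
    have "x \<in> W'" using W by (auto simp: W'_def Q_def image_iff sym_diff_def intro!: bexI[of _ "{}"])
    then have "W' \<noteq> W" using that by auto
    then have "W' \<notin> Q" using max[of W'] by (auto simp: W'_def)
    moreover have "W' \<subseteq> Pow U" "S \<subseteq> W'" "{} \<in> W'"
      using W that by (auto simp: Q_def W'_def sym_diff_def)
    moreover have "sym_diff a b \<in> W'" if ab: "a \<in> W'" "b \<in> W'" for a b
    proof -
      have e1: "sym_diff (sym_diff x u) v = sym_diff x (sym_diff u v)"
        and e2: "sym_diff u (sym_diff x v) = sym_diff x (sym_diff u v)"
        and e3: "sym_diff (sym_diff x u) (sym_diff x v) = sym_diff u v" for u v
        by (auto simp: sym_diff_def)
      consider "a \<in> W" "b \<in> W" | v where "a \<in> W" "b = sym_diff x v" "v \<in> W"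
        | u where "a = sym_diff x u" "u \<in> W" "b \<in> W"
        | u v where "a = sym_diff x u" "u \<in> W" "b = sym_diff x v" "v \<in> W"
        using ab unfolding W'_def by blast
      then show ?thesis
      proof cases
        case 1
        then show ?thesis using cl by (simp add: W'_def)
      next
        case (2 v)
        then show ?thesis using cl[of a v] e2[of a v] by (auto simp: W'_def)
      next
        case (3 u)
        then show ?thesis using cl[of u b] e1[of u b] by (auto simp: W'_def)
      next
        case (4 u v)
        then show ?thesis using cl[of u v] e3[of u v] by (auto simp: W'_def)
      qed
    qed
    ultimately have "c \<in> W'" by (auto simp: Q_def)
    then obtain w where "w \<in> W" "c = sym_diff x w" using W by (auto simp: W'_def Q_def)
    moreover have "sym_diff x (sym_diff x w) = w" by (auto simp: sym_diff_def)
    ultimately show ?thesis by simp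
  qed
  define F where "F = {e \<in> U. {e} \<notin> W}"
  have parity: "x \<in> W \<longleftrightarrow> even (card (F \<inter> x))" if "x \<subseteq> U" for x
  proof -
    have "finite x" using that assms(1) finite_subset by blast
    then show ?thesis using that
    proof (induction x rule: finite_induct)
      case empty
      then show ?case using W by (auto simp: Q_def)
    next
      case (insert e x)
      have ins: "insert e x = sym_diff {e} x" "x = sym_diff {e} (insert e x)" "{e} = sym_diff x (insert e x)"
        using insert by (auto simp: sym_diff_def)
      show ?case
      proof (cases "{e} \<in> W")
        case True
        then have "insert e x \<in> W \<longleftrightarrow> x \<in> W" using ins cl by metis
        then show ?thesis using True insert by (simp add: F_def)
      next
        case False
        \<comment> \<open>Both {e} and x lie outside W, so {e} + c and x + c lie in W; in their sum
          c cancels.\<close>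
        have "insert e x \<in> W" if "x \<notin> W"
        proof -
          have "sym_diff (sym_diff {e} c) (sym_diff x c) = insert e x"
            using insert by (auto simp: sym_diff_def)
          then show ?thesis using cl coset that False insert.prems by (metis insert_subset empty_subsetI)
        qed
        then have "insert e x \<in> W \<longleftrightarrow> x \<notin> W" using ins cl False by metis
        moreover have "F \<inter> insert e x = insert e (F \<inter> x)" using False insert by (auto simp: F_def)
        ultimately show ?thesis using insert by simp
      qed
    qed
  qed
  have "F \<subseteq> U" by (auto simp: F_def)
  moreover have "\<forall>s\<in>S. even (card (F \<inter> s))"
  proof
    fix s assume "s \<in> S"
    then have "s \<in> W" "s \<subseteq> U" using W assms(2) by (auto simp: Q_def)
    then show "even (card (F \<inter> s))" using parity by blast
  qed
  moreover have "odd (card (F \<inter> c))" using parity[OF assms(3)] W by (auto simp: Q_def)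
  ultimately show ?thesis by blast
qed

lemma even_card_sym_diff_Int:
  assumes "finite T"
  shows "even (card (sym_diff P R \<inter> T)) \<longleftrightarrow> (even (card (P \<inter> T)) \<longleftrightarrow> even (card (R \<inter> T)))"
proof -
  let ?I = "P \<inter> R \<inter> T"
  have "card (P \<inter> T) = card (?I \<union> ((P - R) \<inter> T))" by (rule arg_cong[where f = card]) auto
  then have 1: "card (P \<inter> T) = card ?I + card ((P - R) \<inter> T)"
    using assms by (subst (asm) card_Un_disjoint) auto
  have "card (R \<inter> T) = card (?I \<union> ((R - P) \<inter> T))" by (rule arg_cong[where f = card]) auto
  then have 2: "card (R \<inter> T) = card ?I + card ((R - P) \<inter> T)"
    using assms by (subst (asm) card_Un_disjoint) auto
  have "card (sym_diff P R \<inter> T) = card (((P - R) \<inter> T) \<union> ((R - P) \<inter> T))"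
    by (rule arg_cong[where f = card]) (auto simp: sym_diff_def)
  then have 3: "card (sym_diff P R \<inter> T) = card ((P - R) \<inter> T) + card ((R - P) \<inter> T)"
    using assms by (subst (asm) card_Un_disjoint) auto
  show ?thesis unfolding 1 2 3 by presburger
qed

text \<open>Along the cycle each vertex of A is counted by its two incident edges, so the numbers
  \<open>card (g i \<inter> A)\<close> have an even sum; the odd terms of this sum are the cut
  edges.\<close>

lemma even_card_cut_cycle:
  assumes "C \<in> cycles E"
  shows "even (card (cut E A \<inter> C))"
proof -
  obtain vs where vs: "length vs \<ge> 3" "distinct vs" "cycle_edges vs \<subseteq> E" "C = cycle_edges vs"
    using assms by (auto simp: cycles_def)
  define k where "k = length vs"
  define s where "s = (\<lambda>i. (i + 1) mod k)"
  define g where "g = (\<lambda>i. {vs ! i, vs ! (s i)})"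
  have k: "k \<ge> 3" using vs by (simp add: k_def)
  have s: "s i = (if i + 1 = k then 0 else i + 1)" if "i < k" for i
    using that by (auto simp: s_def)
  have sk: "s i < k" if "i < k" for i using s[OF that] that k by auto
  have vsi: "vs ! i = vs ! j \<longleftrightarrow> i = j" if "i < k" "j < k" for i j
    using vs(2) that by (simp add: k_def nth_eq_iff_index_eq)
  have s_inj: "inj_on s {..<k}" by (rule inj_onI) (auto simp: s split: if_splits)
  have s_bij: "bij_betw s {..<k} {..<k}"
    unfolding bij_betw_def using s_inj sk endo_inj_surj[of "{..<k}" s] by blast
  have inj: "inj_on g {..<k}"
  proof (rule inj_onI)
    fix i j assume ij: "i \<in> {..<k}" "j \<in> {..<k}" "g i = g j"
    \<comment> \<open>If i and j were successors of each other, the cycle would have length two; k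
      \<ge> 3 excludes this.\<close>
    then have "i = j \<or> (i = s j \<and> s i = j)"
      unfolding g_def doubleton_eq_iff using vsi sk by auto
    then show "i = j" using ij k by (auto simp: s split: if_splits)
  qed
  have C: "C = g ` {..<k}"
    using vs(4) by (auto simp: cycle_edges_def g_def s_def k_def image_iff)
  have "cut E A \<inter> C = {e \<in> C. odd (card (e \<inter> A))}" using vs by (auto simp: cut_def)
  also have "\<dots> = g ` {i \<in> {..<k}. odd (card (g i \<inter> A))}" unfolding C by auto
  finally have "card (cut E A \<inter> C) = card {i \<in> {..<k}. odd (card (g i \<inter> A))}"
    using inj by (simp add: card_image inj_on_def)
  moreover have "even (\<Sum>i<k. card (g i \<inter> A))"
  proof -
    have "card (g i \<inter> A) = of_bool (vs ! i \<in> A) + of_bool (vs ! (s i) \<in> A)" if "i < k" for i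
    proof -
      have "vs ! i \<noteq> vs ! (s i)" using vsi[OF that sk[OF that]] s[OF that] k by auto
      then show ?thesis unfolding g_def by (auto simp: Int_insert_left)
    qed
    then have "(\<Sum>i<k. card (g i \<inter> A)) = (\<Sum>i<k. of_bool (vs ! i \<in> A)) + (\<Sum>i<k. of_bool (vs ! (s i) \<in> A))"
      by (simp add: sum.distrib)
    also have "(\<Sum>i<k. of_bool (vs ! (s i) \<in> A)) = (\<Sum>i<k. of_bool (vs ! i \<in> A) :: nat)"
      by (rule sum.reindex_bij_betw[OF s_bij, where g = "\<lambda>i. of_bool (vs ! i \<in> A)"])
    finally show ?thesis by simp
  qed
  ultimately show ?thesis by (simp add: even_sum_iff)
qed

lemma triangles_subset_cycles: "triangles E \<subseteq> cycles E"
proof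
  fix T assume "T \<in> triangles E"
  then obtain a b c where *: "T = {{a,b},{b,c},{a,c}}" "a \<noteq> b" "b \<noteq> c" "a \<noteq> c"
    "{a,b} \<in> E" "{b,c} \<in> E" "{a,c} \<in> E"
    by (auto simp: triangles_def)
  have "{i. i < (3::nat)} = {0, 1, 2}" by auto
  moreover have "cycle_edges [a,b,c] = (\<lambda>i. {[a,b,c] ! i, [a,b,c] ! ((i + 1) mod 3)}) ` {i. i < 3}"
    by (auto simp: cycle_edges_def)
  ultimately have "cycle_edges [a,b,c] = T" using * by (auto simp: insert_commute)
  then show "T \<in> cycles E" unfolding cycles_def using * by (auto intro!: exI[of _ "[a,b,c]"])
qed

text \<open>A set that meets all triangles evenly and C oddly keeps both properties when a cut is
  added, because a cut meets every cycle evenly. A smallest such set is therefore minimal under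
  adding cuts.\<close>

lemma exists_witness:
  assumes E: "E \<subseteq> all_edges n" and ne: "triangle_space E \<noteq> cycle_space E"
  shows "\<exists>F. witness E F"
proof -
  have "finite (all_edges n)" by (simp add: all_edges_def)
  then have finE: "finite E" using E finite_subset by blast
  have "gf2_span (triangles E) \<subseteq> gf2_span (cycles E)"
    using triangles_subset_cycles gf2_span_superset by (intro gf2_span_least) blast
  then have "\<not> cycles E \<subseteq> gf2_span (triangles E)"
    using ne gf2_span_least unfolding triangle_space_def cycle_space_def by blast
  then obtain C where C: "C \<in> cycles E" "C \<notin> gf2_span (triangles E)" by auto
  have sub: "D \<subseteq> E" if "D \<in> cycles E" for D using that by (auto simp: cycles_def)
  define good where "good = (\<lambda>F. F \<subseteq> E \<and> (\<forall>T\<in>triangles E. even (card (F \<inter> T))) \<and> odd (card (F \<inter> C)))"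
  have "\<exists>F. good F"
    unfolding good_def using gf2_separation[OF finE _ sub[OF C(1)] C(2)] triangles_subset_cycles sub by blast
  then obtain F where F: "good F" and min: "\<And>F'. good F' \<Longrightarrow> card F \<le> card F'"
    using ex_has_least_nat[of good _ card] by blast
  have "card F \<le> card (sym_diff F (cut E A))" for A
  proof (rule min)
    have "finite D" if "D \<in> cycles E" for D using sub[OF that] finE finite_subset by blast
    then show "good (sym_diff F (cut E A))"
      using F even_card_cut_cycle C(1) triangles_subset_cycles
      unfolding good_def by (auto simp: even_card_sym_diff_Int subset_iff) (auto simp: sym_diff_def cut_def)
  qed
  moreover have "F \<noteq> {}" using F by (auto simp: good_def)
  moreover have "triangle_even E F"
    unfolding triangle_even_def
  proof (intro allI impI)
    fix a b c assume abc: "{a, b} \<in> E" "{b, c} \<in> E" "{a, c} \<in> E"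
    then have "card {a,b} = 2" "card {b,c} = 2" "card {a,c} = 2" using E by (auto simp: all_edges_def)
    then have d: "a \<noteq> b" "b \<noteq> c" "a \<noteq> c" by auto
    then have "{{a,b},{b,c},{a,c}} \<in> triangles E" using abc by (auto simp: triangles_def)
    then have "even (card (F \<inter> {{a,b},{b,c},{a,c}}))" using F by (auto simp: good_def)
    moreover have "{a,b} \<noteq> {b,c}" "{a,b} \<noteq> {a,c}" "{b,c} \<noteq> {a,c}" using d by (auto simp: doubleton_eq_iff)
    ultimately show "{a, c} \<in> F \<longleftrightarrow> ({a, b} \<in> F) \<noteq> ({b, c} \<in> F)"
      by (auto simp: Int_insert_right split: if_splits)
  qed
  ultimately show ?thesis using F unfolding witness_def good_def by blast
qed

section \<open>Witnesses with few edges\<close>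

definition pairs :: "'a set \<Rightarrow> 'a set set" where
  "pairs A = {e. e \<subseteq> A \<and> card e = 2}"

definition nbr :: "'a set set \<Rightarrow> 'a \<Rightarrow> 'a set" where
  "nbr E v = {w. {v, w} \<in> E}"

definition codeg :: "'a set set \<Rightarrow> 'a \<Rightarrow> 'a \<Rightarrow> nat" where
  "codeg E v w = card (nbr E v \<inter> nbr E w)"

text \<open>Ordered edges turn degree sums into cardinalities of \<open>Sigma\<close> sets and allow
  an edge to be charged separately at its two ends.\<close>

definition arcs :: "'a set set \<Rightarrow> ('a \<times> 'a) set" where
  "arcs E = {(x, y). {x, y} \<in> E}"

lemma all_edges_eq_pairs: "all_edges n = pairs {1..n}"
  by (simp add: all_edges_def pairs_def)

lemma finite_pairs [simp]: "finite A \<Longrightarrow> finite (pairs A)"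
  by (simp add: pairs_def)

lemma pairs_empty [simp]: "pairs {} = {}"
  by (auto simp: pairs_def)

lemma pairs_doubleton [simp]: "{x, y} \<in> pairs A \<longleftrightarrow> x \<in> A \<and> y \<in> A \<and> x \<noteq> y"
  by (auto simp: pairs_def card_insert_if)

lemma singleton_notin_pairs [simp]: "{x} \<notin> pairs A"
  by (simp add: pairs_def)

lemma pairs_cases:
  assumes "e \<in> pairs A"
  obtains x y where "e = {x, y}" "x \<in> A" "y \<in> A" "x \<noteq> y"
  using assms unfolding pairs_def by (auto simp: card_2_iff)

lemma nbr_iff: "w \<in> nbr E v \<longleftrightarrow> {v, w} \<in> E"
  by (simp add: nbr_def)

lemma nbr_subset: "E \<subseteq> pairs V \<Longrightarrow> nbr E v \<subseteq> V - {v}"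
  unfolding nbr_def by (auto dest!: subsetD)

lemma card_arcs:
  assumes "finite G" "G \<subseteq> pairs V"
  shows "card (arcs G) = 2 * card G"
proof -
  let ?a = "\<lambda>e. {(x, y). {x, y} = e}"
  have *: "finite (?a e) \<and> card (?a e) = 2" if e: "e \<in> G" for e
  proof -
    obtain a b where ab: "e = {a, b}" "a \<noteq> b" using assms(2) e by (blast elim: pairs_cases)
    then have "?a e = {(a, b), (b, a)}" by (auto simp: doubleton_eq_iff)
    then show ?thesis using ab by simp
  qed
  have "arcs G = (\<Union>e\<in>G. ?a e)" by (auto simp: arcs_def)
  also have "card \<dots> = (\<Sum>e\<in>G. card (?a e))"
    using assms(1) * by (intro card_UN_disjoint) auto
  also have "\<dots> = 2 * card G" using * by simp
  finally show ?thesis .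
qed

lemma arcs_eq_Sigma:
  assumes "E \<subseteq> pairs V"
  shows "arcs E = Sigma V (nbr E)"
  using assms nbr_subset[OF assms] unfolding arcs_def by (auto simp: nbr_iff dest: subsetD)

text \<open>Every triangle meeting F contains exactly two of its edges, so counting the pairs
  (F-edge, triangle through it) by the edge and by the vertex shared by the two F-edges agree.\<close>

lemma sum_codeg_eq:
  assumes V: "finite V" and E: "E \<subseteq> pairs V" and F: "F \<subseteq> E" and ev: "triangle_even E F"
  shows "(\<Sum>(x, y)\<in>arcs F. codeg E x y) = 4 * (\<Sum>x\<in>V. card (E \<inter> pairs (nbr F x)))"
proof -
  have FV: "F \<subseteq> pairs V" using E F by auto
  have finE: "finite E" using E V finite_pairs finite_subset by blast
  have finn: "finite (nbr E x)" "finite (nbr F x)" for x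
    using nbr_subset[OF E] nbr_subset[OF FV] V by (meson finite_Diff finite_subset)+
  have finF: "finite (arcs F)" using arcs_eq_Sigma[OF FV] V finn by simp
  \<comment> \<open>Incidences of an ordered F-edge (x, y) with an apex z. \<open>L1\<close> and
    \<open>L2\<close> record whether the second F-edge of the triangle leaves x or y.\<close>
  define L where "L = (SIGMA q:arcs F. nbr E (fst q) \<inter> nbr E (snd q))"
  define L1 where "L1 = {((x, y), z). ((x, y), z) \<in> L \<and> {x, z} \<in> F}"
  define L2 where "L2 = {((x, y), z). ((x, y), z) \<in> L \<and> {y, z} \<in> F}"
  have finL: "finite L" unfolding L_def using finF finn by auto
  have fin12: "finite L1" "finite L2"
    by (rule finite_subset[OF _ finL], force simp: L1_def L2_def)+
  have "L = L1 \<union> L2" "L1 \<inter> L2 = {}"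
  proof -
    have x: "({x, z} \<in> F) \<noteq> ({y, z} \<in> F)" if "((x, y), z) \<in> L" for x y z
    proof -
      have 1: "{x, y} \<in> F" "{x, y} \<in> E" "{x, z} \<in> E" "{y, z} \<in> E"
        using that F by (auto simp: L_def arcs_def nbr_iff)
      then have "{x, z} \<in> F \<longleftrightarrow> ({x, y} \<in> F) \<noteq> ({y, z} \<in> F)"
        using ev unfolding triangle_even_def by blast
      then show ?thesis using 1 by blast
    qed
    then show "L1 \<inter> L2 = {}" unfolding L1_def L2_def by blast
    show "L = L1 \<union> L2" using x unfolding L1_def L2_def by auto
  qed
  then have "card L = card L1 + card L2" using fin12 by (simp add: card_Un_disjoint)
  moreover have "card L1 = card L2"
  proof (rule bij_betw_same_card)
    show "bij_betw (\<lambda>((x, y), z). ((y, x), z)) L1 L2"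
      by (rule bij_betw_byWitness[where f' = "\<lambda>((x, y), z). ((y, x), z)"])
        (auto simp: L1_def L2_def L_def arcs_def nbr_iff insert_commute)
  qed
  \<comment> \<open>Regrouped by the vertex x common to the two F-edges, (y, z) is an ordered edge
    inside the F-neighbourhood of x. Together with the equal share of \<open>L2\<close> this yields
    the factor 4.\<close>
  moreover have "card L1 = (\<Sum>x\<in>V. 2 * card (E \<inter> pairs (nbr F x)))"
  proof -
    let ?S = "SIGMA x:V. arcs (E \<inter> pairs (nbr F x))"
    have "card L1 = card ?S"
    proof (rule bij_betw_same_card)
      have 1: "y \<noteq> z" if "{y, z} \<in> E" for y z using subsetD[OF E that] by simp
      have 2: "x \<in> V" if "{x, y} \<in> F" for x y using subsetD[OF FV that] by simp
      show "bij_betw (\<lambda>((x, y), z). (x, (y, z))) L1 ?S"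
        by (rule bij_betw_byWitness[where f' = "\<lambda>(x, (y, z)). ((x, y), z)"])
          (use 1 2 F in \<open>auto simp: L1_def L_def arcs_def nbr_iff\<close>)
    qed
    also have "\<dots> = (\<Sum>x\<in>V. card (arcs (E \<inter> pairs (nbr F x))))"
    proof (rule card_SigmaI[OF V], rule ballI)
      fix x show "finite (arcs (E \<inter> pairs (nbr F x)))"
        by (rule finite_subset[of _ "nbr F x \<times> nbr F x"]) (use finn in \<open>auto simp: arcs_def\<close>)
    qed
    also have "\<dots> = (\<Sum>x\<in>V. 2 * card (E \<inter> pairs (nbr F x)))"
      by (rule sum.cong[OF refl], rule card_arcs[of _ V]) (use finE E in auto)
    finally show ?thesis .
  qed
  moreover have "card L = (\<Sum>(x, y)\<in>arcs F. codeg E x y)"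
    unfolding L_def codeg_def using finF finn by (subst card_SigmaI) (auto simp: case_prod_beta)
  ultimately show ?thesis by (simp add: sum_distrib_left[symmetric])
qed

text \<open>The parameters stand for L = np^2 and d = np. With a the number of F-arcs and h the
  number of those leaving heavy vertices, the total codegree is at most L(1.6 h + 2 \<epsilon> a),
  but at least 1.764 L h and at least \<gamma> L a / 3. The first lower bound makes h a bounded
  multiple of \<epsilon> a; the second then fails because \<gamma> \<ge> 100 \<epsilon>.\<close>

lemma no_small_witness:
  fixes V :: "nat set" and L d c c' \<epsilon> \<gamma> m :: real
  assumes V: "finite V" and E: "E \<subseteq> pairs V" and F: "F \<subseteq> E" "F \<noteq> {}" and ev: "triangle_even E F"
    and half: "\<And>v. v \<in> V \<Longrightarrow> 2 * card (nbr F v) \<le> card (nbr E v)"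
    and tri: "\<And>x y. {x, y} \<in> E \<Longrightarrow> \<exists>z. {x, z} \<in> E \<and> {y, z} \<in> E"
    and P1: "\<And>v D. v \<in> V \<Longrightarrow> D \<subseteq> nbr E v \<Longrightarrow> 2 * card D \<le> card (nbr E v) \<Longrightarrow>
              2 * real (card (E \<inter> pairs D)) \<le> 0.8 * L * card D"
    and P2: "\<And>D. D \<subseteq> V \<Longrightarrow> card D \<le> c * d \<Longrightarrow> 2 * real (card (E \<inter> pairs D)) \<le> \<epsilon> * L * card D"
    and P3: "\<And>A. A \<subseteq> V \<Longrightarrow> card A \<le> m \<Longrightarrow> real (card (E \<inter> pairs A)) \<le> c' * d * card A"
    and P4: "\<And>v. v \<in> V \<Longrightarrow> real (card {w \<in> nbr E v. codeg E v w < 0.9 * L}) \<le> c' * d"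
    and P5: "\<And>v w w'. v \<in> V \<Longrightarrow> w \<in> nbr E v \<Longrightarrow> w' \<in> nbr E v \<Longrightarrow> codeg E v w < \<gamma> * L \<Longrightarrow>
              codeg E v w' < \<gamma> * L \<Longrightarrow> w = w'"
    and small: "2 * real (card F) \<le> m * (c * d)"
    and pos: "L > 0" "d > 0" "c > 0" "c' > 0" "\<gamma> > 0" "\<epsilon> > 0" and cc: "100 * c' \<le> c" "100 * \<epsilon> \<le> \<gamma>"
  shows False
proof -
  have FV: "F \<subseteq> pairs V" using E F by auto
  have fin: "finite E" "finite F" using E F V finite_pairs finite_subset by metis+
  have finn: "finite (nbr E x)" "finite (nbr F x)" for x
    using nbr_subset[OF E] nbr_subset[OF FV] V by (meson finite_Diff finite_subset)+
  have finA: "finite (arcs F)" using arcs_eq_Sigma[OF FV] V finn by simp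
  define Hv where "Hv = {x \<in> V. card (nbr F x) > c * d}"
  define h where "h = (\<Sum>x\<in>Hv. real (card (nbr F x)))"
  define a where "a = real (card (arcs F))"
  have Hv: "Hv \<subseteq> V" "finite Hv" using V by (auto simp: Hv_def)
  have a2: "a = 2 * card F" unfolding a_def using card_arcs[OF fin(2) FV] by simp
  have a_sum: "a = (\<Sum>x\<in>V. real (card (nbr F x)))"
    unfolding a_def arcs_eq_Sigma[OF FV] using V finn by simp
  have "a > 0" using a2 F fin by (simp add: card_gt_0_iff)
  have h0: "h \<ge> 0" unfolding h_def by (simp add: sum_nonneg)
  have Hv_h: "card Hv * (c * d) \<le> h"
    unfolding h_def using sum_bounded_below[of Hv "c * d" "\<lambda>x. real (card (nbr F x))"]
    by (auto simp: Hv_def)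
  have "h \<le> a" unfolding h_def a_sum using V Hv by (intro sum_mono2) auto
  then have "card Hv * (c * d) \<le> m * (c * d)" using Hv_h a2 small by linarith
  \<comment> \<open>The bound on card F is what brings the heavy set into the range of
    \<open>P3\<close>.\<close>
  then have Hvm: "card Hv \<le> m" using pos by simp
  define \<Sigma> where "\<Sigma> = (\<Sum>(x, y)\<in>arcs F. real (codeg E x y))"
  have "real (\<Sum>(x, y)\<in>arcs F. codeg E x y) = \<Sigma>"
    unfolding \<Sigma>_def by (simp add: case_prod_beta)
  then have "\<Sigma> = 2 * (\<Sum>x\<in>V. 2 * real (card (E \<inter> pairs (nbr F x))))"
    using sum_codeg_eq[OF V E F(1) ev] by (simp add: sum_distrib_left[symmetric])
  also have "(\<Sum>x\<in>V. 2 * real (card (E \<inter> pairs (nbr F x))))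
      \<le> (\<Sum>x\<in>V. (if x \<in> Hv then 0.8 * L * card (nbr F x) else 0) + \<epsilon> * L * card (nbr F x))"
  proof (rule sum_mono)
    fix x assume x: "x \<in> V"
    have sub: "nbr F x \<subseteq> nbr E x" "nbr F x \<subseteq> V"
      using F nbr_subset[OF FV] by (auto simp: nbr_iff)
    show "2 * real (card (E \<inter> pairs (nbr F x)))
      \<le> (if x \<in> Hv then 0.8 * L * card (nbr F x) else 0) + \<epsilon> * L * card (nbr F x)"
    proof (cases "x \<in> Hv")
      case True
      have "0 \<le> \<epsilon> * L * card (nbr F x)" using pos by simp
      then show ?thesis using True P1[OF x sub(1) half[OF x]] by simp
    next
      case False
      then have "card (nbr F x) \<le> c * d" using x by (auto simp: Hv_def)
      then show ?thesis using False P2[OF sub(2)] by simp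
    qed
  qed
  also have "\<dots> = 0.8 * L * h + \<epsilon> * L * a"
    unfolding sum.distrib h_def a_sum sum_distrib_left using V Hv
    by (simp add: sum.If_cases Int_absorb1)
  finally have up: "\<Sigma> \<le> L * (1.6 * h + 2 * \<epsilon> * a)" by (simp add: algebra_simps)
  have low: "t * L * card Q \<le> \<Sigma>" if "Q \<subseteq> arcs F" "\<And>x y. (x, y) \<in> Q \<Longrightarrow> codeg E x y \<ge> t * L" for t Q
  proof -
    have "t * L * card Q \<le> (\<Sum>(x, y)\<in>Q. real (codeg E x y))"
      using sum_bounded_below[of Q "t * L" "\<lambda>(x, y). real (codeg E x y)"] that(2) by (auto simp: mult_ac)
    also have "\<dots> \<le> \<Sigma>" unfolding \<Sigma>_def using that(1) finA by (intro sum_mono2) auto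
    finally show ?thesis .
  qed
  \<comment> \<open>Q consists of the F-arcs into or out of heavy vertices whose codegree is at
    least 0.9 L. From 2h one loses 2c'd card Hv for arcs inside \<open>Hv\<close> and as much again
    for arcs of low codegree; as c'd card Hv \<le> h/100, at least 1.96 h arcs remain.\<close>
  have "0.9 * L * (1.96 * h) \<le> \<Sigma>"
  proof -
    define P where "P = (SIGMA x:Hv. nbr F x)"
    define P' where "P' = prod.swap ` P"
    define R where "R = (SIGMA x:Hv. {w \<in> nbr E x. codeg E x w < 0.9 * L})"
    define R' where "R' = prod.swap ` R"
    define Q where "Q = (P \<union> P') - (R \<union> R')"
    have finP: "finite P" "finite R" "finite P'" "finite R'"
      unfolding P_def R_def P'_def R'_def using Hv finn by auto
    have cP: "real (card P) = h" unfolding P_def h_def using Hv finn by simp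
    have cP': "card P' = card P" "card R' = card R" unfolding P'_def R'_def by (auto intro!: card_image)
    have "real (card R) = (\<Sum>x\<in>Hv. real (card {w \<in> nbr E x. codeg E x w < 0.9 * L}))"
      unfolding R_def using Hv finn by simp
    also have "\<dots> \<le> card Hv * (c' * d)"
      using sum_bounded_above[of Hv "\<lambda>x. real (card {w \<in> nbr E x. codeg E x w < 0.9 * L})" "c' * d"] P4 Hv
      by auto
    finally have cR: "real (card R) \<le> card Hv * (c' * d)" .
    have "{x} \<notin> F" for x using subsetD[OF FV, of "{x}"] by auto
    then have "P \<inter> P' \<subseteq> arcs (E \<inter> pairs Hv)"
      using F by (auto simp: P_def P'_def arcs_def nbr_iff insert_commute)
    then have "card (P \<inter> P') \<le> card (arcs (E \<inter> pairs Hv))"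
      using Hv by (intro card_mono) (auto simp: arcs_def intro: finite_subset[of _ "Hv \<times> Hv"])
    also have "\<dots> = 2 * card (E \<inter> pairs Hv)" using fin E by (intro card_arcs[of _ V]) auto
    finally have "real (card (P \<inter> P')) \<le> 2 * real (card (E \<inter> pairs Hv))" by linarith
    also have "\<dots> \<le> 2 * (c' * d * card Hv)" using P3[OF Hv(1) Hvm] by simp
    finally have cPP: "real (card (P \<inter> P')) \<le> 2 * (c' * d * card Hv)" .
    have "card (P \<union> P') + card (P \<inter> P') = 2 * card P" using card_Un_Int[OF finP(1,3)] cP' by simp
    then have 1: "real (card (P \<union> P')) + card (P \<inter> P') = 2 * h"
      using cP by (metis of_nat_add of_nat_mult of_nat_numeral)
    have "card (P \<union> P') - card (R \<union> R') \<le> card Q"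
      unfolding Q_def using finP by (intro diff_card_le_card_Diff) auto
    moreover have "card (R \<union> R') \<le> 2 * card R" using card_Un_le[of R R'] cP' by simp
    ultimately have "card (P \<union> P') \<le> card Q + 2 * card R" by linarith
    then have 2: "real (card (P \<union> P')) \<le> card Q + 2 * card R" by linarith
    have "100 * (c' * d * card Hv) \<le> card Hv * (c * d)"
      using mult_right_mono[OF cc(1), of "d * card Hv"] pos by (simp add: mult_ac)
    then have "c' * d * card Hv \<le> h / 100" using Hv_h by linarith
    then have "1.96 * h \<le> card Q" using 1 2 cR cPP by (simp add: mult_ac)
    then have "0.9 * L * (1.96 * h) \<le> 0.9 * L * card Q" using pos by (intro mult_left_mono) auto
    also have "\<dots> \<le> \<Sigma>"
    proof (rule low)
      show "Q \<subseteq> arcs F" by (auto simp: Q_def P_def P'_def arcs_def nbr_iff insert_commute)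
      fix x y assume "(x, y) \<in> Q"
      then show "0.9 * L \<le> codeg E x y" using F
        by (auto simp: Q_def P_def P'_def R_def R'_def nbr_iff insert_commute codeg_def Int_commute
            not_less image_iff)
    qed
    finally show ?thesis .
  qed
  then have "L * (1.764 * h) \<le> L * (1.6 * h + 2 * \<epsilon> * a)" using up by simp
  then have hb: "0.164 * h \<le> 2 * \<epsilon> * a" using pos by simp
  \<comment> \<open>A poor F-edge lies in a triangle with a second F-edge, which is not poor because
    at most one poor edge meets the shared vertex. A rich arc is charged by itself and by the two
    orientations of the poor edge at its first vertex, so at least a third of the arcs are
    rich.\<close>
  have "\<gamma> * L * (a / 3) \<le> \<Sigma>"
  proof -
    define Q where "Q = {(x, y) \<in> arcs F. codeg E x y \<ge> \<gamma> * L}"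
    define poor where "poor = (\<lambda>x. {y \<in> nbr E x. codeg E x y < \<gamma> * L})"
    have finQ: "finite Q" unfolding Q_def using finA by (auto intro: finite_subset[rotated])
    have poor1: "card (poor x) \<le> 1" "finite (poor x)" if "x \<in> V" for x
    proof -
      show "finite (poor x)" using finn by (simp add: poor_def)
      then show "card (poor x) \<le> 1"
        using P5[OF that] by (subst card_le_Suc0_iff_eq[folded One_nat_def]) (auto simp: poor_def)
    qed
    have cs: "codeg E x y = codeg E y x" for x y by (simp add: codeg_def Int_commute)
    have FE: "{x, y} \<in> F \<Longrightarrow> {x, y} \<in> E" for x y using F by auto
    have inV: "{x, y} \<in> E \<Longrightarrow> x \<in> V" "{x, y} \<in> E \<Longrightarrow> y \<in> V" "{x, y} \<in> E \<Longrightarrow> x \<noteq> y" for x y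
      using subsetD[OF E, of "{x, y}"] by simp_all
    let ?N = "\<lambda>q. {fst q} \<times> poor (fst q) \<union> poor (fst q) \<times> {fst q}"
    have cN: "card (?N q) \<le> 2" "finite (?N q)" if "q \<in> Q" for q
    proof -
      have "fst q \<in> V" using that by (auto simp: Q_def arcs_def intro: inV(1)[OF FE])
      note p = poor1[OF this]
      show "finite (?N q)" using p by simp
      have "card (?N q) \<le> card ({fst q} \<times> poor (fst q)) + card (poor (fst q) \<times> {fst q})" by (rule card_Un_le)
      then show "card (?N q) \<le> 2" using p by (simp add: card_cartesian_product)
    qed
    have "arcs F \<subseteq> Q \<union> (\<Union>q\<in>Q. ?N q)"
    proof
      fix q assume "q \<in> arcs F"
      then obtain x y where q: "q = (x, y)" "{x, y} \<in> F" by (auto simp: arcs_def)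
      show "q \<in> Q \<union> (\<Union>q\<in>Q. ?N q)"
      proof (cases "codeg E x y \<ge> \<gamma> * L")
        case True
        then show ?thesis using q by (auto simp: Q_def arcs_def)
      next
        case False
        obtain z where z: "{x, z} \<in> E" "{y, z} \<in> E" using tri FE q(2) by blast
        have xy: "x \<in> nbr E y" "y \<in> nbr E x" using FE[OF q(2)] by (auto simp: nbr_iff insert_commute)
        have ne: "z \<noteq> x" "z \<noteq> y" using inV(3)[OF z(1)] inV(3)[OF z(2)] by auto
        have V2: "x \<in> V" "y \<in> V" using inV[OF z(1)] inV[OF z(2)] by auto
        have "{x, z} \<in> F \<longleftrightarrow> ({x, y} \<in> F) \<noteq> ({y, z} \<in> F)"
          using ev z FE[OF q(2)] unfolding triangle_even_def by blast
        then consider "{x, z} \<in> F" | "{y, z} \<in> F" using q(2) by blast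
        then show ?thesis
        proof cases
          case 1
          have "codeg E x z \<ge> \<gamma> * L"
            by (rule ccontr) (use P5[OF V2(1) xy(2), of z] z(1) ne False in \<open>auto simp: nbr_iff\<close>)
          then have "(x, z) \<in> Q" using 1 by (auto simp: Q_def arcs_def)
          moreover have "q \<in> ?N (x, z)" using q False xy by (auto simp: poor_def)
          ultimately show ?thesis by blast
        next
          case 2
          have "codeg E y z \<ge> \<gamma> * L"
            by (rule ccontr) (use P5[OF V2(2) xy(1), of z] z(2) ne False cs[of x y] in \<open>auto simp: nbr_iff\<close>)
          then have "(y, z) \<in> Q" using 2 by (auto simp: Q_def arcs_def)
          moreover have "q \<in> ?N (y, z)" using q False xy cs[of x y] by (auto simp: poor_def)
          ultimately show ?thesis by blast
        qed
      qed
    qed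
    then have "card (arcs F) \<le> card (Q \<union> (\<Union>q\<in>Q. ?N q))"
      using finQ cN by (intro card_mono) auto
    also have "\<dots> \<le> card Q + card (\<Union>q\<in>Q. ?N q)" by (rule card_Un_le)
    also have "card (\<Union>q\<in>Q. ?N q) \<le> (\<Sum>q\<in>Q. card (?N q))" by (rule card_UN_le[OF finQ])
    also have "\<dots> \<le> card Q * 2" using sum_bounded_above[of Q "\<lambda>q. card (?N q)" 2] cN by auto
    finally have "a / 3 \<le> card Q" unfolding a_def by simp
    then have "\<gamma> * L * (a / 3) \<le> \<gamma> * L * card Q" using pos by (intro mult_left_mono) auto
    also have "\<dots> \<le> \<Sigma>" by (rule low) (auto simp: Q_def)
    finally show ?thesis .
  qed
  then have "\<gamma> * L * (a / 3) \<le> L * (1.6 * h + 2 * \<epsilon> * a)" using up by linarith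
  then have "L * (\<gamma> * (a / 3)) \<le> L * (1.6 * h + 2 * \<epsilon> * a)" by (simp only: ac_simps)
  then have "\<gamma> * (a / 3) \<le> 1.6 * h + 2 * \<epsilon> * a" using pos by simp
  moreover have "100 * (\<epsilon> * a) \<le> \<gamma> * a" using cc(2) \<open>a > 0\<close> by simp
  moreover have "0 < \<epsilon> * a" using \<open>a > 0\<close> pos by simp
  ultimately show False using hb by simp
qed

section \<open>Typical graphs\<close>

definition cross :: "'a set \<Rightarrow> 'a set \<Rightarrow> 'a set set" where
  "cross A B = (\<lambda>(a, b). {a, b}) ` (A \<times> B)"

lemma cross_iff: "e \<in> cross A B \<longleftrightarrow> (\<exists>a\<in>A. \<exists>b\<in>B. e = {a, b})"
  by (auto simp: cross_def)

lemma finite_cross [simp]: "finite A \<Longrightarrow> finite B \<Longrightarrow> finite (cross A B)"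
  by (simp add: cross_def)

lemma inj_on_doubleton: "A \<inter> B = {} \<Longrightarrow> inj_on (\<lambda>(a, b). {a, b}) (A \<times> B)"
  by (auto simp: inj_on_def doubleton_eq_iff)

lemma card_cross: "A \<inter> B = {} \<Longrightarrow> card (cross A B) = card A * card B"
  unfolding cross_def by (simp add: card_image[OF inj_on_doubleton] card_cartesian_product)

lemma cross_subset_pairs: "A \<subseteq> V \<Longrightarrow> B \<subseteq> V \<Longrightarrow> A \<inter> B = {} \<Longrightarrow> cross A B \<subseteq> pairs V"
  by (auto simp: cross_def)

lemma card_cross_le_sum:
  assumes "finite A" "finite B"
  shows "card (E \<inter> cross A B) \<le> (\<Sum>a\<in>A. card (nbr E a \<inter> B))"
proof -
  have "E \<inter> cross A B \<subseteq> (\<lambda>(a, b). {a, b}) ` (SIGMA a:A. nbr E a \<inter> B)"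
    by (force simp: cross_def nbr_iff)
  then have "card (E \<inter> cross A B) \<le> card ((\<lambda>(a, b). {a, b}) ` (SIGMA a:A. nbr E a \<inter> B))"
    using assms by (intro card_mono) auto
  also have "\<dots> \<le> card (SIGMA a:A. nbr E a \<inter> B)" using assms by (intro card_image_le) auto
  also have "\<dots> = (\<Sum>a\<in>A. card (nbr E a \<inter> B))" using assms by simp
  finally show ?thesis .
qed

lemma card_pairs: "finite D \<Longrightarrow> 2 * real (card (pairs D)) = real (card D) * (real (card D) - 1)"
proof -
  assume "finite D"
  then have "card (pairs D) = card D choose 2" unfolding pairs_def by (rule n_subsets)
  moreover have "even (card D * (card D - 1))" by (cases "card D") auto
  ultimately have "2 * card (pairs D) = card D * (card D - 1)" by (simp add: choose_two)
  then have "real (2 * card (pairs D)) = real (card D * (card D - 1))" by simp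
  then show ?thesis by (cases "card D") (auto simp: algebra_simps)
qed

lemma card_pairs_le: "finite D \<Longrightarrow> 2 * real (card (pairs D)) \<le> real (card D) * real (card D)"
  using card_pairs[of D] by (simp add: algebra_simps)

lemma pairs_mono: "A \<subseteq> B \<Longrightarrow> pairs A \<subseteq> pairs B"
  by (auto simp: pairs_def)

lemma pairs_star: "v \<in> V \<Longrightarrow> pairs V = (\<lambda>w. {v, w}) ` (V - {v}) \<union> pairs (V - {v})"
proof (intro equalityI subsetI)
  fix e assume v: "v \<in> V" and "e \<in> pairs V"
  then obtain x y where "e = {x, y}" "x \<in> V" "y \<in> V" "x \<noteq> y" by (blast elim: pairs_cases)
  then show "e \<in> (\<lambda>w. {v, w}) ` (V - {v}) \<union> pairs (V - {v})"
    by (cases "x = v"; cases "y = v") (auto simp: insert_commute)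
qed (auto simp: pairs_def)

text \<open>Two-round exposure at v: its neighbourhood N is a random subset of V - {v}, and the
  graph off v is independent of it. Codegrees with v then become degrees into a fixed set.\<close>

lemma prob_star:
  assumes "finite V" "v \<in> V"
  shows "prob p (pairs V) (\<lambda>E. P (nbr E v) (E \<inter> pairs (V - {v})))
    = expect p (V - {v}) (\<lambda>N. prob p (pairs (V - {v})) (P N))"
proof -
  let ?g = "\<lambda>w. {v, w}"
  have inj: "inj_on ?g (V - {v})" by (auto simp: inj_on_def doubleton_eq_iff)
  have disj: "?g ` (V - {v}) \<inter> pairs (V - {v}) = {}" by (auto simp: pairs_def)
  have "prob p (pairs V) (\<lambda>E. P (nbr E v) (E \<inter> pairs (V - {v})))
    = expect p (?g ` (V - {v})) (\<lambda>A. prob p (pairs (V - {v}))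
        (\<lambda>B. P (nbr (A \<union> B) v) ((A \<union> B) \<inter> pairs (V - {v}))))"
    unfolding pairs_star[OF assms(2)] using assms disj
    by (subst prob_union) (auto simp: pairs_star[symmetric])
  also have "\<dots> = expect p (V - {v}) (\<lambda>N. prob p (pairs (V - {v}))
        (\<lambda>B. P (nbr (?g ` N \<union> B) v) ((?g ` N \<union> B) \<inter> pairs (V - {v}))))"
    using assms inj by (subst expect_image) auto
  also have "\<dots> = expect p (V - {v}) (\<lambda>N. prob p (pairs (V - {v})) (P N))"
  proof (intro expect_cong prob_cong)
    fix N B assume *: "N \<subseteq> V - {v}" "B \<subseteq> pairs (V - {v})"
    have "nbr (?g ` N \<union> B) v = N" using * by (auto simp: nbr_def doubleton_eq_iff pairs_def)
    moreover have "(?g ` N \<union> B) \<inter> pairs (V - {v}) = B" using * by (auto simp: pairs_def)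
    ultimately show "P (nbr (?g ` N \<union> B) v) ((?g ` N \<union> B) \<inter> pairs (V - {v})) \<longleftrightarrow> P N B" by simp
  qed
  finally show ?thesis .
qed

text \<open>The binomial theorem, read off from \<open>expect_power\<close> at probability 1/2,
  where all subsets have equal weight.\<close>

lemma sum_Pow_power:
  assumes "finite V"
  shows "(\<Sum>D\<in>Pow V. q ^ card D) = (1 + q :: real) ^ card V"
proof -
  have "expect (1/2) V (\<lambda>E. q ^ card E) = (\<Sum>D\<in>Pow V. (1/2) ^ card V * q ^ card D)"
    unfolding expect_def
  proof (rule sum.cong[OF refl])
    fix E assume "E \<in> Pow V"
    then have "card E \<le> card V" using assms by (auto intro: card_mono)
    then have "(1/2 :: real) ^ card V = (1/2) ^ card E * (1/2) ^ (card V - card E)"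
      by (simp add: power_add[symmetric])
    then show "(1/2) ^ card E * (1 - 1/2) ^ (card V - card E) * q ^ card E = (1/2) ^ card V * q ^ card E" by simp
  qed
  then have "(1/2) ^ card V * (\<Sum>D\<in>Pow V. q ^ card D) = ((1 + q) / 2) ^ card V"
    using expect_power[OF assms, of "1/2" q] by (simp add: sum_distrib_left add_divide_distrib)
  then show ?thesis by (simp add: field_simps)
qed

section \<open>Failure probabilities of degree, density and codegree conditions\<close>

context
  fixes p :: real and V :: "'v set" and n :: nat
  assumes p01: "0 \<le> p" "p \<le> 1" and V: "finite V" "card V = n"
begin

text \<open>A union bound over sets of all sizes at once. Assumption \<open>k\<close> bounds the
  failure probability of D by \<open>q ^ card D\<close> with q = n^(-2), and over nonempty D these
  sum to (1 + q)^n - 1 \<le> exp(1/n) - 1. The parameter z is the exponential tilt.\<close>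

lemma dense_sets_prob:
  fixes lam a0 z :: real
  assumes "z \<ge> 1" "a0 \<ge> 0" "n \<ge> 1" and k: "lam * ln z - p * (z - 1) * a0 / 2 \<ge> 2 * ln n"
  shows "prob p (pairs V) (\<lambda>E. \<exists>D\<subseteq>V. card D \<le> a0 \<and> lam * card D < card (E \<inter> pairs D)) \<le> exp (1 / n) - 1"
proof -
  define q where "q = exp (- 2 * ln (real n))"
  let ?I = "Pow V - {{}}"
  have "prob p (pairs V) (\<lambda>E. \<exists>D\<subseteq>V. card D \<le> a0 \<and> lam * card D < card (E \<inter> pairs D))
    \<le> (\<Sum>D\<in>?I. prob p (pairs V) (\<lambda>E. card D \<le> a0 \<and> lam * card D < card (E \<inter> pairs D)))"
  proof (rule prob_Bex[OF p01])
    fix E assume "\<exists>D\<subseteq>V. card D \<le> a0 \<and> lam * card D < card (E \<inter> pairs D)"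
    then obtain D where "D \<subseteq> V" "card D \<le> a0 \<and> lam * card D < card (E \<inter> pairs D)" by blast
    moreover from this have "D \<noteq> {}" by auto
    ultimately show "\<exists>D\<in>?I. card D \<le> a0 \<and> lam * card D < card (E \<inter> pairs D)" by blast
  qed (use V in auto)
  also have "\<dots> \<le> (\<Sum>D\<in>?I. q ^ card D)"
  proof (rule sum_mono)
    fix D assume "D \<in> ?I"
    then have D: "D \<subseteq> V" "finite D" using V finite_subset by auto
    show "prob p (pairs V) (\<lambda>E. card D \<le> a0 \<and> lam * card D < card (E \<inter> pairs D)) \<le> q ^ card D"
    proof (cases "card D \<le> a0")
      case True
      have "prob p (pairs V) (\<lambda>E. card D \<le> a0 \<and> lam * card D < card (E \<inter> pairs D))
        \<le> exp (p * (z - 1) * card (pairs D) - lam * card D * ln z)"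
        by (rule chernoff_upper[OF p01]) (use V D pairs_mono assms in auto)
      also have "\<dots> \<le> exp (card D * (- 2 * ln n))"
      proof -
        have "2 * real (card (pairs D)) \<le> card D * a0"
          using card_pairs_le[OF D(2)] mult_left_mono[OF True, of "card D"] by simp
        then have "p * (z - 1) * real (card (pairs D)) \<le> p * (z - 1) * (card D * a0 / 2)"
          using p01 assms by (intro mult_left_mono) auto
        moreover have "card D * (2 * ln n) \<le> card D * (lam * ln z - p * (z - 1) * a0 / 2)"
          using k by (intro mult_left_mono) auto
        moreover have "p * (z - 1) * (card D * a0 / 2) = card D * (p * (z - 1) * a0 / 2)" by simp
        moreover have "card D * (lam * ln z - p * (z - 1) * a0 / 2)
            = lam * card D * ln z - card D * (p * (z - 1) * a0 / 2)" by (simp only: right_diff_distrib) simp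
        moreover have "card D * (- 2 * ln n) = - (card D * (2 * ln n))" by simp
        ultimately have "p * (z - 1) * card (pairs D) - lam * card D * ln z \<le> card D * (- 2 * ln n)"
          by linarith
        then show ?thesis by simp
      qed
      also have "\<dots> = q ^ card D" unfolding q_def by (rule exp_of_nat_mult)
      finally show ?thesis .
    next
      case False
      then have "prob p (pairs V) (\<lambda>E. card D \<le> a0 \<and> lam * card D < card (E \<inter> pairs D)) = 0"
        using V by (simp add: prob_def)
      then show ?thesis by (simp add: q_def)
    qed
  qed
  also have "\<dots> = (1 + q) ^ n - 1"
    using V sum_Pow_power[of V q] by (simp add: sum_diff1)
  also have "\<dots> \<le> exp q ^ n - 1"
    using exp_ge_add_one_self[of q] by (simp add: power_mono q_def)
  also have "\<dots> = exp (n * q) - 1" by (simp add: exp_of_nat_mult)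
  also have "n * q = 1 / n"
    using \<open>n \<ge> 1\<close> exp_of_nat_mult[of 2 "ln (real n)"] unfolding q_def
    by (simp add: exp_minus field_simps power2_eq_square)
  finally show ?thesis .
qed

text \<open>R carries what is known about the degree of v, so that the bound has to be shown only
  for each fixed regular N.\<close>

lemma prob_nbr_le:
  assumes "v \<in> V" "\<And>N. N \<subseteq> V - {v} \<Longrightarrow> R N \<Longrightarrow> prob p (pairs (V - {v})) (P N) \<le> b" "0 \<le> b"
  shows "prob p (pairs V) (\<lambda>E. R (nbr E v) \<and> P (nbr E v) (E \<inter> pairs (V - {v}))) \<le> b"
proof -
  have "prob p (pairs V) (\<lambda>E. R (nbr E v) \<and> P (nbr E v) (E \<inter> pairs (V - {v})))
    = expect p (V - {v}) (\<lambda>N. prob p (pairs (V - {v})) (\<lambda>E. R N \<and> P N E))"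
    by (rule prob_star[where P = "\<lambda>N E. R N \<and> P N E"]) (use V assms in auto)
  also have "\<dots> \<le> b"
  proof (rule expect_le_const[OF p01])
    fix N assume N: "N \<subseteq> V - {v}"
    show "prob p (pairs (V - {v})) (\<lambda>E. R N \<and> P N E) \<le> b"
      using assms(2)[OF N] assms(3) V by (cases "R N") (simp_all add: prob_def)
  qed (use V in auto)
  finally show ?thesis .
qed

lemma degree_prob:
  assumes "v \<in> V" "n \<ge> 1"
  shows "prob p (pairs V) (\<lambda>E. \<not> (99/100 * (n * p) \<le> card (nbr E v) \<and> card (nbr E v) \<le> 101/100 * (n * p)))
     \<le> 6 * exp (- (n * p) / 100000)"
proof -
  have fin: "finite (V - {v})" and c: "real (card (V - {v})) = real n - 1" using V assms by (auto simp: of_nat_diff)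
  have "prob p (pairs V) (\<lambda>E. \<not> (99/100 * (n * p) \<le> card (nbr E v) \<and> card (nbr E v) \<le> 101/100 * (n * p)))
    = expect p (V - {v}) (\<lambda>N. prob p (pairs (V - {v})) (\<lambda>_. \<not> (99/100 * (n * p) \<le> card N \<and> card N \<le> 101/100 * (n * p))))"
    by (rule prob_star[where P = "\<lambda>N E. \<not> (99/100 * (n * p) \<le> card N \<and> card N \<le> 101/100 * (n * p))"])
      (use V assms in auto)
  also have "\<dots> = prob p (V - {v}) (\<lambda>N. \<not> (99/100 * (n * p) \<le> card N \<and> card N \<le> 101/100 * (n * p)))"
    unfolding prob_def[of p "V - {v}"] using V by (intro expect_cong) (simp add: prob_def)
  also have "\<dots> \<le> prob p (V - {v}) (\<lambda>N. 101/100 * (n * p) \<le> card (N \<inter> (V - {v})))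
     + prob p (V - {v}) (\<lambda>N. card (N \<inter> (V - {v})) \<le> 99/100 * (n * p))"
    by (rule prob_disj[OF p01]) (auto simp: Int_absorb2)
  also have "prob p (V - {v}) (\<lambda>N. 101/100 * (n * p) \<le> card (N \<inter> (V - {v})))
     \<le> exp (p * ((201/200) - 1) * card (V - {v}) - 101/100 * (n * p) * ln (201/200))"
    by (rule chernoff_upper[OF p01]) (use fin in auto)
  also have "\<dots> \<le> exp (- (n * p) / 100000)"
  proof -
    have "ln ((201/200)::real) \<ge> (1/200) - (1/200)\<^sup>2"
      using ln_one_plus_pos_lower_bound[of "(1/200)"] by simp
    then have "ln ((201/200)::real) \<ge> (199/40000)" by (simp add: power2_eq_square)
    then have "101/100 * (n * p) * ln (201/200) \<ge> 101/100 * (n * p) * (199/40000)"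
      using p01 by (intro mult_left_mono) auto
    moreover have "p * ((201/200) - 1) * card (V - {v}) = (1/200) * (n * p) - (1/200) * p"
      unfolding c by (simp add: field_simps)
    moreover have "0 \<le> n * p" using p01 by simp
    ultimately have "p * ((201/200) - 1) * card (V - {v}) - 101/100 * (n * p) * ln (201/200) \<le> - (n * p) / 100000"
      using p01 by linarith
    then show ?thesis by simp
  qed
  also have "prob p (V - {v}) (\<lambda>N. card (N \<inter> (V - {v})) \<le> 99/100 * (n * p))
     \<le> exp (p * ((399/400) - 1) * card (V - {v}) - 99/100 * (n * p) * ln (399/400))"
    by (rule chernoff_lower[OF p01]) (use fin in auto)
  \<comment> \<open>V - {v} has n - 1 elements; in the lower tail this shifts the exponent by less
    than 1, and the resulting factor e is absorbed into 5.\<close>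
  also have "\<dots> \<le> exp (1 - (n * p) / 100000)"
  proof -
    have "ln ((399/400)::real) \<ge> - (1/400) - 2 * (1/400)\<^sup>2"
      using ln_one_minus_pos_lower_bound[of "(1/400)"] by simp
    then have "ln ((399/400)::real) \<ge> - 201/80000" by (simp add: power2_eq_square)
    then have "99/100 * (n * p) * ln (399/400) \<ge> 99/100 * (n * p) * (- 201/80000)"
      using p01 by (intro mult_left_mono) auto
    moreover have "p * ((399/400) - 1) * card (V - {v}) = (1/400) * p - (1/400) * (n * p)"
      unfolding c by (simp add: field_simps)
    moreover have "0 \<le> n * p" using p01 by simp
    ultimately have "p * ((399/400) - 1) * card (V - {v}) - 99/100 * (n * p) * ln (399/400) \<le> 1 - (n * p) / 100000"
      using p01 by linarith
    then show ?thesis by simp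
  qed
  also have "exp (1 - (n * p) / 100000) \<le> 5 * exp (- (n * p) / 100000)"
  proof -
    have "exp (1 - (n * p) / 100000) = exp 1 * exp (- (n * p) / 100000)"
      by (simp add: exp_add[symmetric])
    also have "\<dots> \<le> 5 * exp (- (n * p) / 100000)" using exp_le by (intro mult_right_mono) auto
    finally show ?thesis .
  qed
  finally show ?thesis by simp
qed

text \<open>Summing over D leaves a single binomial variable. Only edges from D to N - D are
  counted, so that no pair is counted from both ends and there are card D * card (N - D) independent
  trials.\<close>

lemma codeg_low_prob:
  fixes t z :: real
  assumes "v \<in> V" "N \<subseteq> V - {v}" "D \<subseteq> N" "0 < z" "z \<le> 1"
  shows "prob p (pairs (V - {v})) (\<lambda>E. \<forall>w\<in>D. card (N \<inter> nbr E w) \<le> t)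
    \<le> exp (p * (z - 1) * (card D * card (N - D)) - t * card D * ln z)"
proof -
  have fin: "finite N" "finite D" using assms V by (meson finite_Diff finite_subset)+
  have cc: "card (cross D (N - D)) = card D * card (N - D)" by (rule card_cross) auto
  have "prob p (pairs (V - {v})) (\<lambda>E. \<forall>w\<in>D. card (N \<inter> nbr E w) \<le> t)
    \<le> exp (p * (z - 1) * card (cross D (N - D)) - t * card D * ln z)"
  proof (rule chernoff_lower[OF p01])
    show "cross D (N - D) \<subseteq> pairs (V - {v})" using assms by (intro cross_subset_pairs) auto
    fix E assume *: "\<forall>w\<in>D. card (N \<inter> nbr E w) \<le> t"
    have "real (card (E \<inter> cross D (N - D))) \<le> (\<Sum>w\<in>D. real (card (nbr E w \<inter> (N - D))))"
      using card_cross_le_sum[of D "N - D" E] fin by (simp flip: of_nat_sum)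
    also have "\<dots> \<le> (\<Sum>w\<in>D. t)"
    proof (rule sum_mono)
      fix w assume "w \<in> D"
      have "card (nbr E w \<inter> (N - D)) \<le> card (N \<inter> nbr E w)" using fin by (intro card_mono) auto
      then show "real (card (nbr E w \<inter> (N - D))) \<le> t" using * \<open>w \<in> D\<close> by fastforce
    qed
    finally show "card (E \<inter> cross D (N - D)) \<le> t * card D" by (simp add: mult.commute)
  qed (use assms V in auto)
  then show ?thesis unfolding cc by simp
qed

end

lemma ln_ge_one_minus_inverse: "x > 0 \<Longrightarrow> 1 - 1 / x \<le> ln (x::real)"
  using ln_le_minus_one[of "1 / x"] by (simp add: ln_div)

lemma exp_bound_mono: "(a::real) \<le> b \<Longrightarrow> t \<le> exp a \<Longrightarrow> t \<le> exp b"
  by (meson exp_le_cancel_iff order_trans)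

lemma two_power_le_exp: "(2::real) ^ k \<le> exp k"
proof -
  have "(2::real) ^ k \<le> exp 1 ^ k" using exp_ge_add_one_self[of 1] by (intro power_mono) auto
  then show ?thesis by (simp add: exp_of_nat_mult[symmetric])
qed

lemma card_subfamily_le_exp:
  fixes t :: real
  assumes "finite N" "I \<subseteq> Pow N" "card N \<le> t"
  shows "real (card I) \<le> exp t"
proof -
  have "card I \<le> 2 ^ card N" using card_mono[OF _ assms(2)] assms(1) by (simp add: card_Pow)
  then have "real (card I) \<le> real (2 ^ card N)" by (rule of_nat_mono)
  also have "\<dots> \<le> exp (card N)" using two_power_le_exp by simp
  also have "\<dots> \<le> exp t" using assms(3) by simp
  finally show ?thesis .
qed

context
  fixes p :: real and V :: "'v set" and n :: nat
  assumes p01: "0 \<le> p" "p \<le> 1" and V: "finite V" "card V = n"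
begin

text \<open>A set D of at most half of N spans about p|D|^2/2 edges, so twice their number is at
  most about 0.5 np^2 |D| and reaching 0.8 is a large deviation. For |D| > c np its exponent has
  order (np^2)(np), which beats the at most exp(2np) choices of D once np^2 is large.\<close>

lemma dense_nbhd_subset_prob:
  assumes v: "v \<in> V" and N: "N \<subseteq> V - {v}" "card N \<le> 101/100 * (n * p)" and c: "c > 0"
  shows "prob p (pairs (V - {v})) (\<lambda>E. \<exists>D\<subseteq>N. c * (n * p) < card D \<and> 2 * card D \<le> card N \<and>
      0.8 * (n * p\<^sup>2) * card D < 2 * real (card (E \<inter> pairs D)))
    \<le> exp (2 * (n * p) - (3/200) * c * (n * p\<^sup>2) * (n * p))"
    (is "prob p ?U (\<lambda>E. \<exists>D\<subseteq>N. ?Q D E) \<le> _")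
proof -
  have finN: "finite N" using N V by (meson finite_Diff finite_subset)
  have x0: "0 \<le> n * p\<^sup>2" and d0: "0 \<le> n * p" using p01 by auto
  let ?I = "{D. D \<subseteq> N \<and> c * (n * p) < card D \<and> 2 * card D \<le> card N}"
  have "prob p ?U (\<lambda>E. \<exists>D\<subseteq>N. ?Q D E) \<le> exp (2 * (n * p)) * exp (- (3/200) * c * (n * p\<^sup>2) * (n * p))"
  proof (rule prob_Bex_le[OF p01])
    show "finite ?I" using finN by simp
    show "real (card ?I) \<le> exp (2 * (n * p))"
      by (rule card_subfamily_le_exp[OF finN]) (use N d0 in auto)
  next
    fix D assume "D \<in> ?I"
    then have D: "D \<subseteq> N" "c * (n * p) < card D" "2 * card D \<le> card N" by auto
    have finD: "finite D" using D finN finite_subset by blast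
    have "2 * real (card D) \<le> card N" using D(3) by linarith
    then have "real (card D) \<le> 101/200 * (n * p)" using N by simp
    then have "card D * real (card D) \<le> card D * (101/200 * (n * p))" by (rule mult_left_mono) simp
    then have "real (card (pairs D)) \<le> 101/400 * (n * p) * card D"
      using card_pairs_le[OF finD] by (simp add: mult_ac)
    then have "p * (3/2 - 1) * real (card (pairs D)) \<le> p * (3/2 - 1) * (101/400 * (n * p) * card D)"
      using p01 by (intro mult_left_mono) auto
    also have "\<dots> = 101/800 * (n * p\<^sup>2 * card D)" by (simp add: power2_eq_square)
    finally have 1: "p * (3/2 - 1) * real (card (pairs D)) \<le> 101/800 * (n * p\<^sup>2 * card D)" .
    \<comment> \<open>Splitting 3/2 into two factors improves ln x \<ge> 1 - 1/x from 1/3 to 11/30;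
      the constant 3/200 in the exponent needs this.\<close>
    have "ln (3/2 :: real) = ln (5/4) + ln (6/5)"
      using ln_mult[of "5/4 :: real" "6/5"] by simp
    then have "ln (3/2 :: real) \<ge> 11/30"
      using ln_ge_one_minus_inverse[of "5/4"] ln_ge_one_minus_inverse[of "6/5"] by simp
    then have "2/5 * (n * p\<^sup>2 * card D) * ln (3/2) \<ge> 2/5 * (n * p\<^sup>2 * card D) * (11/30)"
      using x0 by (intro mult_left_mono) auto
    moreover have "n * p\<^sup>2 * (c * (n * p)) \<le> n * p\<^sup>2 * card D"
      using D x0 by (intro mult_left_mono) auto
    moreover have "- (3/200) * c * (n * p\<^sup>2) * (n * p) = - (3/200) * (n * p\<^sup>2 * (c * (n * p)))" by simp
    moreover have "0 \<le> n * p\<^sup>2 * card D" using x0 by simp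
    ultimately have 2: "p * (3/2 - 1) * card (pairs D) - 2/5 * (n * p\<^sup>2 * card D) * ln (3/2)
        \<le> - (3/200) * c * (n * p\<^sup>2) * (n * p)" using 1 by linarith
    show "prob p ?U (?Q D) \<le> exp (- (3/200) * c * (n * p\<^sup>2) * (n * p))"
      by (rule exp_bound_mono[OF 2], rule chernoff_upper[OF p01])
        (use V N D pairs_mono[of D "V - {v}"] in \<open>auto simp: mult_ac\<close>)
  qed auto
  then show ?thesis by (simp add: exp_add[symmetric])
qed

text \<open>Too many neighbours of low codegree contain a set D of exactly k of them. Since k \<le>
  np/100, removing D leaves nearly all of N, and 0.9 np^2 is still below the mean number of
  neighbours in N - D, which is at least 0.98 np^2.\<close>

lemma low_codeg_prob:
  assumes v: "v \<in> V" and N: "N \<subseteq> V - {v}" "card N \<le> 101/100 * (n * p)" "99/100 * (n * p) \<le> card N"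
    and c: "c > 0" "c \<le> 1/200" and np: "n * p \<ge> 200"
  shows "prob p (pairs (V - {v})) (\<lambda>E. c * (n * p) < card {w \<in> N. card (N \<inter> nbr E w) < 0.9 * (n * p\<^sup>2)})
    \<le> exp (2 * (n * p) - (1/1000) * c * (n * p\<^sup>2) * (n * p))"
    (is "prob p ?U ?Q \<le> _")
proof -
  have finN: "finite N" using N V by (meson finite_Diff finite_subset)
  have x0: "0 \<le> n * p\<^sup>2" and d0: "0 \<le> n * p" using p01 by auto
  define k where "k = nat \<lceil>c * (n * p)\<rceil>"
  have "0 \<le> c * (n * p)" using c d0 by simp
  then have k: "c * (n * p) \<le> k" "k \<le> c * (n * p) + 1" unfolding k_def by linarith+
  have "c * (n * p) \<le> (1/200) * (n * p)" using c np by (intro mult_right_mono) auto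
  then have k2: "k \<le> (1/100) * (n * p)" using k np by linarith
  let ?I = "{D. D \<subseteq> N \<and> card D = k}"
  have "prob p ?U ?Q \<le> exp (2 * (n * p)) * exp (- (1/1000) * c * (n * p\<^sup>2) * (n * p))"
  proof (rule prob_Bex_le[OF p01])
    show "finite ?I" using finN by simp
    show "real (card ?I) \<le> exp (2 * (n * p))"
      by (rule card_subfamily_le_exp[OF finN]) (use N d0 in auto)
  next
    fix E assume "?Q E"
    then have "k \<le> card {w \<in> N. card (N \<inter> nbr E w) < 0.9 * (n * p\<^sup>2)}" unfolding k_def by linarith
    then obtain D where "D \<subseteq> {w \<in> N. card (N \<inter> nbr E w) < 0.9 * (n * p\<^sup>2)}" "card D = k"
      by (rule obtain_subset_with_card_n)
    then show "\<exists>D\<in>?I. \<forall>w\<in>D. card (N \<inter> nbr E w) \<le> 9/10 * (n * p\<^sup>2)"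
      by (intro bexI[of _ D]) auto
  next
    fix D assume "D \<in> ?I"
    then have D: "D \<subseteq> N" "card D = k" by auto
    have finD: "finite D" using D finN finite_subset by blast
    have "real (card (N - D)) = card N - real k"
      using D finD card_mono[OF finN D(1)] by (simp add: card_Diff_subset of_nat_diff)
    then have "98/100 * (n * p) \<le> card (N - D)" using N k2 by simp
    then have "1/20 * (p * k) * (98/100 * (n * p)) \<le> 1/20 * (p * k) * card (N - D)"
      using p01 by (intro mult_left_mono) auto
    moreover have "1/20 * (p * k) * (98/100 * (n * p)) = 49/1000 * (n * p\<^sup>2 * k)" by (simp add: power2_eq_square)
    moreover have "p * (19/20 - 1) * (card D * card (N - D)) = - (1/20 * (p * k) * card (N - D))"
      using D by simp
    ultimately have 1: "p * (19/20 - 1) * (card D * card (N - D)) \<le> - 49/1000 * (n * p\<^sup>2 * k)" by linarith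
    have "ln (19/20 :: real) \<ge> - 1/19" using ln_ge_one_minus_inverse[of "19/20"] by simp
    then have "9/10 * (n * p\<^sup>2 * k) * ln (19/20) \<ge> 9/10 * (n * p\<^sup>2 * k) * (- 1/19)"
      using x0 by (intro mult_left_mono) auto
    moreover have "n * p\<^sup>2 * (c * (n * p)) \<le> n * p\<^sup>2 * k"
      using k x0 by (intro mult_left_mono) auto
    moreover have "- (1/1000) * c * (n * p\<^sup>2) * (n * p) = - (1/1000) * (n * p\<^sup>2 * (c * (n * p)))" by simp
    moreover have "0 \<le> n * p\<^sup>2 * k" using x0 by simp
    moreover have "9/10 * (n * p\<^sup>2) * card D * ln (19/20) = 9/10 * (n * p\<^sup>2 * k) * ln (19/20)"
      using D by simp
    ultimately have 2: "p * (19/20 - 1) * (card D * card (N - D)) - 9/10 * (n * p\<^sup>2) * card D * ln (19/20)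
        \<le> - (1/1000) * c * (n * p\<^sup>2) * (n * p)" using 1 by linarith
    show "prob p ?U (\<lambda>E. \<forall>w\<in>D. card (N \<inter> nbr E w) \<le> 9/10 * (n * p\<^sup>2))
        \<le> exp (- (1/1000) * c * (n * p\<^sup>2) * (n * p))"
      by (rule exp_bound_mono[OF 2], rule codeg_low_prob[OF p01 V v N(1) D(1)]) auto
  qed auto
  then show ?thesis by (simp add: exp_add[symmetric])
qed

text \<open>The rate has to come close to 2 np^2, the cost of two vertices having no neighbour in N.
  The tilt z = 1/64 loses little of it, and the threshold 1/200 is so small that the term with ln z
  costs only 0.047 np^2.\<close>

lemma poor_pair_prob:
  assumes v: "v \<in> V" and N: "N \<subseteq> V - {v}" "card N \<le> 101/100 * (n * p)" "99/100 * (n * p) \<le> card N"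
  shows "prob p (pairs (V - {v})) (\<lambda>E. \<exists>w\<in>N. \<exists>w'\<in>N. w \<noteq> w' \<and> card (N \<inter> nbr E w) < 1/200 * (n * p\<^sup>2) \<and>
      card (N \<inter> nbr E w') < 1/200 * (n * p\<^sup>2))
    \<le> (101/100 * (n * p))\<^sup>2 * exp (4 - 19/10 * (n * p\<^sup>2))"
    (is "prob p ?U ?Q \<le> _")
proof -
  have finN: "finite N" using N V by (meson finite_Diff finite_subset)
  have x0: "0 \<le> n * p\<^sup>2" and d0: "0 \<le> n * p" using p01 by auto
  let ?I = "{(w, w'). w \<in> N \<and> w' \<in> N \<and> w \<noteq> w'}"
  let ?P = "\<lambda>q E. \<forall>w\<in>{fst q, snd q}. card (N \<inter> nbr E w) \<le> 1/200 * (n * p\<^sup>2)"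
  have sub: "?I \<subseteq> N \<times> N" by auto
  show ?thesis
  proof (rule prob_Bex_le[OF p01, where I = ?I and Q = ?P])
    show "finite ?I" using finN finite_subset[OF sub] by simp
    have "card ?I \<le> card N * card N"
      using card_mono[OF _ sub] finN by (simp add: card_cartesian_product)
    then have "real (card ?I) \<le> real (card N * card N)" by (rule of_nat_mono)
    also have "\<dots> = card N * real (card N)" by simp
    also have "\<dots> \<le> (101/100 * (n * p)) * (101/100 * (n * p))" using N d0 by (intro mult_mono) auto
    finally show "real (card ?I) \<le> (101/100 * (n * p))\<^sup>2" by (simp add: power2_eq_square)
  next
    fix E assume "?Q E"
    then obtain w w' where "w \<in> N" "w' \<in> N" "w \<noteq> w'" "card (N \<inter> nbr E w) < 1/200 * (n * p\<^sup>2)"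
      "card (N \<inter> nbr E w') < 1/200 * (n * p\<^sup>2)" by blast
    then show "\<exists>q\<in>?I. ?P q E" by (intro bexI[of _ "(w, w')"]) auto
  next
    fix q assume "q \<in> ?I"
    then obtain w w' where q: "q = (w, w')" "w \<in> N" "w' \<in> N" "w \<noteq> w'" by auto
    have c2: "card {w, w'} = 2" using q by simp
    have "real (card (N - {w, w'})) = card N - real 2"
      using q finN card_mono[of N "{w, w'}"] by (simp add: card_Diff_subset of_nat_diff)
    then have "99/100 * (n * p) - 2 \<le> card (N - {w, w'})" using N by simp
    then have "63/32 * p * (99/100 * (n * p) - 2) \<le> 63/32 * p * card (N - {w, w'})"
      using p01 by (intro mult_left_mono) auto
    moreover have "63/32 * p * (99/100 * (n * p) - 2) = 6237/3200 * (n * p\<^sup>2) - 63/16 * p"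
      by (simp add: power2_eq_square right_diff_distrib)
    moreover have "p * (1/64 - 1) * (card {w, w'} * card (N - {w, w'})) = - (63/32 * p * card (N - {w, w'}))"
      using c2 by simp
    ultimately have 1: "p * (1/64 - 1) * (card {w, w'} * card (N - {w, w'})) \<le> 63/16 * p - 6237/3200 * (n * p\<^sup>2)"
      by linarith
    have "ln (1/64 :: real) = - (6 * ln 2)" using ln_realpow[of 2 6] by (simp add: ln_div)
    \<comment> \<open>The factors 5/4, 6/5 and 4/3 of 2 give ln 2 \<le> 1/4 + 1/5 + 1/3 =
      47/60.\<close>
    moreover have "ln (2 :: real) = ln (5/4) + ln (6/5) + ln (4/3)"
      using ln_mult[of "5/4 :: real" "6/5"] ln_mult[of "3/2 :: real" "4/3"] by simp
    ultimately have "ln (1/64 :: real) \<ge> - 47/10"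
      using ln_le_minus_one[of "5/4"] ln_le_minus_one[of "6/5"] ln_le_minus_one[of "4/3"] by simp
    then have "1/100 * (n * p\<^sup>2) * ln (1/64) \<ge> 1/100 * (n * p\<^sup>2) * (- 47/10)"
      using x0 by (intro mult_left_mono) auto
    moreover have "1/200 * (n * p\<^sup>2) * card {w, w'} * ln (1/64) = 1/100 * (n * p\<^sup>2) * ln (1/64)"
      using c2 by simp
    ultimately have 2: "p * (1/64 - 1) * (card {w, w'} * card (N - {w, w'})) - 1/200 * (n * p\<^sup>2) * card {w, w'} * ln (1/64)
        \<le> 4 - 19/10 * (n * p\<^sup>2)" using 1 p01 x0 by linarith
    show "prob p ?U (?P q) \<le> exp (4 - 19/10 * (n * p\<^sup>2))"
      unfolding q fst_conv snd_conv
      by (rule exp_bound_mono[OF 2], rule codeg_low_prob[OF p01 V v N(1)]) (use q in auto)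
  qed auto
qed

end

text \<open>The codegree thresholds 0.9 and 1/200 (times the mean) separate the two ways a codegree can be
  low: every vertex has few neighbours of the first kind and at most one of the second.\<close>

definition typical :: "nat \<Rightarrow> real \<Rightarrow> real \<Rightarrow> real \<Rightarrow> real \<Rightarrow> real \<Rightarrow> nat set set \<Rightarrow> bool" where
  "typical n p c c' \<epsilon> \<eta> E \<longleftrightarrow>
    (\<forall>v\<in>{1..n}. 99/100 * (real n * p) \<le> card (nbr E v) \<and> card (nbr E v) \<le> 101/100 * (real n * p)) \<and>
    (\<forall>v\<in>{1..n}. \<forall>D\<subseteq>nbr E v. c * (real n * p) < card D \<longrightarrow> 2 * card D \<le> card (nbr E v) \<longrightarrow>
       2 * real (card (E \<inter> pairs D)) \<le> 0.8 * (real n * p\<^sup>2) * card D) \<and>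
    (\<forall>D\<subseteq>{1..n}. card D \<le> c * (real n * p) \<longrightarrow> 2 * real (card (E \<inter> pairs D)) \<le> \<epsilon> * (real n * p\<^sup>2) * card D) \<and>
    (\<forall>A\<subseteq>{1..n}. card A \<le> \<eta> * real n \<longrightarrow> real (card (E \<inter> pairs A)) \<le> c' * (real n * p) * card A) \<and>
    (\<forall>v\<in>{1..n}. real (card {w \<in> nbr E v. codeg E v w < 0.9 * (real n * p\<^sup>2)}) \<le> c' * (real n * p)) \<and>
    (\<forall>v\<in>{1..n}. \<forall>w\<in>nbr E v. \<forall>w'\<in>nbr E v. codeg E v w < 1/200 * (real n * p\<^sup>2) \<longrightarrow>
       codeg E v w' < 1/200 * (real n * p\<^sup>2) \<longrightarrow> w = w')"

text \<open>The codegree of an edge at v depends only on the star of v and on the graph off v, the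
  form required for exposing v first.\<close>

lemma nbr_Int_restrict:
  assumes "E \<subseteq> pairs V" "w \<in> nbr E v"
  shows "nbr E v \<inter> nbr E w = nbr E v \<inter> nbr (E \<inter> pairs (V - {v})) w"
proof -
  have "x \<in> nbr E w \<longleftrightarrow> x \<in> nbr (E \<inter> pairs (V - {v})) w" if "x \<in> nbr E v" for x
  proof -
    have "x \<in> V - {v}" "w \<in> V - {v}" using nbr_subset[OF assms(1), of v] assms(2) that by auto
    moreover have "w \<noteq> x" if "{w, x} \<in> E" using subsetD[OF assms(1) that] by simp
    ultimately show ?thesis by (simp add: nbr_iff) blast
  qed
  then show ?thesis by blast
qed

text \<open>Three kinds of failure: local ones at a vertex v, treated by exposing the star of v;
  dense sets of size at most c np; dense sets of size at most \<eta> n. The values c =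
  exp(-6/\<epsilon>) and \<eta> = exp(-3/c') are the reciprocals of the tilts used for the last
  two.\<close>

lemma not_typical_prob:
  fixes n :: nat and p c c' \<epsilon> \<eta> :: real
  assumes p01: "0 \<le> p" "p \<le> 1" and n: "n \<ge> 1" and x: "n * p\<^sup>2 \<ge> 5/4 * ln n" and np: "n * p \<ge> 200"
    and c: "c = exp (- 6 / \<epsilon>)" "\<epsilon> > 0" "c' > 0" "c' \<le> 1/200" "\<eta> = exp (- 3 / c')"
    and big: "3/200 * c * (n * p\<^sup>2) \<ge> 3" "1/1000 * c' * (n * p\<^sup>2) \<ge> 3"
  shows "prob p (pairs {1..n}) (\<lambda>E. \<not> typical n p c c' \<epsilon> \<eta> E)
     \<le> n * (6 * exp (- (n * p) / 100000) + 2 * exp (- (n * p)) + (101/100 * (n * p))\<^sup>2 * exp (4 - 19/10 * (n * p\<^sup>2)))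
       + 2 * (exp (1 / n) - 1)"
proof -
  let ?V = "{1..n}"
  let ?U = "pairs ?V"
  have V: "finite ?V" "card ?V = n" by auto
  have x0: "0 \<le> n * p\<^sup>2" and d0: "0 \<le> n * p" and ln0: "0 \<le> ln (real n)" using p01 n by auto
  have c0: "c > 0" using c by simp
  define Rg where "Rg = (\<lambda>N :: nat set. 99/100 * (n * p) \<le> card N \<and> card N \<le> 101/100 * (n * p))"
  define A1 where "A1 = (\<lambda>(N :: nat set) E. \<exists>D\<subseteq>N. c * (n * p) < card D \<and> 2 * card D \<le> card N \<and>
      0.8 * (n * p\<^sup>2) * card D < 2 * real (card (E \<inter> pairs D)))"
  define A4 where "A4 = (\<lambda>(N :: nat set) E. c' * (n * p) < card {w \<in> N. card (N \<inter> nbr E w) < 0.9 * (n * p\<^sup>2)})"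
  define A5 where "A5 = (\<lambda>(N :: nat set) E. \<exists>w\<in>N. \<exists>w'\<in>N. w \<noteq> w' \<and> card (N \<inter> nbr E w) < 1/200 * (n * p\<^sup>2) \<and>
      card (N \<inter> nbr E w') < 1/200 * (n * p\<^sup>2))"
  define X where "X = (\<lambda>v E. \<not> Rg (nbr E v) \<or> (Rg (nbr E v) \<and> A1 (nbr E v) (E \<inter> pairs (?V - {v}))) \<or>
     (Rg (nbr E v) \<and> A4 (nbr E v) (E \<inter> pairs (?V - {v}))) \<or> (Rg (nbr E v) \<and> A5 (nbr E v) (E \<inter> pairs (?V - {v}))))"
  define b5 where "b5 = (101/100 * (n * p))\<^sup>2 * exp (4 - 19/10 * (n * p\<^sup>2))"
  define Y2 where "Y2 = (\<lambda>E :: nat set set. \<exists>D\<subseteq>?V. card D \<le> c * (n * p) \<and> (\<epsilon> * (n * p\<^sup>2) / 2) * card D < card (E \<inter> pairs D))"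
  define Y3 where "Y3 = (\<lambda>E :: nat set set. \<exists>D\<subseteq>?V. card D \<le> \<eta> * n \<and> (c' * (n * p)) * card D < card (E \<inter> pairs D))"
  have Xv: "prob p ?U (X v) \<le> 6 * exp (- (n * p) / 100000) + 2 * exp (- (n * p)) + b5" if v: "v \<in> ?V" for v
  proof -
    have "prob p ?U (X v) \<le> prob p ?U (\<lambda>E. \<not> Rg (nbr E v)) + (prob p ?U (\<lambda>E. Rg (nbr E v) \<and> A1 (nbr E v) (E \<inter> pairs (?V - {v})))
       + (prob p ?U (\<lambda>E. Rg (nbr E v) \<and> A4 (nbr E v) (E \<inter> pairs (?V - {v})))
       + prob p ?U (\<lambda>E. Rg (nbr E v) \<and> A5 (nbr E v) (E \<inter> pairs (?V - {v})))))"
      unfolding X_def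
      by (rule order_trans[OF prob_disj[OF p01]], assumption, rule add_left_mono)+ simp
    moreover have "prob p ?U (\<lambda>E. \<not> Rg (nbr E v)) \<le> 6 * exp (- (n * p) / 100000)"
      unfolding Rg_def by (rule degree_prob[OF p01 V v n])
    moreover have "prob p ?U (\<lambda>E. Rg (nbr E v) \<and> A1 (nbr E v) (E \<inter> pairs (?V - {v}))) \<le> exp (- (n * p))"
    proof (rule prob_nbr_le[OF p01 V v])
      fix N assume N: "N \<subseteq> ?V - {v}" "Rg N"
      have 1: "2 * (n * p) - (3/200) * c * (n * p\<^sup>2) * (n * p) \<le> - (n * p)"
        using mult_right_mono[OF big(1) d0] by linarith
      show "prob p (pairs (?V - {v})) (A1 N) \<le> exp (- (n * p))"
        unfolding A1_def by (rule exp_bound_mono[OF 1], rule dense_nbhd_subset_prob[OF p01 V v N(1) _ c0])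
         (use N in \<open>auto simp: Rg_def\<close>)
    qed simp
    moreover have "prob p ?U (\<lambda>E. Rg (nbr E v) \<and> A4 (nbr E v) (E \<inter> pairs (?V - {v}))) \<le> exp (- (n * p))"
    proof (rule prob_nbr_le[OF p01 V v])
      fix N assume N: "N \<subseteq> ?V - {v}" "Rg N"
      have 1: "2 * (n * p) - (1/1000) * c' * (n * p\<^sup>2) * (n * p) \<le> - (n * p)"
        using mult_right_mono[OF big(2) d0] by linarith
      show "prob p (pairs (?V - {v})) (A4 N) \<le> exp (- (n * p))"
        unfolding A4_def by (rule exp_bound_mono[OF 1], rule low_codeg_prob[OF p01 V v N(1) _ _ c(3,4) np])
         (use N in \<open>auto simp: Rg_def\<close>)
    qed simp
    moreover have "prob p ?U (\<lambda>E. Rg (nbr E v) \<and> A5 (nbr E v) (E \<inter> pairs (?V - {v}))) \<le> b5"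
    proof (rule prob_nbr_le[OF p01 V v])
      fix N assume N: "N \<subseteq> ?V - {v}" "Rg N"
      show "prob p (pairs (?V - {v})) (A5 N) \<le> b5"
        unfolding A5_def b5_def by (rule poor_pair_prob[OF p01 V v N(1)]) (use N in \<open>auto simp: Rg_def\<close>)
    qed (simp add: b5_def)
    ultimately show ?thesis by linarith
  qed
  have X: "prob p ?U (\<lambda>E. \<exists>v\<in>?V. X v E) \<le> n * (6 * exp (- (n * p) / 100000) + 2 * exp (- (n * p)) + b5)"
    by (rule prob_Bex_le[OF p01, of ?V _ _ X]) (use Xv in \<open>auto simp: b5_def\<close>)
  have Y2: "prob p ?U Y2 \<le> exp (1 / n) - 1"
    unfolding Y2_def
  \<comment> \<open>As the tilt is 1/c, the mean term is at most np^2/2 while the logarithm of the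
    tilt gains 3 np^2; the difference is at least 2 ln n. For \<open>Y3\<close> the tilt 1/\<eta>
    works in the same way with np in place of np^2.\<close>
  proof (rule dense_sets_prob[OF p01 V, of "exp (6 / \<epsilon>)"])
    have "p * (exp (6 / \<epsilon>) - 1) * (c * (n * p)) \<le> p * exp (6 / \<epsilon>) * (c * (n * p))"
      using p01 c0 d0 by (intro mult_right_mono mult_left_mono) auto
    also have "\<dots> = (exp (6 / \<epsilon>) * c) * (n * p\<^sup>2)" by (simp add: power2_eq_square)
    also have "\<dots> = n * p\<^sup>2" unfolding c by (simp add: exp_minus)
    finally have "p * (exp (6 / \<epsilon>) - 1) * (c * (n * p)) / 2 \<le> n * p\<^sup>2 / 2" by simp
    moreover have "\<epsilon> * (n * p\<^sup>2) / 2 * ln (exp (6 / \<epsilon>)) = 3 * (n * p\<^sup>2)" using c by simp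
    ultimately show "\<epsilon> * (n * p\<^sup>2) / 2 * ln (exp (6 / \<epsilon>)) - p * (exp (6 / \<epsilon>) - 1) * (c * (n * p)) / 2 \<ge> 2 * ln n"
      using x x0 ln0 by linarith
  qed (use c c0 d0 n in auto)
  have Y3: "prob p ?U Y3 \<le> exp (1 / n) - 1"
    unfolding Y3_def
  proof (rule dense_sets_prob[OF p01 V, of "exp (3 / c')"])
    have "p * (exp (3 / c') - 1) * (\<eta> * n) \<le> p * exp (3 / c') * (\<eta> * n)"
      using p01 c by (intro mult_right_mono mult_left_mono) auto
    also have "\<dots> = (exp (3 / c') * \<eta>) * (n * p)" by simp
    also have "\<dots> = n * p" unfolding c by (simp add: exp_minus)
    finally have "p * (exp (3 / c') - 1) * (\<eta> * n) / 2 \<le> n * p / 2" by simp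
    moreover have "c' * (n * p) * ln (exp (3 / c')) = 3 * (n * p)" using c by simp
    moreover have "n * p\<^sup>2 \<le> n * p" using p01 by (intro mult_left_mono) (auto simp: power2_eq_square mult_left_le)
    ultimately show "c' * (n * p) * ln (exp (3 / c')) - p * (exp (3 / c') - 1) * (\<eta> * n) / 2 \<ge> 2 * ln n"
      using x d0 ln0 by linarith
  qed (use c n in auto)
  have "prob p ?U (\<lambda>E. \<not> typical n p c c' \<epsilon> \<eta> E) \<le> prob p ?U (\<lambda>E. \<exists>v\<in>?V. X v E) + prob p ?U (\<lambda>E. Y2 E \<or> Y3 E)"
  proof (rule prob_disj[OF p01], rule ccontr)
    fix E assume E: "E \<subseteq> ?U" "\<not> typical n p c c' \<epsilon> \<eta> E" "\<not> ((\<exists>v\<in>?V. X v E) \<or> Y2 E \<or> Y3 E)"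
    have a: "Rg (nbr E v)" "\<not> A1 (nbr E v) (E \<inter> pairs (?V - {v}))" "\<not> A4 (nbr E v) (E \<inter> pairs (?V - {v}))"
      "\<not> A5 (nbr E v) (E \<inter> pairs (?V - {v}))" if "v \<in> ?V" for v
      using E(3) that unfolding X_def by blast+
    have cd: "codeg E v w = card (nbr E v \<inter> nbr (E \<inter> pairs (?V - {v})) w)" if "w \<in> nbr E v" for v w
      unfolding codeg_def using nbr_Int_restrict[OF E(1) that] by simp
    have t2: "2 * real (card (E \<inter> pairs D)) \<le> 0.8 * (n * p\<^sup>2) * card D"
      if "v \<in> ?V" "D \<subseteq> nbr E v" "c * (n * p) < card D" "2 * card D \<le> card (nbr E v)" for v D
    proof -
      have "D \<subseteq> ?V - {v}" using that nbr_subset[OF E(1)] by blast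
      then have "E \<inter> pairs (?V - {v}) \<inter> pairs D = E \<inter> pairs D" using pairs_mono[of D "?V - {v}"] by blast
      then show ?thesis using a(2)[OF that(1)] that unfolding A1_def by (metis not_less)
    qed
    have t3: "2 * real (card (E \<inter> pairs D)) \<le> \<epsilon> * (n * p\<^sup>2) * card D"
      if "D \<subseteq> ?V" "card D \<le> c * (n * p)" for D
    proof -
      have "\<not> (\<epsilon> * (n * p\<^sup>2) / 2) * card D < card (E \<inter> pairs D)" using E(3) that unfolding Y2_def by blast
      then show ?thesis by (simp add: not_less)
    qed
    have t4: "real (card (E \<inter> pairs D)) \<le> c' * (n * p) * card D" if "D \<subseteq> ?V" "card D \<le> \<eta> * n" for D
      using E(3) that unfolding Y3_def by (meson not_less)
    have t5: "real (card {w \<in> nbr E v. codeg E v w < 0.9 * (n * p\<^sup>2)}) \<le> c' * (n * p)" if "v \<in> ?V" for v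
    proof -
      have "{w \<in> nbr E v. codeg E v w < 0.9 * (n * p\<^sup>2)}
        = {w \<in> nbr E v. card (nbr E v \<inter> nbr (E \<inter> pairs (?V - {v})) w) < 0.9 * (n * p\<^sup>2)}"
        by (intro Collect_cong conj_cong refl) (simp only: cd)
      then show ?thesis using a(3)[OF that] unfolding A4_def by (simp only: not_less)
    qed
    have t6: "w = w'" if "v \<in> ?V" "w \<in> nbr E v" "w' \<in> nbr E v" "codeg E v w < 1/200 * (n * p\<^sup>2)"
      "codeg E v w' < 1/200 * (n * p\<^sup>2)" for v w w'
      using a(4)[OF that(1)] that unfolding A5_def by (auto simp only: cd)
    have "typical n p c c' \<epsilon> \<eta> E"
      unfolding typical_def
    proof (intro conjI)
      show "\<forall>v\<in>{1..n}. 99/100 * (n * p) \<le> card (nbr E v) \<and> card (nbr E v) \<le> 101/100 * (n * p)"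
        using a(1) unfolding Rg_def by blast
    qed (intro ballI allI impI, erule (3) t2, intro allI impI, erule (1) t3, intro allI impI, erule (1) t4,
        intro ballI, erule t5, intro ballI impI, erule (4) t6)
    then show False using E(2) by blast
  qed
  also have "\<dots> \<le> n * (6 * exp (- (n * p) / 100000) + 2 * exp (- (n * p)) + b5) + ((exp (1 / n) - 1) + (exp (1 / n) - 1))"
    by (intro add_mono X order_trans[OF prob_disj[OF p01] add_mono[OF Y2 Y3]])
  finally show ?thesis unfolding b5_def by simp
qed

lemma typical_whp:
  fixes c c' \<epsilon> \<eta> \<delta> :: real
  assumes c: "c = exp (- 6 / \<epsilon>)" "\<epsilon> > 0" "c' > 0" "c' \<le> 1/200" "\<eta> = exp (- 3 / c')" and \<delta>: "\<delta> > 0"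
  shows "\<forall>\<^sub>F n in sequentially. \<forall>p::real. 0 \<le> p \<longrightarrow> p \<le> 1 \<longrightarrow> n * p\<^sup>2 \<ge> 5/4 * ln n \<longrightarrow>
     prob p (pairs {1..n}) (\<lambda>E. \<not> typical n p c c' \<epsilon> \<eta> E) \<le> \<delta>"
proof -
  have c0: "c > 0" using c by simp
  \<comment> \<open>A bound free of p. Its middle summand has order n^2 n^(-9/4) = n^(-1/4), with
    9/4 = (9/5)(5/4): this is where the constant 5/4 has to be larger than 1.\<close>
  define B where "B = (\<lambda>n::nat. n * (6 * exp (- sqrt n / 100000) + 2 * exp (- sqrt n))
      + 11 * exp 4 * (n * n * exp (- 9/4 * ln n)) + 2 * (exp (1 / n) - 1))"
  have "B \<longlonglongrightarrow> 0" unfolding B_def by real_asymp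
  then have "\<forall>\<^sub>F n in sequentially. B n < \<delta>" using \<delta> by (rule order_tendstoD)
  moreover have "\<forall>\<^sub>F n::nat in sequentially. 5/4 * ln n \<ge> 1" by real_asymp
  moreover have "filterlim (\<lambda>n::nat. 5/4 * ln n) at_top sequentially" by real_asymp
  then have "\<forall>\<^sub>F n::nat in sequentially. 5/4 * ln n \<ge> 200 / c" "\<forall>\<^sub>F n::nat in sequentially. 5/4 * ln n \<ge> 3000 / c'"
    unfolding filterlim_at_top by blast+
  moreover have "\<forall>\<^sub>F n::nat in sequentially. n \<ge> 40000" by (rule eventually_ge_at_top)
  ultimately show ?thesis
  proof eventually_elim
    case (elim n)
    show ?case
    proof (intro allI impI)
      fix p :: real assume p: "0 \<le> p" "p \<le> 1" and x: "n * p\<^sup>2 \<ge> 5/4 * ln n"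
      define y where "y = n * p\<^sup>2"
      have y: "y \<ge> 5/4 * ln n" "y \<ge> 1" "y \<ge> 200 / c" "y \<ge> 3000 / c'" using x elim unfolding y_def by linarith+
      have sq: "(n * p)\<^sup>2 = n * y" by (simp add: y_def power2_eq_square)
      also have "\<dots> \<ge> n" using mult_left_mono[OF y(2), of "real n"] by simp
      finally have d: "sqrt n \<le> n * p" using p by (intro real_le_lsqrt) auto
      have "200 \<le> sqrt n" using elim by (intro real_le_rsqrt) auto
      then have np: "n * p \<ge> 200" using d by linarith
      have big: "3/200 * c * y \<ge> 3" "1/1000 * c' * y \<ge> 3" using y c0 c by (auto simp: field_simps)
      have "prob p (pairs {1..n}) (\<lambda>E. \<not> typical n p c c' \<epsilon> \<eta> E)
        \<le> n * (6 * exp (- (n * p) / 100000) + 2 * exp (- (n * p)) + (101/100 * (n * p))\<^sup>2 * exp (4 - 19/10 * (n * p\<^sup>2)))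
       + 2 * (exp (1 / n) - 1)"
        by (rule not_typical_prob) (use p x np c big elim in \<open>auto simp: y_def\<close>)
      also have "\<dots> = n * (6 * exp (- (n * p) / 100000) + 2 * exp (- (n * p)))
          + n * ((101/100 * (n * p))\<^sup>2 * exp (4 - 19/10 * y)) + 2 * (exp (1 / n) - 1)"
        by (simp add: y_def algebra_simps)
      also have "n * (6 * exp (- (n * p) / 100000) + 2 * exp (- (n * p))) \<le> n * (6 * exp (- sqrt n / 100000) + 2 * exp (- sqrt n))"
        using d by (intro mult_left_mono add_mono) auto
      also have "n * ((101/100 * (n * p))\<^sup>2 * exp (4 - 19/10 * y)) = 10201/10000 * (n * n * (y * exp (4 - 19/10 * y)))"
      proof -
        have "(101/100 * (n * p))\<^sup>2 = 10201/10000 * (n * y)"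
          unfolding power_mult_distrib sq[unfolded power_mult_distrib] by (simp add: power2_eq_square)
        then show ?thesis by simp
      qed
      also have "\<dots> \<le> 10201/10000 * (n * n * (10 * exp 4 * exp (- 9/4 * ln n)))"
      proof (intro mult_left_mono)
        \<comment> \<open>The factor y is paid for with 1/10 of the exponent, which leaves
          9/5.\<close>
        have "y \<le> 10 * exp (y / 10)" using exp_ge_add_one_self[of "y / 10"] by linarith
        then have "y * exp (4 - 19/10 * y) \<le> 10 * exp (y / 10) * exp (4 - 19/10 * y)" by (rule mult_right_mono) simp
        also have "\<dots> = 10 * exp 4 * exp (- 9/5 * y)" by (simp add: exp_add[symmetric])
        also have "\<dots> \<le> 10 * exp 4 * exp (- 9/4 * ln n)" using y(1) by simp
        finally show "y * exp (4 - 19/10 * y) \<le> 10 * exp 4 * exp (- 9/4 * ln n)" .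
      qed auto
      also have "\<dots> \<le> 11 * exp 4 * (n * n * exp (- 9/4 * ln n))" by simp
      finally have "prob p (pairs {1..n}) (\<lambda>E. \<not> typical n p c c' \<epsilon> \<eta> E) \<le> B n" unfolding B_def by simp
      then show "prob p (pairs {1..n}) (\<lambda>E. \<not> typical n p c c' \<epsilon> \<eta> E) \<le> \<delta>" using elim by linarith
    qed
  qed
qed

section \<open>Avoiding odd triangles\<close>

lemma one_minus_power_le_exp: "0 \<le> p \<Longrightarrow> p \<le> 1 \<Longrightarrow> (1 - p) ^ k \<le> exp (- (p * k))" for p :: real
proof -
  assume p: "0 \<le> p" "p \<le> 1"
  have "(1 - p) ^ k \<le> exp (- p) ^ k" using exp_ge_add_one_self[of "- p"] p by (intro power_mono) auto
  then show ?thesis by (simp add: exp_of_nat_mult[symmetric] mult.commute)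
qed

lemma prob_disjoint:
  assumes "finite U" "A \<subseteq> U"
  shows "prob p U (\<lambda>E. E \<inter> A = {}) = (1 - p) ^ card A"
proof -
  have fin: "finite A" using assms finite_subset by blast
  have "prob p U (\<lambda>E. E \<inter> A = {}) = expect p U (\<lambda>E. 0 ^ card (E \<inter> A))"
    unfolding prob_def by (rule expect_cong) (use fin in \<open>auto simp: power_0_left\<close>)
  also have "\<dots> = (1 - p) ^ card A"
    using expect_restrict[OF assms, of p "\<lambda>E. 0 ^ card E"] expect_power[OF fin, of p 0] by simp
  finally show ?thesis .
qed

lemma card_star_edges_ge:
  assumes "finite N1" "finite N2" "N1 \<inter> N2 = {}" "finite B"
  shows "(\<Sum>y\<in>N1. card (nbr B y \<inter> N2)) \<le> card (B \<inter> pairs (N1 \<union> N2))"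
proof -
  let ?S = "SIGMA y:N1. nbr B y \<inter> N2"
  have "inj_on (\<lambda>(a, b). {a, b}) ?S"
    by (rule inj_on_subset[OF inj_on_doubleton[OF assms(3)]]) auto
  then have "card ?S = card ((\<lambda>(a, b). {a, b}) ` ?S)" by (simp add: card_image)
  also have "\<dots> \<le> card (B \<inter> pairs (N1 \<union> N2))"
    by (rule card_mono) (use assms in \<open>auto simp: nbr_iff\<close>)
  finally show ?thesis using assms by simp
qed

text \<open>The quantity averaged is the probability that no pair of B inside N is an edge. A set
  \<open>D1\<close> of vertices of large B-degree is exposed after the remaining part N2 of N. A
  vertex of \<open>D1\<close> with many B-neighbours in N2, once chosen, multiplies this probability
  by at most 1/2, hence contributes a factor 1 - p/2 on average; there are order \<mu> n such
  vertices unless an unlikely N2 occurs.\<close>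

lemma random_subset_surviving:
  fixes \<mu> p :: real and n :: nat
  assumes p01: "0 \<le> p" "p \<le> 1" and Y: "finite Y" "card Y \<le> n" and B: "B \<subseteq> pairs Y" "card B \<ge> \<mu> * n\<^sup>2"
    and \<mu>: "\<mu> > 0" "\<mu> * n \<ge> 4" "\<mu> * (n * p\<^sup>2) \<ge> 4"
  shows "expect p Y (\<lambda>N. (1 - p) ^ card (B \<inter> pairs N)) \<le> 3 * exp (- (\<mu> * (n * p)) / 20)" (is "_ \<le> 3 * ?e")
proof -
  have finB: "finite B" using B Y finite_pairs finite_subset by blast
  have nb: "nbr B y \<subseteq> Y - {y}" "finite (nbr B y)" "card (nbr B y) \<le> n" for y
  proof -
    show 1: "nbr B y \<subseteq> Y - {y}" by (rule nbr_subset[OF B(1)])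
    show "finite (nbr B y)" using 1 Y by (meson finite_Diff finite_subset)
    have "card (nbr B y) \<le> card Y" using 1 Y by (intro card_mono) auto
    then show "card (nbr B y) \<le> n" using Y by simp
  qed
  define D where "D = {y \<in> Y. card (nbr B y) \<ge> \<mu> * n}"
  have "n > 0" using \<mu> by (cases n) auto
  \<comment> \<open>In the degree sum 2 card B \<ge> 2 \<mu> n^2 the vertices outside D account for
    at most \<mu> n^2, and each vertex of D for at most n.\<close>
  have cD: "\<mu> * n \<le> card D"
  proof -
    have "2 * (\<mu> * n\<^sup>2) \<le> 2 * card B" using B by simp
    also have "\<dots> = card (arcs B)" using card_arcs[OF finB B(1)] by simp
    also have "\<dots> = (\<Sum>y\<in>Y. real (card (nbr B y)))" unfolding arcs_eq_Sigma[OF B(1)] using Y nb by simp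
    also have "\<dots> \<le> (\<Sum>y\<in>Y. (if y \<in> D then real n else 0) + \<mu> * n)"
    proof (rule sum_mono)
      fix y assume "y \<in> Y"
      moreover have "real (card (nbr B y)) \<le> n" using nb(3)[of y] by simp
      moreover have "0 \<le> \<mu> * n" using \<mu> by linarith
      ultimately show "real (card (nbr B y)) \<le> (if y \<in> D then real n else 0) + \<mu> * n"
        by (auto simp: D_def)
    qed
    also have "\<dots> = card D * real n + card Y * (\<mu> * n)"
      using Y by (simp add: sum.distrib sum.If_cases D_def Int_def)
    also have "card Y * (\<mu> * n) \<le> n * (\<mu> * n)" using Y \<mu> by (intro mult_right_mono) auto
    finally have "(\<mu> * n) * n \<le> card D * real n" by (simp add: power2_eq_square)
    then show ?thesis using \<open>n > 0\<close> by simp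
  qed
  \<comment> \<open>At most \<mu> n / 2 vertices are set apart, so each of them keeps B-degree at
    least \<mu> n / 2 outside \<open>D1\<close>.\<close>
  define k where "k = nat \<lfloor>\<mu> * n / 2\<rfloor>"
  have k: "k \<le> \<mu> * n / 2" "k \<ge> \<mu> * n / 4" using \<mu> unfolding k_def by linarith+
  have "k \<le> card D" using k(1) cD \<mu> by linarith
  then obtain D1 where D1: "D1 \<subseteq> D" "card D1 = k" by (rule obtain_subset_with_card_n)
  have D1Y: "D1 \<subseteq> Y" "finite D1" using D1 Y by (auto simp: D_def intro: finite_subset)
  have "k > 0" using k \<mu> by linarith
  define Y2 where "Y2 = Y - D1"
  define M where "M = (\<lambda>y. nbr B y - D1)"
  have M: "M y \<subseteq> Y2" "card (M y) \<ge> \<mu> * n / 2" if "y \<in> D1" for y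
  proof -
    show "M y \<subseteq> Y2" using nb(1)[of y] by (auto simp: M_def Y2_def)
    have "card (nbr B y) - card D1 \<le> card (M y)" unfolding M_def by (rule diff_card_le_card_Diff[OF D1Y(2)])
    moreover have "card (nbr B y) \<ge> \<mu> * n" using that D1 by (auto simp: D_def)
    ultimately show "card (M y) \<ge> \<mu> * n / 2" using k D1 by linarith
  qed
  have YU: "Y = Y2 \<union> D1" "Y2 \<inter> D1 = {}" "finite Y2" using D1Y Y by (auto simp: Y2_def)
  define good where "good = (\<lambda>y N. \<mu> * (n * p) / 4 \<le> card (N \<inter> M y))"
  \<comment> \<open>If fewer than half of \<open>D1\<close> are bad, the good vertices yield the
    exponential; otherwise the second summand is at least 1. It is linear in the bad events, so
    their probabilities can be inserted afterwards.\<close>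
  have inner: "expect p D1 (\<lambda>N1. (1 - p) ^ card (B \<inter> pairs (N2 \<union> N1)))
     \<le> ?e + 2 / k * (\<Sum>y\<in>D1. of_bool (\<not> good y N2))" if N2: "N2 \<subseteq> Y2" for N2
  proof -
    have "expect p D1 (\<lambda>N1. (1 - p) ^ card (B \<inter> pairs (N2 \<union> N1)))
      \<le> expect p D1 (\<lambda>N1. \<Prod>y\<in>N1. (1 - p) ^ card (N2 \<inter> M y))"
    proof (rule expect_mono[OF p01])
      fix N1 assume N1: "N1 \<subseteq> D1"
      have fin: "finite N1" "finite N2" using N1 N2 D1Y YU finite_subset by blast+
      have disjoint: "N1 \<inter> N2 = {}" using N1 N2 YU by auto
      have "nbr B y \<inter> N2 = N2 \<inter> M y" for y using N2 by (auto simp: M_def Y2_def)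
      then have "(\<Sum>y\<in>N1. card (N2 \<inter> M y)) \<le> card (B \<inter> pairs (N1 \<union> N2))"
        using card_star_edges_ge[OF fin _ finB] disjoint by simp
      then have "(1 - p) ^ card (B \<inter> pairs (N1 \<union> N2)) \<le> (1 - p) ^ (\<Sum>y\<in>N1. card (N2 \<inter> M y))"
        using p01 by (intro power_decreasing) auto
      then show "(1 - p) ^ card (B \<inter> pairs (N2 \<union> N1)) \<le> (\<Prod>y\<in>N1. (1 - p) ^ card (N2 \<inter> M y))"
        by (simp add: power_sum Un_commute)
    qed
    also have "\<dots> = (\<Prod>y\<in>D1. 1 - p + p * (1 - p) ^ card (N2 \<inter> M y))"
      by (rule expect_prod[OF D1Y(2)])
    also have "\<dots> \<le> (\<Prod>y\<in>D1. exp (- p / 2 * of_bool (good y N2)))"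
    proof (rule prod_mono, rule conjI)
      fix y assume "y \<in> D1"
      show "0 \<le> 1 - p + p * (1 - p) ^ card (N2 \<inter> M y)" using p01 by simp
      show "1 - p + p * (1 - p) ^ card (N2 \<inter> M y) \<le> exp (- p / 2 * of_bool (good y N2))"
      proof (cases "good y N2")
        case True
        have "(1 - p) ^ card (N2 \<inter> M y) \<le> exp (- (p * card (N2 \<inter> M y)))"
          by (rule one_minus_power_le_exp[OF p01])
        also have "p * card (N2 \<inter> M y) \<ge> p * (\<mu> * (n * p) / 4)"
          using True p01 unfolding good_def by (intro mult_left_mono) auto
        then have "exp (- (p * card (N2 \<inter> M y))) \<le> exp (- 1)"
          using \<mu>(3) by (simp add: power2_eq_square mult_ac)
        also have "\<dots> \<le> 1 / 2" using exp_ge_add_one_self[of 1] by (simp add: exp_minus field_simps)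
        finally have "p * (1 - p) ^ card (N2 \<inter> M y) \<le> p * (1 / 2)" using p01 by (intro mult_left_mono) auto
        then have "1 - p + p * (1 - p) ^ card (N2 \<inter> M y) \<le> 1 + - p / 2" by simp
        also have "\<dots> \<le> exp (- p / 2)" by (rule exp_ge_add_one_self)
        finally show ?thesis using True by simp
      next
        case False
        have "p * (1 - p) ^ card (N2 \<inter> M y) \<le> p * 1" using p01 by (intro mult_left_mono power_le_one) auto
        then show ?thesis using False by simp
      qed
    qed
    also have "\<dots> = exp (- p / 2 * (\<Sum>y\<in>D1. of_bool (good y N2)))"
      by (simp only: exp_sum[OF D1Y(2)] sum_distrib_left)
    also have "\<dots> \<le> ?e + 2 / k * (\<Sum>y\<in>D1. of_bool (\<not> good y N2))"
    proof -
      define t where "t = (\<Sum>y\<in>D1. of_bool (\<not> good y N2) :: real)"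
      define g where "g = (\<Sum>y\<in>D1. of_bool (good y N2) :: real)"
      have "g + t = (\<Sum>y\<in>D1. 1)" unfolding t_def g_def sum.distrib[symmetric] by (rule sum.cong) auto
      then have gt: "g + t = k" using D1 by simp
      have t0: "t \<ge> 0" "g \<ge> 0" unfolding t_def g_def by (auto intro: sum_nonneg)
      show ?thesis
      proof (cases "t \<ge> k / 2")
        case True
        then have "1 \<le> 2 / k * t" using \<open>k > 0\<close> by (simp add: field_simps)
        moreover have "exp (- p / 2 * g) \<le> 1" using p01 t0 by simp
        ultimately show ?thesis unfolding t_def[symmetric] g_def[symmetric]
          using exp_gt_zero[of "- (\<mu> * (n * p)) / 20"] by linarith
      next
        case False
        then have "\<mu> * n / 10 \<le> g" using gt k \<mu> by linarith
        then have "p / 2 * (\<mu> * n / 10) \<le> p / 2 * g" using p01 by (intro mult_left_mono) auto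
        then have "- p / 2 * g \<le> - (\<mu> * (n * p)) / 20" by (simp add: mult_ac)
        then have "exp (- p / 2 * g) \<le> ?e" by simp
        moreover have "0 \<le> 2 / k * t" using t0 by simp
        ultimately show ?thesis unfolding t_def[symmetric] g_def[symmetric] by linarith
      qed
    qed
    finally show ?thesis .
  qed
  have bad: "expect p Y2 (\<lambda>N. of_bool (\<not> good y N)) \<le> ?e" if y: "y \<in> D1" for y
  proof -
    have "p * (1/2 - 1) * card (M y) - \<mu> * (n * p) / 4 * ln (1/2) \<le> - (\<mu> * (n * p)) / 20"
    proof -
      have "p * (\<mu> * n / 2) \<le> p * card (M y)" using M(2)[OF y] p01 by (intro mult_left_mono) auto
      moreover have "ln (2 :: real) = ln (5/4) + ln (6/5) + ln (4/3)"
        using ln_mult[of "5/4 :: real" "6/5"] ln_mult[of "3/2 :: real" "4/3"] by simp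
      then have "ln (2::real) \<le> 47/60"
        using ln_le_minus_one[of "5/4"] ln_le_minus_one[of "6/5"] ln_le_minus_one[of "4/3"] by simp
      then have "\<mu> * (n * p) / 4 * ln 2 \<le> \<mu> * (n * p) / 4 * (47/60)" using \<mu> p01 by (intro mult_left_mono) auto
      moreover have "0 \<le> \<mu> * (n * p)" using \<mu> p01 by simp
      moreover have "p * (1/2 - 1) * card (M y) = - (p * card (M y)) / 2" by simp
      moreover have "\<mu> * (n * p) / 4 * ln (1/2) = - (\<mu> * (n * p) / 4 * ln 2)" by (simp add: ln_div)
      moreover have "p * (\<mu> * n / 2) = \<mu> * (n * p) / 2" by simp
      ultimately show ?thesis by linarith
    qed
    then show ?thesis unfolding prob_def[symmetric]
      by (rule exp_bound_mono) (rule chernoff_lower[OF p01], use YU M y in \<open>auto simp: good_def\<close>)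
  qed
  have "expect p Y (\<lambda>N. (1 - p) ^ card (B \<inter> pairs N))
     = expect p Y2 (\<lambda>N2. expect p D1 (\<lambda>N1. (1 - p) ^ card (B \<inter> pairs (N2 \<union> N1))))"
    unfolding YU(1) using D1Y YU by (subst expect_union) auto
  also have "\<dots> \<le> expect p Y2 (\<lambda>N2. ?e + 2 / k * (\<Sum>y\<in>D1. of_bool (\<not> good y N2)))"
    by (rule expect_mono[OF p01]) (rule inner)
  also have "\<dots> = ?e + 2 / k * (\<Sum>y\<in>D1. expect p Y2 (\<lambda>N. of_bool (\<not> good y N)))"
    using YU by (simp only: expect_add expect_cmult expect_sum expect_const)
  also have "\<dots> \<le> ?e + 2 / k * (k * ?e)"
    using sum_bounded_above[of D1 "\<lambda>y. expect p Y2 (\<lambda>N. of_bool (\<not> good y N))" "?e"] bad D1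
    by (intro add_left_mono mult_left_mono) auto
  also have "\<dots> = 3 * ?e" using \<open>k > 0\<close> by simp
  finally show ?thesis .
qed

lemma cross_insert: "cross (insert x X) Y = (\<lambda>y. {x, y}) ` Y \<union> cross X Y"
  by (auto simp: cross_def)

text \<open>The set K collects the pairs already excluded by the exposed neighbourhoods. As long as it
  has fewer than M elements, each further neighbourhood gains a factor r.\<close>

lemma expect_excluded_pairs:
  fixes p r \<tau> M :: real
  assumes p01: "0 \<le> p" "p \<le> 1" and fin: "finite X" "finite Y" and disj: "X \<inter> Y = {}"
    and r: "\<And>B'. B' \<subseteq> pairs Y \<Longrightarrow> M \<le> card B' \<Longrightarrow> expect p Y (\<lambda>N. (1 - p) ^ card (B' \<inter> pairs N)) \<le> r" "0 \<le> r"
    and Bx: "\<And>x. x \<in> X \<Longrightarrow> Bx x \<subseteq> pairs Y \<and> 2 * M \<le> card (Bx x)"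
    and \<tau>: "\<And>k::nat. M \<le> k \<Longrightarrow> (1 - p) ^ k \<le> \<tau>" "0 \<le> \<tau>" and K: "K \<subseteq> pairs Y"
  shows "expect p (cross X Y) (\<lambda>E. (1 - p) ^ card (K \<union> (\<Union>x\<in>X. Bx x \<inter> pairs (nbr E x \<inter> Y))))
    \<le> \<tau> + r ^ card X * (1 - p) ^ card K"
  using fin(1) disj Bx K
proof (induction X arbitrary: K rule: finite_induct)
  case empty
  then show ?case using \<tau> by (simp add: cross_def)
next
  case (insert x X)
  have finY: "finite (pairs Y)" using fin by simp
  have finK: "finite K" using insert.prems finY finite_subset by blast
  have BxY: "Bx x' \<subseteq> pairs Y" if "x' \<in> insert x X" for x' using insert.prems(2)[OF that] by simp
  let ?kill = "\<lambda>X E. \<Union>x\<in>X. Bx x \<inter> pairs (nbr E x \<inter> Y)"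
  have finKill: "finite (K \<union> ?kill (insert x X) E)" for E
    by (rule finite_subset[OF _ finY]) (use BxY insert.prems in blast)
  show ?case
  proof (cases "M \<le> card K")
    case True
    \<comment> \<open>With M pairs excluded already, the gain from the remaining neighbourhoods can
      be ignored.\<close>
    have "expect p (cross (insert x X) Y) (\<lambda>E. (1 - p) ^ card (K \<union> ?kill (insert x X) E)) \<le> \<tau>"
    proof (rule expect_le_const[OF p01])
      fix E
      have "card K \<le> card (K \<union> ?kill (insert x X) E)" by (rule card_mono[OF finKill]) auto
      then have "(1 - p) ^ card (K \<union> ?kill (insert x X) E) \<le> (1 - p) ^ card K"
        using p01 by (intro power_decreasing) auto
      then show "(1 - p) ^ card (K \<union> ?kill (insert x X) E) \<le> \<tau>" using \<tau>(1)[OF True] by linarith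
    qed (use fin insert in auto)
    moreover have "0 \<le> r ^ card (insert x X) * (1 - p) ^ card K" using r p01 by simp
    ultimately show ?thesis by linarith
  next
    case False
    let ?g = "\<lambda>y. {x, y}"
    have xY: "x \<notin> Y" "X \<inter> Y = {}" "x \<notin> X" using insert by auto
    have inj: "inj_on ?g Y" by (auto simp: inj_on_def doubleton_eq_iff)
    have dj: "?g ` Y \<inter> cross X Y = {}" using xY by (auto simp: cross_def doubleton_eq_iff)
    \<comment> \<open>Only pairs outside K are a gain. As \<open>Bx x\<close> has at least 2M pairs
      and K fewer than M, at least M such pairs exist.\<close>
    define B' where "B' = Bx x - K"
    have B': "B' \<subseteq> pairs Y" "M \<le> card B'"
    proof -
      show "B' \<subseteq> pairs Y" using BxY by (auto simp: B'_def)
      have "card (Bx x) - card K \<le> card B'" unfolding B'_def by (rule diff_card_le_card_Diff[OF finK])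
      then show "M \<le> card B'" using False insert.prems(2)[of x] by simp linarith
    qed
    have "expect p (cross (insert x X) Y) (\<lambda>E. (1 - p) ^ card (K \<union> ?kill (insert x X) E))
      = expect p Y (\<lambda>N. expect p (cross X Y) (\<lambda>E. (1 - p) ^ card (K \<union> ?kill (insert x X) (?g ` N \<union> E))))"
      unfolding cross_insert using fin insert dj inj by (simp add: expect_union expect_image)
    also have "\<dots> = expect p Y (\<lambda>N. expect p (cross X Y) (\<lambda>E. (1 - p) ^ card ((K \<union> (Bx x \<inter> pairs N)) \<union> ?kill X E)))"
    proof (intro expect_cong arg_cong[where f = "\<lambda>A. (1 - p) ^ card A"])
      fix N E assume N: "N \<subseteq> Y" and E: "E \<subseteq> cross X Y"
      have 1: "nbr (?g ` N \<union> E) x \<inter> Y = N"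
      proof -
        have "{x, y} \<notin> E" for y using E xY by (auto simp: cross_def doubleton_eq_iff dest!: subsetD)
        then show ?thesis using N xY by (auto simp: nbr_iff doubleton_eq_iff)
      qed
      have 2: "nbr (?g ` N \<union> E) x' \<inter> Y = nbr E x' \<inter> Y" if "x' \<in> X" for x'
        using N xY that by (auto simp: nbr_iff doubleton_eq_iff)
      show "K \<union> ?kill (insert x X) (?g ` N \<union> E) = (K \<union> (Bx x \<inter> pairs N)) \<union> ?kill X E"
        using 1 2 by auto
    qed
    also have "\<dots> \<le> expect p Y (\<lambda>N. \<tau> + r ^ card X * (1 - p) ^ card (K \<union> (Bx x \<inter> pairs N)))"
    proof (rule expect_mono[OF p01])
      fix N assume "N \<subseteq> Y"
      show "expect p (cross X Y) (\<lambda>E. (1 - p) ^ card ((K \<union> (Bx x \<inter> pairs N)) \<union> ?kill X E))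
        \<le> \<tau> + r ^ card X * (1 - p) ^ card (K \<union> (Bx x \<inter> pairs N))"
        by (rule insert.IH) (use xY insert.prems BxY[of x] in auto)
    qed
    also have "\<dots> = expect p Y (\<lambda>N. \<tau> + r ^ card X * (1 - p) ^ card K * (1 - p) ^ card (B' \<inter> pairs N))"
    proof (intro expect_cong)
      fix N
      have "card (K \<union> (Bx x \<inter> pairs N)) = card (K \<union> (B' \<inter> pairs N))"
        by (rule arg_cong[where f = card]) (auto simp: B'_def)
      also have "\<dots> = card K + card (B' \<inter> pairs N)"
        using finK finY B'(1) by (intro card_Un_disjoint) (auto simp: B'_def intro: finite_subset)
      finally show "\<tau> + r ^ card X * (1 - p) ^ card (K \<union> (Bx x \<inter> pairs N))
        = \<tau> + r ^ card X * (1 - p) ^ card K * (1 - p) ^ card (B' \<inter> pairs N)" by (simp add: power_add)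
    qed
    also have "\<dots> = \<tau> + r ^ card X * (1 - p) ^ card K * expect p Y (\<lambda>N. (1 - p) ^ card (B' \<inter> pairs N))"
      using fin by (simp add: expect_add expect_cmult)
    also have "\<dots> \<le> \<tau> + r ^ card X * (1 - p) ^ card K * r"
      using r B' p01 by (intro add_left_mono mult_left_mono) auto
    finally show ?thesis using xY insert.hyps by (simp add: mult_ac)
  qed
qed

text \<open>The conditions for different x concern the same random edges inside Y and are not
  independent. Once the edges between X and Y are given, they say jointly that the edges inside Y
  avoid one fixed set, the union of all excluded pairs.\<close>

lemma prob_no_bad_triangle:
  fixes p r \<tau> M :: real
  assumes p01: "0 \<le> p" "p \<le> 1" and fin: "finite X" "finite Y" and disj: "X \<inter> Y = {}"
    and r: "\<And>B'. B' \<subseteq> pairs Y \<Longrightarrow> M \<le> card B' \<Longrightarrow> expect p Y (\<lambda>N. (1 - p) ^ card (B' \<inter> pairs N)) \<le> r" "0 \<le> r"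
    and Bx: "\<And>x. x \<in> X \<Longrightarrow> Bx x \<subseteq> pairs Y \<and> 2 * M \<le> card (Bx x)"
    and \<tau>: "\<And>k::nat. M \<le> k \<Longrightarrow> (1 - p) ^ k \<le> \<tau>" "0 \<le> \<tau>"
  shows "prob p (cross X Y \<union> pairs Y) (\<lambda>E. \<forall>x\<in>X. E \<inter> Bx x \<inter> pairs (nbr E x \<inter> Y) = {}) \<le> \<tau> + r ^ card X"
proof -
  have dj: "cross X Y \<inter> pairs Y = {}" using disj by (auto simp: cross_def)
  let ?kill = "\<lambda>E. \<Union>x\<in>X. Bx x \<inter> pairs (nbr E x \<inter> Y)"
  have "prob p (cross X Y \<union> pairs Y) (\<lambda>E. \<forall>x\<in>X. E \<inter> Bx x \<inter> pairs (nbr E x \<inter> Y) = {})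
    = expect p (cross X Y) (\<lambda>A. prob p (pairs Y) (\<lambda>C. \<forall>x\<in>X. (A \<union> C) \<inter> Bx x \<inter> pairs (nbr (A \<union> C) x \<inter> Y) = {}))"
    by (rule prob_union) (use fin dj in auto)
  also have "\<dots> = expect p (cross X Y) (\<lambda>A. prob p (pairs Y) (\<lambda>C. C \<inter> ?kill A = {}))"
  proof (intro expect_cong prob_cong)
    fix A C assume A: "A \<subseteq> cross X Y" and C: "C \<subseteq> pairs Y"
    have "nbr (A \<union> C) x = nbr A x" if "x \<in> X" for x
    proof -
      have "{x, y} \<notin> C" for y using subsetD[OF C, of "{x, y}"] disj that by auto
      then show ?thesis by (auto simp: nbr_iff)
    qed
    moreover have "(A \<union> C) \<inter> Bx x = C \<inter> Bx x" if "x \<in> X" for x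
      using A Bx[OF that] dj by auto
    ultimately show "(\<forall>x\<in>X. (A \<union> C) \<inter> Bx x \<inter> pairs (nbr (A \<union> C) x \<inter> Y) = {}) \<longleftrightarrow> C \<inter> ?kill A = {}"
      by auto
  qed
  also have "\<dots> = expect p (cross X Y) (\<lambda>A. (1 - p) ^ card ({} \<union> ?kill A))"
    by (intro expect_cong) (use fin Bx in \<open>simp, subst prob_disjoint, auto\<close>)
  also have "\<dots> \<le> \<tau> + r ^ card X * (1 - p) ^ card ({} :: 'a set set)"
    by (rule expect_excluded_pairs[OF p01 fin disj r Bx \<tau>]) auto
  finally show ?thesis by simp
qed

section \<open>Colours forced by a small vertex set\<close>

text \<open>A vertex s of S adjacent to both y and z forces whether yz belongs to F: this is the colour
  of the pair. If different vertices s disagree, the pair is not an edge, and the value of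
  the colour is irrelevant.\<close>

definition determined :: "'a set \<Rightarrow> 'a set set \<Rightarrow> 'a \<Rightarrow> 'a \<Rightarrow> bool" where
  "determined S E y z \<longleftrightarrow> (\<exists>s\<in>S. {s, y} \<in> E \<and> {s, z} \<in> E)"

definition colour :: "'a set \<Rightarrow> 'a set set \<Rightarrow> 'a set set \<Rightarrow> 'a \<Rightarrow> 'a \<Rightarrow> bool" where
  "colour S E F y z \<longleftrightarrow> (\<exists>s\<in>S. {s, y} \<in> E \<and> {s, z} \<in> E \<and> ({s, y} \<in> F) \<noteq> ({s, z} \<in> F))"

definition undetermined :: "'a set \<Rightarrow> 'a set set \<Rightarrow> 'a set \<Rightarrow> 'a set set" where
  "undetermined S E W = {e \<in> pairs W. \<exists>y z. e = {y, z} \<and> \<not> determined S E y z}"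

text \<open>With colours read off from F, an edge yz in this set whose ends are adjacent to x would
  close a triangle with an odd number of F-edges.\<close>

definition odd_pairs :: "'a set \<Rightarrow> 'a set set \<Rightarrow> 'a set set \<Rightarrow> 'a set \<Rightarrow> 'a \<Rightarrow> 'a set set" where
  "odd_pairs S E F Y x = {e \<in> pairs Y. \<exists>y z. e = {y, z} \<and> determined S E y z \<and> determined S E x y \<and>
     determined S E x z \<and> colour S E F y z \<noteq> (colour S E F x y \<noteq> colour S E F x z)}"

text \<open>On the other pairs of Y the colouring is exactly the cut between those y for which xy is
  coloured and the rest of Y.\<close>

definition off_cut_pairs :: "'a set \<Rightarrow> 'a set set \<Rightarrow> 'a set set \<Rightarrow> 'a set \<Rightarrow> 'a \<Rightarrow> 'a set set" where
  "off_cut_pairs S E F Y x = odd_pairs S E F Y x \<union> {e \<in> pairs Y. \<exists>y z. e = {y, z} \<and>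
     \<not> (determined S E y z \<and> determined S E x y \<and> determined S E x z)}"

lemma determined_sym: "determined S E y z = determined S E z y"
  by (auto simp: determined_def)

text \<open>Every s gives the same answer because {y, z} is an edge. E and F enter the colour only
  through \<open>cross S W\<close>, so the colour is fixed before the pairs inside W are exposed,
  provided S and W are disjoint.\<close>

lemma mem_eq_colour:
  assumes ev: "triangle_even E F" and W: "y \<in> W" "z \<in> W" and E: "{y, z} \<in> E"
    and det: "determined S (E \<inter> cross S W) y z"
  shows "{y, z} \<in> F \<longleftrightarrow> colour S (E \<inter> cross S W) (F \<inter> cross S W) y z"
proof -
  have "{y, z} \<in> F \<longleftrightarrow> ({s, y} \<in> F \<inter> cross S W) \<noteq> ({s, z} \<in> F \<inter> cross S W)"
    if s: "s \<in> S" "{s, y} \<in> E" "{s, z} \<in> E" for s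
  proof -
    have "{s, y} \<in> cross S W" "{s, z} \<in> cross S W" using s W by (auto simp: cross_iff)
    moreover have "{y, s} \<in> E" using s by (simp add: insert_commute)
    then have "{y, z} \<in> F \<longleftrightarrow> ({y, s} \<in> F) \<noteq> ({s, z} \<in> F)"
      using ev s E unfolding triangle_even_def by blast
    ultimately show ?thesis by (auto simp: insert_commute)
  qed
  then show ?thesis using det unfolding determined_def colour_def by blast
qed

lemma no_odd_triangle:
  assumes ev: "triangle_even E F" and x: "x \<in> X"
  shows "E \<inter> odd_pairs S (E \<inter> cross S (X \<union> Y)) (F \<inter> cross S (X \<union> Y)) Y x \<inter> pairs (nbr E x \<inter> Y) = {}"
proof -
  let ?E1 = "E \<inter> cross S (X \<union> Y)" and ?F1 = "F \<inter> cross S (X \<union> Y)"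
  have False if e: "e \<in> E" "e \<in> odd_pairs S ?E1 ?F1 Y x" "e \<in> pairs (nbr E x \<inter> Y)" for e
  proof -
    obtain y z where yz: "e = {y, z}" "determined S ?E1 y z" "determined S ?E1 x y" "determined S ?E1 x z"
      "colour S ?E1 ?F1 y z \<noteq> (colour S ?E1 ?F1 x y \<noteq> colour S ?E1 ?F1 x z)"
      using e(2) by (auto simp: odd_pairs_def)
    then have "y \<in> nbr E x \<inter> Y" "z \<in> nbr E x \<inter> Y" using e(3) by auto
    then have E: "{x, y} \<in> E" "{x, z} \<in> E" "{y, z} \<in> E" "{y, x} \<in> E" and W: "x \<in> X \<union> Y" "y \<in> X \<union> Y" "z \<in> X \<union> Y"
      using e(1) x yz(1) by (auto simp: nbr_iff insert_commute)
    have "{y, z} \<in> F \<longleftrightarrow> ({y, x} \<in> F) \<noteq> ({x, z} \<in> F)" using ev E unfolding triangle_even_def by blast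
    then have "{y, z} \<in> F \<longleftrightarrow> ({x, y} \<in> F) \<noteq> ({x, z} \<in> F)" by (simp add: insert_commute)
    then show False
      using mem_eq_colour[OF ev W(2,3) E(3) yz(2)] mem_eq_colour[OF ev W(1,2) E(1) yz(3)]
        mem_eq_colour[OF ev W(1,3) E(2) yz(4)] yz(5) by simp
  qed
  then show ?thesis by blast
qed

text \<open>F is compared with the cut of A, the set of those y in Y whose pair with x is coloured.
  Inside Y the two can differ only on \<open>off_cut_pairs\<close>; all edges that meet S or X are
  given away through the degree bound.\<close>

lemma card_witness_le:
  fixes E F :: "nat set set" and d :: real
  assumes E: "E \<subseteq> pairs (S \<union> X \<union> Y)" and fin: "finite S" "finite X" "finite Y"
    and F: "F \<subseteq> E" and ev: "triangle_even E F"
    and min: "\<And>A. card F \<le> card (sym_diff F (cut E A))" and x: "x \<in> X"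
    and deg: "\<And>v. v \<in> S \<union> X \<Longrightarrow> real (card (nbr E v)) \<le> d"
  shows "card F \<le> card (E \<inter> off_cut_pairs S (E \<inter> cross S (X \<union> Y)) (F \<inter> cross S (X \<union> Y)) Y x) + (card S + card X) * d"
proof -
  let ?E1 = "E \<inter> cross S (X \<union> Y)" and ?F1 = "F \<inter> cross S (X \<union> Y)"
  let ?off = "off_cut_pairs S ?E1 ?F1 Y x"
  define A where "A = {y \<in> Y. colour S ?E1 ?F1 x y}"
  let ?T = "\<Union>v\<in>S \<union> X. (\<lambda>w. {v, w}) ` nbr E v"
  have finE: "finite E" using E fin finite_pairs[of "S \<union> X \<union> Y"] finite_subset by blast
  have finn: "finite (nbr E v)" for v using nbr_subset[OF E, of v] fin by (meson finite_Diff finite_UnI finite_subset)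
  have "sym_diff F (cut E A) \<subseteq> (E \<inter> ?off) \<union> ?T"
  proof
    fix e assume e: "e \<in> sym_diff F (cut E A)"
    then have eE: "e \<in> E" using F by (auto simp: sym_diff_def cut_def)
    then obtain a b where ab: "e = {a, b}" "a \<in> S \<union> X \<union> Y" "b \<in> S \<union> X \<union> Y" "a \<noteq> b"
      using E by (blast elim: pairs_cases)
    show "e \<in> (E \<inter> ?off) \<union> ?T"
    proof (cases "a \<in> S \<union> X \<or> b \<in> S \<union> X")
      case True
      then have "e \<in> ?T"
      proof
        assume "a \<in> S \<union> X"
        moreover have "b \<in> nbr E a" using ab eE by (simp add: nbr_iff)
        ultimately show ?thesis using ab by blast
      next
        assume "b \<in> S \<union> X"
        moreover have "a \<in> nbr E b" "e = {b, a}" using ab eE by (auto simp: nbr_iff insert_commute)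
        ultimately show ?thesis by blast
      qed
      then show ?thesis by blast
    next
      case False
      then have Y: "a \<in> Y" "b \<in> Y" using ab by auto
      then have eY: "e \<in> pairs Y" using ab by simp
      have "e \<in> ?off"
      proof (rule ccontr)
        assume no: "e \<notin> ?off"
        then have det: "determined S ?E1 a b" "determined S ?E1 x a" "determined S ?E1 x b"
          using eY ab(1) unfolding off_cut_pairs_def by blast+
        then have "colour S ?E1 ?F1 a b \<longleftrightarrow> (colour S ?E1 ?F1 x a \<noteq> colour S ?E1 ?F1 x b)"
          using no eY ab(1) unfolding off_cut_pairs_def odd_pairs_def by blast
        moreover have "e \<in> F \<longleftrightarrow> colour S ?E1 ?F1 a b"
          using mem_eq_colour[OF ev _ _ _ det(1)] eE ab Y by auto
        moreover have "odd (card (e \<inter> A)) \<longleftrightarrow> (colour S ?E1 ?F1 x a \<noteq> colour S ?E1 ?F1 x b)"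
          using ab(1,4) Y by (auto simp: A_def Int_insert_left)
        ultimately have "e \<in> F \<longleftrightarrow> e \<in> cut E A" using eE by (simp add: cut_def)
        then show False using e by (auto simp: sym_diff_def)
      qed
      then show ?thesis using eE by blast
    qed
  qed
  then have "card (sym_diff F (cut E A)) \<le> card ((E \<inter> ?off) \<union> ?T)"
    using finE fin finn by (intro card_mono) auto
  also have "\<dots> \<le> card (E \<inter> ?off) + card ?T" by (rule card_Un_le)
  finally have 1: "card F \<le> card (E \<inter> ?off) + card ?T" using min[of A] by linarith
  have "card ?T \<le> (\<Sum>v\<in>S \<union> X. card ((\<lambda>w. {v, w}) ` nbr E v))" using fin by (intro card_UN_le) auto
  also have "\<dots> \<le> (\<Sum>v\<in>S \<union> X. card (nbr E v))" using finn by (intro sum_mono card_image_le)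
  finally have "real (card ?T) \<le> (\<Sum>v\<in>S \<union> X. real (card (nbr E v)))" by (simp flip: of_nat_sum)
  also have "\<dots> \<le> card (S \<union> X) * d" using deg sum_bounded_above[of "S \<union> X" "\<lambda>v. real (card (nbr E v))" d] by simp
  also have "\<dots> \<le> (card S + card X) * d"
  proof (rule mult_right_mono)
    show "real (card (S \<union> X)) \<le> real (card S + card X)" using card_Un_le by (rule of_nat_mono)
    show "0 \<le> d" using deg[of x] x by (meson UnCI of_nat_0_le_iff order_trans)
  qed
  finally show ?thesis using 1 by linarith
qed

lemma card_off_cut_pairs_le:
  assumes fin: "finite X" "finite Y" and x: "x \<in> X"
  shows "card (off_cut_pairs S E F Y x) \<le> card (odd_pairs S E F Y x) + card (undetermined S E (X \<union> Y))
    + card {y \<in> Y. \<not> determined S E x y} * card Y"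
proof -
  let ?ud = "{y \<in> Y. \<not> determined S E x y}"
  let ?C = "(\<lambda>(y, z). {y, z}) ` (?ud \<times> Y)"
  have "off_cut_pairs S E F Y x \<subseteq> (odd_pairs S E F Y x \<union> undetermined S E (X \<union> Y)) \<union> ?C"
  proof
    fix e assume "e \<in> off_cut_pairs S E F Y x"
    then consider "e \<in> odd_pairs S E F Y x" | y z where "e \<in> pairs Y" "e = {y, z}"
        "\<not> (determined S E y z \<and> determined S E x y \<and> determined S E x z)"
      by (auto simp: off_cut_pairs_def)
    then show "e \<in> (odd_pairs S E F Y x \<union> undetermined S E (X \<union> Y)) \<union> ?C"
    proof cases
      case (2 y z)
      then have Y: "y \<in> Y" "z \<in> Y" by auto
      consider "\<not> determined S E y z" | "\<not> determined S E x y" | "\<not> determined S E x z" using 2 by blast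
      then show ?thesis
      proof cases
        case 1
        then have "e \<in> undetermined S E (X \<union> Y)"
          using 2 pairs_mono[of Y "X \<union> Y"] unfolding undetermined_def by blast
        then show ?thesis by blast
      next
        case c2: 2
        then have "(y, z) \<in> ?ud \<times> Y" using Y by simp
        then show ?thesis using 2(2) by blast
      next
        case c3: 3
        then have "(z, y) \<in> ?ud \<times> Y" "e = (\<lambda>(y, z). {y, z}) (z, y)" using Y 2(2) by auto
        then show ?thesis by blast
      qed
    qed blast
  qed
  then have "card (off_cut_pairs S E F Y x) \<le> card ((odd_pairs S E F Y x \<union> undetermined S E (X \<union> Y)) \<union> ?C)"
    using fin by (intro card_mono) (auto simp: odd_pairs_def undetermined_def)
  also have "\<dots> \<le> card (odd_pairs S E F Y x) + card (undetermined S E (X \<union> Y)) + card ?C"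
    by (meson card_Un_le add_le_mono1 order_trans)
  also have "card ?C \<le> card (?ud \<times> Y)" using fin by (intro card_image_le) auto
  finally show ?thesis by (simp add: card_cartesian_product)
qed

text \<open>Input for averaging: if few pairs are undetermined in total, a typical x in X has few
  undetermined partners in Y.\<close>

lemma sum_card_undetermined_le:
  assumes fin: "finite X" "finite Y" and "X \<inter> Y = {}"
  shows "(\<Sum>x\<in>X. card {y \<in> Y. \<not> determined S E x y}) \<le> card (undetermined S E (X \<union> Y))"
proof -
  let ?P = "SIGMA x:X. {y \<in> Y. \<not> determined S E x y}"
  have "inj_on (\<lambda>(a, b). {a, b}) ?P"
    by (rule inj_on_subset[OF inj_on_doubleton[OF assms(3)]]) auto
  then have "card ?P = card ((\<lambda>(a, b). {a, b}) ` ?P)" by (simp add: card_image)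
  also have "\<dots> \<le> card (undetermined S E (X \<union> Y))"
  proof (rule card_mono)
    show "finite (undetermined S E (X \<union> Y))" using fin by (simp add: undetermined_def)
    show "(\<lambda>(a, b). {a, b}) ` ?P \<subseteq> undetermined S E (X \<union> Y)"
      using assms(3) unfolding undetermined_def by fastforce
  qed
  finally show ?thesis using fin by simp
qed

section \<open>Independence over disjoint blocks of pairs\<close>

lemma of_bool_Ball: "finite S \<Longrightarrow> of_bool (\<forall>s\<in>S. P s) = (\<Prod>s\<in>S. of_bool (P s) :: real)"
  by (induction S rule: finite_induct) auto

lemma prob_Ball_blocks:
  assumes "finite U" "finite I" "\<And>i. i \<in> I \<Longrightarrow> B i \<subseteq> U"
    and "\<And>i j. i \<in> I \<Longrightarrow> j \<in> I \<Longrightarrow> i \<noteq> j \<Longrightarrow> B i \<inter> B j = {}"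
  shows "prob p U (\<lambda>E. \<forall>i\<in>I. P i (E \<inter> B i)) = (\<Prod>i\<in>I. prob p (B i) (P i))"
proof -
  have "(\<Union>i\<in>I. B i) \<subseteq> U" using assms by auto
  then have "prob p U (\<lambda>E. \<forall>i\<in>I. P i ((E \<inter> (\<Union>i\<in>I. B i)) \<inter> B i)) = prob p (\<Union>i\<in>I. B i) (\<lambda>E. \<forall>i\<in>I. P i (E \<inter> B i))"
    by (rule prob_restrict[OF assms(1)])
  also have "\<dots> = (\<Prod>i\<in>I. prob p (B i) (P i))"
    unfolding prob_def of_bool_Ball[OF assms(2)] using assms
    by (intro expect_blocks) (auto intro: finite_subset)
  finally show ?thesis by (simp add: Int_assoc Int_absorb1 SUP_upper cong: ball_cong)
qed

lemma prob_not_both: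
  assumes "a \<noteq> b"
  shows "prob p {a, b} (\<lambda>E. \<not> (a \<in> E \<and> b \<in> E)) = 1 - p\<^sup>2"
  using assms unfolding prob_def by (simp add: expect_insert power2_eq_square algebra_simps)

lemma prob_no_common_neighbour:
  assumes "finite U" "finite S" "\<And>s. s \<in> S \<Longrightarrow> {{s, y}, {s, z}} \<subseteq> U" "y \<noteq> z" "y \<notin> S" "z \<notin> S"
  shows "prob p U (\<lambda>E. \<forall>s\<in>S. \<not> ({s, y} \<in> E \<and> {s, z} \<in> E)) = (1 - p\<^sup>2) ^ card S"
proof -
  let ?P = "\<lambda>s E. \<not> ({s, y} \<in> E \<and> {s, z} \<in> E)" and ?B = "\<lambda>s. {{s, y}, {s, z}}"
  have "prob p U (\<lambda>E. \<forall>s\<in>S. ?P s E) = prob p U (\<lambda>E. \<forall>s\<in>S. ?P s (E \<inter> ?B s))"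
    by (rule prob_cong) auto
  also have "\<dots> = (\<Prod>s\<in>S. prob p (?B s) (?P s))"
    by (rule prob_Ball_blocks) (use assms in \<open>auto simp: doubleton_eq_iff\<close>)
  also have "\<dots> = (\<Prod>s\<in>S. 1 - p\<^sup>2)"
    by (rule prod.cong[OF refl], rule prob_not_both) (use assms in \<open>auto simp: doubleton_eq_iff\<close>)
  finally show ?thesis by simp
qed

text \<open>Given the colours on the edges at S, the graph on the remaining vertices must avoid all odd
  triangles; it is exceptional if it does so although there are many odd pairs at every suitable x,
  or if it has unusually many edges among the few pairs on which the colouring is not the cut
  read off from x.\<close>

definition exceptional :: "real \<Rightarrow> nat \<Rightarrow> real \<Rightarrow> real \<Rightarrow> real \<Rightarrow> 'a set \<Rightarrow> 'a set \<Rightarrow> 'a set \<Rightarrow>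
    'a set set \<Rightarrow> 'a set set \<Rightarrow> 'a set set \<Rightarrow> bool" where
  "exceptional p n \<alpha> \<eta> \<epsilon> S X Y E1 F1 E \<longleftrightarrow>
    (let X' = {x \<in> X. real (card {y \<in> Y. \<not> determined S E1 x y}) \<le> \<alpha> * real n} in
      (\<forall>x\<in>X'. \<eta> * (real n)\<^sup>2 \<le> real (card (odd_pairs S E1 F1 Y x)) \<and>
        E \<inter> odd_pairs S E1 F1 Y x \<inter> pairs (nbr E x \<inter> Y) = {}) \<or>
      (\<exists>x\<in>X'. real (card (odd_pairs S E1 F1 Y x)) < \<eta> * (real n)\<^sup>2 \<and>
        \<epsilon> * ((real n)\<^sup>2 * p) < real (card (E \<inter> off_cut_pairs S E1 F1 Y x))))"

text \<open>If all suitable x have many odd pairs, the first two terms bound the probability of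
  avoiding their odd triangles. If some x has few, its off-cut set has at most \<epsilon> n^2 / 4
  pairs, and the third term is a Chernoff bound on the edges in it, summed over x.\<close>

lemma exceptional_prob:
  fixes p \<alpha> \<beta> \<eta> \<epsilon> \<xi> :: real and n :: nat
  assumes p01: "0 \<le> p" "p \<le> 1" and fin: "finite X" "finite Y" and disj: "X \<inter> Y = {}"
    and cards: "card Y \<le> n" "card X \<le> n" "\<xi> * n / 2 \<le> card X" and n: "n \<ge> 1"
    and und: "card (undetermined S E1 (X \<union> Y)) \<le> \<beta> * (real n)\<^sup>2"
    and pos: "\<alpha> > 0" "\<eta> > 0" "\<xi> > 0" and \<beta>: "\<beta> = \<alpha> * \<xi> / 4" and sm: "4 * (\<eta> + \<beta> + \<alpha>) \<le> \<epsilon>"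
    and big: "\<eta> / 2 * n \<ge> 4" "\<eta> / 2 * (n * p\<^sup>2) \<ge> 4" "3 \<le> exp (\<eta> / 2 * (n * p) / 40)"
  shows "prob p (cross X Y \<union> pairs Y) (exceptional p n \<alpha> \<eta> \<epsilon> S X Y E1 F1)
     \<le> exp (- (\<eta> / 2 * ((real n)\<^sup>2 * p))) + exp (- (\<eta> * \<xi> / 320 * ((real n)\<^sup>2 * p))) + n * exp (- (\<epsilon> / 2 * ((real n)\<^sup>2 * p)))"
proof -
  let ?U = "cross X Y \<union> pairs Y"
  let ?odd = "odd_pairs S E1 F1 Y" and ?off = "off_cut_pairs S E1 F1 Y"
  define ud where "ud = (\<lambda>x. {y \<in> Y. \<not> determined S E1 x y})"
  define X' where "X' = {x \<in> X. real (card (ud x)) \<le> \<alpha> * real n}"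
  have X': "X' \<subseteq> X" "finite X'" using fin by (auto simp: X'_def)
  have finU: "finite ?U" using fin by simp
  have q0: "0 \<le> (real n)\<^sup>2 * p" using p01 by simp
  \<comment> \<open>Averaging: by \<beta> = \<alpha> \<xi> / 4 at most \<xi> n / 4 vertices of X
    have more than \<alpha> n undetermined partners, half of the guaranteed size of X.\<close>
  have cX': "\<xi> * n / 4 \<le> card X'"
  proof -
    have "\<alpha> * n \<le> card (ud x)" if "x \<in> X - X'" for x using that by (auto simp: X'_def)
    then have "card (X - X') * (\<alpha> * n) \<le> (\<Sum>x\<in>X - X'. real (card (ud x)))"
      by (rule sum_bounded_below)
    also have "\<dots> \<le> (\<Sum>x\<in>X. real (card (ud x)))" using fin by (intro sum_mono2) auto
    also have "\<dots> \<le> card (undetermined S E1 (X \<union> Y))"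
      using sum_card_undetermined_le[OF fin disj, of S E1] unfolding ud_def by (simp flip: of_nat_sum)
    also have "\<dots> \<le> \<xi> * n / 4 * (\<alpha> * n)" using und \<beta> by (simp add: power2_eq_square mult_ac)
    finally have "card (X - X') \<le> \<xi> * n / 4" using pos n by simp
    moreover have "real (card X) = card X' + card (X - X')"
      using card_Diff_subset[OF X'(2,1)] card_mono[OF fin(1) X'(1)] by simp
    ultimately show ?thesis using cards by linarith
  qed
  \<comment> \<open>Half of the rate in \<open>random_subset_surviving\<close> is given up to absorb
    the factor 3.\<close>
  define r where "r = exp (- (\<eta> / 2 * (n * p)) / 40)"
  let ?A = "\<lambda>E. \<forall>x\<in>X'. \<eta> * (real n)\<^sup>2 \<le> card (?odd x) \<and> E \<inter> ?odd x \<inter> pairs (nbr E x \<inter> Y) = {}"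
  let ?B = "\<lambda>x E. card (?odd x) < \<eta> * (real n)\<^sup>2 \<and> \<epsilon> * ((real n)\<^sup>2 * p) < card (E \<inter> ?off x)"
  have "prob p ?U ?A \<le> exp (- (\<eta> / 2 * ((real n)\<^sup>2 * p))) + exp (- (\<eta> * \<xi> / 320 * ((real n)\<^sup>2 * p)))"
  proof (cases "\<forall>x\<in>X'. \<eta> * (real n)\<^sup>2 \<le> card (?odd x)")
    case True
    let ?U' = "cross X' Y \<union> pairs Y"
    have sub: "?U' \<subseteq> ?U" using X'(1) unfolding cross_def by blast
    have "prob p ?U ?A \<le> prob p ?U (\<lambda>E. \<forall>x\<in>X'. (E \<inter> ?U') \<inter> ?odd x \<inter> pairs (nbr (E \<inter> ?U') x \<inter> Y) = {})"
    proof (rule prob_mono[OF p01], rule ballI)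
      fix E x assume "?A E" "x \<in> X'"
      then have "E \<inter> ?odd x \<inter> pairs (nbr E x \<inter> Y) = {}" by blast
      moreover have "pairs (nbr (E \<inter> ?U') x \<inter> Y) \<subseteq> pairs (nbr E x \<inter> Y)"
        by (rule pairs_mono) (auto simp: nbr_iff)
      ultimately show "(E \<inter> ?U') \<inter> ?odd x \<inter> pairs (nbr (E \<inter> ?U') x \<inter> Y) = {}" by blast
    qed
    also have "\<dots> = prob p ?U' (\<lambda>E. \<forall>x\<in>X'. E \<inter> ?odd x \<inter> pairs (nbr E x \<inter> Y) = {})"
      by (rule prob_restrict[OF finU sub])
    also have "\<dots> \<le> exp (- (\<eta> / 2 * ((real n)\<^sup>2 * p))) + r ^ card X'"
    \<comment> \<open>M is half of the guaranteed number of odd pairs, so that a further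
      neighbourhood still meets M pairs not yet excluded.\<close>
    proof (rule prob_no_bad_triangle[OF p01 X'(2) fin(2), where M = "\<eta> / 2 * (real n)\<^sup>2"])
      fix B' assume B': "B' \<subseteq> pairs Y" "\<eta> / 2 * (real n)\<^sup>2 \<le> card B'"
      have "expect p Y (\<lambda>N. (1 - p) ^ card (B' \<inter> pairs N)) \<le> 3 * exp (- (\<eta> / 2 * (n * p)) / 20)"
        by (rule random_subset_surviving[OF p01 fin(2) cards(1) B'(1)]) (use B'(2) pos big in auto)
      also have "\<dots> \<le> exp (\<eta> / 2 * (n * p) / 40) * exp (- (\<eta> / 2 * (n * p)) / 20)"
        using big by (intro mult_right_mono) auto
      also have "\<dots> = r" unfolding r_def by (simp flip: exp_add)
      finally show "expect p Y (\<lambda>N. (1 - p) ^ card (B' \<inter> pairs N)) \<le> r" .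
    next
      fix k :: nat assume "\<eta> / 2 * (real n)\<^sup>2 \<le> k"
      then have "p * (\<eta> / 2 * (real n)\<^sup>2) \<le> p * k" using p01 by (intro mult_left_mono) auto
      then have "- (p * k) \<le> - (\<eta> / 2 * ((real n)\<^sup>2 * p))" by (simp add: mult_ac)
      then show "(1 - p) ^ k \<le> exp (- (\<eta> / 2 * ((real n)\<^sup>2 * p)))"
        by (rule exp_bound_mono) (rule one_minus_power_le_exp[OF p01])
    qed (use X' disj True in \<open>auto simp: r_def odd_pairs_def\<close>)
    also have "r ^ card X' \<le> exp (- (\<eta> * \<xi> / 320 * ((real n)\<^sup>2 * p)))"
    proof -
      have "\<eta> / 2 * (n * p) / 40 * (\<xi> * n / 4) \<le> \<eta> / 2 * (n * p) / 40 * card X'"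
        using cX' pos p01 by (intro mult_left_mono) auto
      moreover have "\<eta> / 2 * (n * p) / 40 * (\<xi> * n / 4) = \<eta> * \<xi> / 320 * ((real n)\<^sup>2 * p)"
        by (simp add: power2_eq_square)
      moreover have "r ^ card X' = exp (- (\<eta> / 2 * (n * p) / 40 * card X'))"
        unfolding r_def exp_of_nat_mult[symmetric] by (simp add: mult_ac)
      ultimately show ?thesis by (simp only: exp_le_cancel_iff neg_le_iff_le)
    qed
    finally show ?thesis by simp
  next
    case False
    then have "prob p ?U ?A \<le> prob p ?U (\<lambda>E. False)" by (intro prob_mono[OF p01]) blast
    also have "\<dots> = 0" using finU by (simp add: prob_def)
    finally show ?thesis by (simp add: add_nonneg_nonneg order_trans)
  qed
  moreover have "prob p ?U (\<lambda>E. \<exists>x\<in>X'. ?B x E) \<le> n * exp (- (\<epsilon> / 2 * ((real n)\<^sup>2 * p)))"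
  proof (rule prob_Bex_le[OF p01 X'(2)])
    fix x assume x: "x \<in> X'"
    show "prob p ?U (?B x) \<le> exp (- (\<epsilon> / 2 * ((real n)\<^sup>2 * p)))"
    proof (cases "card (?odd x) < \<eta> * (real n)\<^sup>2")
      case True
      have xX: "x \<in> X" using x X' by blast
      have "real (card (?off x)) \<le> card (?odd x) + card (undetermined S E1 (X \<union> Y)) + card (ud x) * real (card Y)"
        using card_off_cut_pairs_le[OF fin xX, of S E1 F1] unfolding ud_def
        by (metis of_nat_add of_nat_le_iff of_nat_mult)
      also have "card (ud x) * real (card Y) \<le> (\<alpha> * n) * n"
        using x cards pos by (intro mult_mono) (auto simp: X'_def)
      finally have c: "real (card (?off x)) \<le> (\<eta> + \<beta> + \<alpha>) * (real n)\<^sup>2"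
        using True und by (simp add: power2_eq_square algebra_simps)
      have e1: "0 \<le> exp 1 - (1::real)" "exp 1 - (1::real) \<le> 2" using exp_le by auto
      have "p * (exp 1 - 1) * card (?off x) \<le> p * 2 * ((\<eta> + \<beta> + \<alpha>) * (real n)\<^sup>2)"
        using c p01 e1 by (intro mult_mono) auto
      also have "\<dots> = 2 * (\<eta> + \<beta> + \<alpha>) * ((real n)\<^sup>2 * p)" by simp
      also have "\<dots> \<le> (\<epsilon> / 2) * ((real n)\<^sup>2 * p)" using sm q0 by (intro mult_right_mono) auto
      finally have 1: "p * (exp 1 - 1) * card (?off x) - \<epsilon> * ((real n)\<^sup>2 * p) * ln (exp 1) \<le> - (\<epsilon> / 2 * ((real n)\<^sup>2 * p))"
        by simp
      show ?thesis
        by (rule exp_bound_mono[OF 1], rule chernoff_upper[OF p01 finU])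
          (auto simp: off_cut_pairs_def odd_pairs_def)
    next
      case False
      then have "prob p ?U (?B x) = 0" using finU by (simp add: prob_def)
      then show ?thesis by simp
    qed
  next
    have "card X' \<le> card X" by (rule card_mono[OF fin(1) X'(1)])
    then show "real (card X') \<le> n" using cards by simp
  qed auto
  moreover have "prob p ?U (exceptional p n \<alpha> \<eta> \<epsilon> S X Y E1 F1) \<le> prob p ?U ?A + prob p ?U (\<lambda>E. \<exists>x\<in>X'. ?B x E)"
    by (rule prob_disj[OF p01]) (simp add: exceptional_def Let_def X'_def ud_def)
  ultimately show ?thesis by linarith
qed

text \<open>A union bound over the traces F1 of F on the exposed edges E1 at S. Unless E1 is
  unusually large there are at most exp(3 \<sigma> n^2 p) traces, and the bound b applies to each of
  them because the pairs off S are independent of E1.\<close>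

lemma large_witness_prob:
  fixes p \<alpha> \<beta> \<eta> \<epsilon> \<epsilon>0 \<xi> \<sigma> b :: real and n :: nat and S X Y :: "nat set"
  assumes p01: "0 \<le> p" "p \<le> 1" and V: "S \<union> X \<union> Y = {1..n}" and disj: "X \<inter> Y = {}" "S \<inter> (X \<union> Y) = {}"
    and n: "n \<ge> 1" and \<sigma>: "card S \<le> \<sigma> * n" "\<sigma> > 0" and b: "\<beta> > 0"
    and sz: "101/100 * (real (card S) + card X) + \<epsilon> * n \<le> \<epsilon>0 * n"
    and ex: "\<And>E1 F1. card (undetermined S E1 (X \<union> Y)) \<le> \<beta> * (real n)\<^sup>2 \<Longrightarrow>
       prob p (cross X Y \<union> pairs Y) (exceptional p n \<alpha> \<eta> \<epsilon> S X Y E1 F1) \<le> b" and b0: "0 \<le> b"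
  shows "prob p (pairs {1..n}) (\<lambda>E. (\<forall>v\<in>{1..n}. real (card (nbr E v)) \<le> 101/100 * (n * p)) \<and>
      (\<exists>F. witness E F \<and> \<epsilon>0 * ((real n)\<^sup>2 * p) < real (card F)))
    \<le> exp (- (\<sigma> / 2 * ((real n)\<^sup>2 * p))) + exp (- (p\<^sup>2 * card S)) / \<beta> + exp (3 * \<sigma> * ((real n)\<^sup>2 * p)) * b"
proof -
  let ?V = "{1..n}" and ?W = "X \<union> Y"
  let ?U1 = "cross S ?W" and ?U' = "cross X Y \<union> pairs Y"
  let ?q = "(real n)\<^sup>2 * p"
  have fin: "finite S" "finite X" "finite Y" using V by (metis finite_Un finite_atLeastAtMost)+
  have finV: "finite (pairs ?V)" by simp
  have sub: "?U1 \<subseteq> pairs ?V" "?U' \<subseteq> pairs ?V"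
    using V disj cross_subset_pairs[of S ?V ?W] cross_subset_pairs[of X ?V Y] pairs_mono[of Y ?V] by blast+
  have dU: "?U1 \<inter> ?U' = {}"
    using disj by (auto simp: cross_def doubleton_eq_iff)
  have cW: "card ?W \<le> n"
  proof -
    have "card ?W \<le> card ?V" using V by (intro card_mono) auto
    then show ?thesis by simp
  qed
  let ?und = "\<lambda>E. undetermined S (E \<inter> ?U1) ?W"
  let ?T1 = "\<lambda>E. 3 * \<sigma> * ?q \<le> card (E \<inter> ?U1)"
  let ?T2 = "\<lambda>E. \<beta> * (real n)\<^sup>2 < card (?und E)"
  let ?T3 = "\<lambda>E. card (E \<inter> ?U1) \<le> 3 * \<sigma> * ?q \<and> card (?und E) \<le> \<beta> * (real n)\<^sup>2 \<and>
      (\<exists>F1\<subseteq>E \<inter> ?U1. exceptional p n \<alpha> \<eta> \<epsilon> S X Y (E \<inter> ?U1) F1 (E \<inter> ?U'))"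
  let ?BAD = "\<lambda>E. (\<forall>v\<in>?V. real (card (nbr E v)) \<le> 101/100 * (n * p)) \<and> (\<exists>F. witness E F \<and> \<epsilon>0 * ?q < real (card F))"
  \<comment> \<open>By \<open>sz\<close>, the edges meeting S or X leave more than \<epsilon> n^2 p
    edges off the cut for every suitable x. Since F also allows no odd triangle, its trace is
    exceptional whether or not some suitable x has few odd pairs.\<close>
  have bad: "?T1 E \<or> (?T2 E \<or> ?T3 E)" if E: "E \<subseteq> pairs ?V" and BAD: "?BAD E" for E
  proof (cases "?T1 E \<or> ?T2 E")
    case False
    obtain F where F: "F \<subseteq> E" "triangle_even E F" "\<And>A. card F \<le> card (sym_diff F (cut E A))" "\<epsilon>0 * ?q < real (card F)"
      using BAD unfolding witness_def by blast
    let ?E1 = "E \<inter> ?U1" and ?F1 = "F \<inter> ?U1"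
    have "exceptional p n \<alpha> \<eta> \<epsilon> S X Y ?E1 ?F1 (E \<inter> ?U')"
    proof -
      define X' where "X' = {x \<in> X. real (card {y \<in> Y. \<not> determined S ?E1 x y}) \<le> \<alpha> * real n}"
      have "(E \<inter> ?U') \<inter> odd_pairs S ?E1 ?F1 Y x \<inter> pairs (nbr (E \<inter> ?U') x \<inter> Y) = {}" if "x \<in> X'" for x
      proof -
        have "E \<inter> odd_pairs S ?E1 ?F1 Y x \<inter> pairs (nbr E x \<inter> Y) = {}"
          by (rule no_odd_triangle[OF F(2)]) (use that in \<open>auto simp: X'_def\<close>)
        moreover have "pairs (nbr (E \<inter> ?U') x \<inter> Y) \<subseteq> pairs (nbr E x \<inter> Y)"
          by (rule pairs_mono) (auto simp: nbr_iff)
        ultimately show ?thesis by blast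
      qed
      moreover have "\<epsilon> * ?q < card ((E \<inter> ?U') \<inter> off_cut_pairs S ?E1 ?F1 Y x)" if "x \<in> X'" for x
      proof -
        have "card F \<le> card (E \<inter> off_cut_pairs S ?E1 ?F1 Y x) + (card S + card X) * (101/100 * (n * p))"
          by (rule card_witness_le[OF _ fin F(1,2,3)]) (use E V BAD that in \<open>auto simp: X'_def\<close>)
        moreover have "(E \<inter> ?U') \<inter> off_cut_pairs S ?E1 ?F1 Y x = E \<inter> off_cut_pairs S ?E1 ?F1 Y x"
          by (auto simp: off_cut_pairs_def odd_pairs_def)
        moreover have "(101/100 * (real (card S) + card X) + \<epsilon> * n) * (n * p) \<le> (\<epsilon>0 * n) * (n * p)"
          using sz p01 by (intro mult_right_mono) auto
        then have "(card S + card X) * (101/100 * (n * p)) + \<epsilon> * ?q \<le> \<epsilon>0 * ?q"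
          by (simp add: power2_eq_square algebra_simps)
        ultimately show ?thesis using F(4) by simp
      qed
      ultimately show ?thesis unfolding exceptional_def Let_def X'_def[symmetric] by (meson not_le)
    qed
    then show ?thesis using False F(1) by (meson Int_mono linear not_le order_refl)
  qed blast
  have P1: "prob p (pairs ?V) ?T1 \<le> exp (- (\<sigma> / 2 * ?q))"
  proof -
    have "real (card ?U1) \<le> \<sigma> * n * n"
    proof -
      have "real (card ?U1) = card S * real (card ?W)" by (simp add: card_cross[OF disj(2)])
      also have "\<dots> \<le> (\<sigma> * n) * n" using \<sigma> cW by (intro mult_mono) auto
      finally show ?thesis .
    qed
    then have "p * real (card ?U1) \<le> p * (\<sigma> * n * n)" using p01 by (intro mult_left_mono) auto
    then have "p * (2 - 1) * card ?U1 \<le> \<sigma> * ?q" by (simp add: power2_eq_square mult_ac)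
    moreover have "3 * \<sigma> * ?q * (1/2) \<le> 3 * \<sigma> * ?q * ln 2"
      using ln_ge_one_minus_inverse[of 2] p01 \<sigma> by (intro mult_left_mono) auto
    ultimately have 1: "p * (2 - 1) * card ?U1 - 3 * \<sigma> * ?q * ln 2 \<le> - (\<sigma> / 2 * ?q)" by linarith
    show ?thesis by (rule exp_bound_mono[OF 1], rule chernoff_upper[OF p01 finV sub(1)]) auto
  qed
  \<comment> \<open>First moment: a given pair has no common neighbour in S with probability at most
    exp(-p^2 card S), and the number of pairs, at most n^2, cancels against the threshold \<beta>
    n^2.\<close>
  have P2: "prob p (pairs ?V) ?T2 \<le> exp (- (p\<^sup>2 * card S)) / \<beta>"
  proof -
    have bn: "\<beta> * (real n)\<^sup>2 > 0" using b n by simp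
    have "prob p (pairs ?V) ?T2
      \<le> expect p (pairs ?V) (\<lambda>E. 1 / (\<beta> * (real n)\<^sup>2) * (\<Sum>e\<in>pairs ?W. of_bool (e \<in> ?und E)))"
    proof (rule prob_markov[OF p01])
      fix E assume T: "?T2 E"
      have "(\<Sum>e\<in>pairs ?W. of_bool (e \<in> ?und E) :: real) = card (pairs ?W \<inter> ?und E)"
        using fin by (simp add: of_bool_def sum.If_cases)
      moreover have "pairs ?W \<inter> ?und E = ?und E"
        by (auto simp: undetermined_def)
      ultimately show "1 \<le> 1 / (\<beta> * (real n)\<^sup>2) * (\<Sum>e\<in>pairs ?W. of_bool (e \<in> ?und E))"
        using T bn by simp
    qed (use bn in \<open>simp add: divide_nonneg_pos sum_nonneg\<close>)
    also have "\<dots> = 1 / (\<beta> * (real n)\<^sup>2) * (\<Sum>e\<in>pairs ?W. prob p (pairs ?V) (\<lambda>E. e \<in> ?und E))"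
      by (simp only: expect_cmult expect_sum prob_def)
    also have "\<dots> \<le> 1 / (\<beta> * (real n)\<^sup>2) * ((real n)\<^sup>2 * exp (- (p\<^sup>2 * card S)))"
    proof (rule mult_left_mono)
      have "prob p (pairs ?V) (\<lambda>E. e \<in> ?und E) \<le> exp (- (p\<^sup>2 * card S))" if e: "e \<in> pairs ?W" for e
      proof -
        obtain y z where yz: "e = {y, z}" "y \<in> ?W" "z \<in> ?W" "y \<noteq> z" using e by (blast elim: pairs_cases)
        have nS: "y \<notin> S" "z \<notin> S" using yz disj by auto
        have "prob p (pairs ?V) (\<lambda>E. e \<in> ?und E)
          \<le> prob p (pairs ?V) (\<lambda>E. \<forall>s\<in>S. \<not> ({s, y} \<in> E \<and> {s, z} \<in> E))"
        proof (rule prob_mono[OF p01])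
          fix E assume "e \<in> ?und E"
          then have "\<not> determined S (E \<inter> ?U1) y z"
            using yz(1) determined_sym[of S "E \<inter> ?U1"] by (auto simp: undetermined_def doubleton_eq_iff)
          moreover have "{s, y} \<in> ?U1" "{s, z} \<in> ?U1" if "s \<in> S" for s using that yz by (auto simp: cross_iff)
          ultimately show "\<forall>s\<in>S. \<not> ({s, y} \<in> E \<and> {s, z} \<in> E)" by (auto simp: determined_def)
        qed
        also have "\<dots> = (1 - p\<^sup>2) ^ card S"
        proof (rule prob_no_common_neighbour[OF finV fin(1) _ yz(4) nS])
          fix s assume "s \<in> S"
          then have "{{s, y}, {s, z}} \<subseteq> ?U1" using yz by (auto simp: cross_iff)
          then show "{{s, y}, {s, z}} \<subseteq> pairs ?V" using sub by blast
        qed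
        also have "\<dots> \<le> exp (- (p\<^sup>2 * card S))" by (rule one_minus_power_le_exp) (use p01 in \<open>auto simp: power_le_one\<close>)
        finally show ?thesis .
      qed
      then have "(\<Sum>e\<in>pairs ?W. prob p (pairs ?V) (\<lambda>E. e \<in> ?und E))
         \<le> card (pairs ?W) * exp (- (p\<^sup>2 * card S))"
        using sum_bounded_above[of "pairs ?W" "\<lambda>e. prob p (pairs ?V) (\<lambda>E. e \<in> ?und E)"
            "exp (- (p\<^sup>2 * card S))"] by simp
      also have "\<dots> \<le> (real n)\<^sup>2 * exp (- (p\<^sup>2 * card S))"
      proof (rule mult_right_mono)
        have "card ?W * real (card ?W) \<le> n * real n" using cW by (intro mult_mono) auto
        then show "real (card (pairs ?W)) \<le> (real n)\<^sup>2"
          using card_pairs_le[of ?W] fin by (simp add: power2_eq_square)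
      qed simp
      finally show "(\<Sum>e\<in>pairs ?W. prob p (pairs ?V) (\<lambda>E. e \<in> ?und E))
         \<le> (real n)\<^sup>2 * exp (- (p\<^sup>2 * card S))" .
    qed (use bn in simp)
    also have "\<dots> = exp (- (p\<^sup>2 * card S)) / \<beta>" using n by simp
    finally show ?thesis .
  qed
  have P3: "prob p (pairs ?V) ?T3 \<le> exp (3 * \<sigma> * ?q) * b"
  proof -
    let ?H = "\<lambda>E1 E'. card E1 \<le> 3 * \<sigma> * ?q \<and> card (undetermined S E1 ?W) \<le> \<beta> * (real n)\<^sup>2 \<and>
      (\<exists>F1\<subseteq>E1. exceptional p n \<alpha> \<eta> \<epsilon> S X Y E1 F1 E')"
    have "prob p (pairs ?V) ?T3 = prob p (pairs ?V) (\<lambda>E. ?H ((E \<inter> (?U1 \<union> ?U')) \<inter> ?U1) ((E \<inter> (?U1 \<union> ?U')) \<inter> ?U'))"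
    proof (rule prob_cong)
      fix E :: "nat set set"
      have "(E \<inter> (?U1 \<union> ?U')) \<inter> ?U1 = E \<inter> ?U1" "(E \<inter> (?U1 \<union> ?U')) \<inter> ?U' = E \<inter> ?U'" by blast+
      then show "?T3 E \<longleftrightarrow> ?H ((E \<inter> (?U1 \<union> ?U')) \<inter> ?U1) ((E \<inter> (?U1 \<union> ?U')) \<inter> ?U')" by (simp only:)
    qed
    also have "\<dots> = prob p (?U1 \<union> ?U') (\<lambda>E. ?H (E \<inter> ?U1) (E \<inter> ?U'))"
      by (rule prob_restrict[OF finV, where P = "\<lambda>E. ?H (E \<inter> ?U1) (E \<inter> ?U')"]) (use sub in blast)
    also have "\<dots> = expect p ?U1 (\<lambda>A. prob p ?U' (\<lambda>B. ?H ((A \<union> B) \<inter> ?U1) ((A \<union> B) \<inter> ?U')))"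
      by (rule prob_union) (use fin dU in auto)
    also have "\<dots> = expect p ?U1 (\<lambda>A. prob p ?U' (\<lambda>B. ?H A B))"
    proof (intro expect_cong prob_cong)
      fix A B assume "A \<subseteq> ?U1" "B \<subseteq> ?U'"
      then have "(A \<union> B) \<inter> ?U1 = A" "(A \<union> B) \<inter> ?U' = B" using dU by blast+
      then show "?H ((A \<union> B) \<inter> ?U1) ((A \<union> B) \<inter> ?U') \<longleftrightarrow> ?H A B" by (simp only:)
    qed
    also have "\<dots> \<le> exp (3 * \<sigma> * ?q) * b"
    proof (rule expect_le_const[OF p01])
      fix E1 assume E1: "E1 \<subseteq> ?U1"
      have finE1: "finite E1" by (rule finite_subset[OF E1]) (use fin in simp)
      show "prob p ?U' (?H E1) \<le> exp (3 * \<sigma> * ?q) * b"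
      proof (cases "card E1 \<le> 3 * \<sigma> * ?q \<and> card (undetermined S E1 ?W) \<le> \<beta> * (real n)\<^sup>2")
        case True
        show ?thesis
        proof (rule prob_Bex_le[OF p01, where I = "Pow E1" and Q = "exceptional p n \<alpha> \<eta> \<epsilon> S X Y E1"])
          have "real (card (Pow E1)) \<le> exp (card E1)" using two_power_le_exp finE1 by (simp add: card_Pow)
          also have "\<dots> \<le> exp (3 * \<sigma> * ?q)" using True by simp
          finally show "real (card (Pow E1)) \<le> exp (3 * \<sigma> * ?q)" .
        qed (use finE1 ex True b0 in auto)
      next
        case False
        then have "prob p ?U' (?H E1) \<le> prob p ?U' (\<lambda>E. False)" by (intro prob_mono[OF p01]) blast
        also have "\<dots> = 0" using fin by (simp add: prob_def)
        finally show ?thesis using b0 by (simp add: order_trans)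
      qed
    qed (use fin in auto)
    finally show ?thesis .
  qed
  have "prob p (pairs ?V) ?BAD \<le> prob p (pairs ?V) ?T1 + (prob p (pairs ?V) ?T2 + prob p (pairs ?V) ?T3)"
    by (rule order_trans[OF prob_disj[OF p01 bad] add_left_mono[OF prob_disj[OF p01]]])
  also have "\<dots> \<le> exp (- (\<sigma> / 2 * ?q)) + (exp (- (p\<^sup>2 * card S)) / \<beta> + exp (3 * \<sigma> * ?q) * b)"
    by (intro add_mono P1 P2 P3)
  finally show ?thesis by simp
qed

lemma large_witness_whp:
  fixes \<epsilon>0 \<delta> :: real
  assumes e0: "0 < \<epsilon>0" "\<epsilon>0 \<le> 1" and \<delta>: "\<delta> > 0"
  shows "\<forall>\<^sub>F n in sequentially. \<forall>p::real. 0 \<le> p \<longrightarrow> p \<le> 1 \<longrightarrow> n * p\<^sup>2 \<ge> 5/4 * ln n \<longrightarrow>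
     prob p (pairs {1..n}) (\<lambda>E. (\<forall>v\<in>{1..n}. real (card (nbr E v)) \<le> 101/100 * (n * p)) \<and>
      (\<exists>F. witness E F \<and> \<epsilon>0 * ((real n)\<^sup>2 * p) < real (card F))) \<le> \<delta>"
proof -
  \<comment> \<open>\<xi> is the density of X, and \<eta> also serves as the threshold \<alpha>.
    \<kappa> lies below all three decay rates of \<open>exceptional_prob\<close>. The density
    \<sigma> of S is \<kappa>/6, so that the exp(3 \<sigma> n^2 p) traces consume just half of the
    rate \<kappa>.\<close>
  define \<xi> where "\<xi> = \<epsilon>0 / 8"
  define \<epsilon> where "\<epsilon> = \<epsilon>0 / 2"
  define \<eta> where "\<eta> = \<epsilon>0 / 32"
  define \<beta> where "\<beta> = \<eta> * \<xi> / 4"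
  define \<kappa> where "\<kappa> = \<eta> * \<xi> / 320"
  define \<sigma> where "\<sigma> = \<kappa> / 6"
  have pos: "\<xi> > 0" "\<epsilon> > 0" "\<eta> > 0" "\<beta> > 0" "\<kappa> > 0" "\<sigma> > 0"
    using e0 by (auto simp: \<xi>_def \<epsilon>_def \<eta>_def \<beta>_def \<kappa>_def \<sigma>_def)
  have \<xi>1: "\<xi> \<le> 1/8" "\<eta> \<le> 1/32" using e0 by (auto simp: \<xi>_def \<eta>_def)
  have \<eta>\<xi>: "\<eta> * \<xi> \<le> \<eta> * (1/8)" "\<eta> * \<xi> \<le> 1/32 * \<xi>" using \<xi>1 pos by (auto intro!: mult_left_mono mult_right_mono)
  have \<beta>\<eta>: "\<beta> \<le> \<eta>" and \<kappa>\<eta>: "\<kappa> \<le> \<eta> / 2" and \<kappa>\<epsilon>: "\<kappa> \<le> \<epsilon> / 2" and \<sigma>\<xi>: "\<sigma> \<le> \<xi>"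
    using \<eta>\<xi> pos e0 by (auto simp: \<beta>_def \<kappa>_def \<epsilon>_def \<sigma>_def \<eta>_def)
  \<comment> \<open>The middle summand decays only polynomially, since p^2 card S may be as small as
    about (5/4) \<sigma> ln n; the 1 in its exponent covers the rounding of card S.\<close>
  define B where "B = (\<lambda>n::nat. exp (- (\<sigma> / 2 * n)) + exp (1 - \<sigma> * (5/4 * ln n)) / \<beta> + (real n + 2) * exp (- (\<kappa> / 2 * n)))"
  have "B \<longlonglongrightarrow> 0" unfolding B_def using pos by real_asymp
  then have "\<forall>\<^sub>F n in sequentially. B n < \<delta>" using \<delta> by (rule order_tendstoD)
  moreover have "\<forall>\<^sub>F n::nat in sequentially. 5/4 * ln n \<ge> 1" by real_asymp
  moreover have "filterlim (\<lambda>n::nat. 5/4 * ln n) at_top sequentially" by real_asymp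
  then have "\<forall>\<^sub>F n::nat in sequentially. 5/4 * ln n \<ge> 160 / \<eta>" unfolding filterlim_at_top by blast
  moreover have "\<forall>\<^sub>F n::nat in sequentially. \<xi> * n \<ge> 2" using pos by real_asymp
  moreover have "\<forall>\<^sub>F n::nat in sequentially. n \<ge> 1" by (rule eventually_ge_at_top)
  ultimately show ?thesis
  proof eventually_elim
    case (elim n)
    show ?case
    proof (intro allI impI)
      fix p :: real assume p: "0 \<le> p" "p \<le> 1" and x: "n * p\<^sup>2 \<ge> 5/4 * ln n"
      let ?q = "(real n)\<^sup>2 * p"
      have "n * p\<^sup>2 \<le> n * p" using p by (intro mult_left_mono) (auto simp: power2_eq_square mult_left_le)
      then have np: "n * p \<ge> 160 / \<eta>" "n * p\<^sup>2 \<ge> 160 / \<eta>" "n * p \<ge> 1" using x elim by linarith+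
      have "n * p \<le> real n * 1" using p by (intro mult_left_mono) auto
      then have nn: "n \<ge> 160 / \<eta>" using np by simp
      have "real n * 1 \<le> n * (n * p)" using np by (intro mult_left_mono) auto
      then have q: "n \<le> ?q" by (simp add: power2_eq_square mult_ac)
      define s where "s = nat \<lfloor>\<sigma> * n\<rfloor>"
      define m where "m = nat \<lfloor>\<xi> * n\<rfloor>"
      have "0 \<le> \<sigma> * n" "0 \<le> \<xi> * n" using pos by auto
      then have s: "s \<le> \<sigma> * n" "\<sigma> * n - 1 \<le> s" and m: "m \<le> \<xi> * n" "\<xi> * n / 2 \<le> m"
        using elim unfolding s_def m_def by linarith+
      have "\<sigma> * n \<le> 1/8 * n" "\<xi> * n \<le> 1/8 * n" using \<sigma>\<xi> \<xi>1 by (intro mult_right_mono; simp)+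
      then have smn: "s + m \<le> n" using s m by linarith
      let ?S = "{1..s}" and ?X = "{s+1..s+m}" and ?Y = "{s+m+1..n}"
      define b where "b = exp (- (\<eta> / 2 * ?q)) + exp (- (\<eta> * \<xi> / 320 * ?q)) + n * exp (- (\<epsilon> / 2 * ?q))"
      have "prob p (pairs {1..n}) (\<lambda>E. (\<forall>v\<in>{1..n}. real (card (nbr E v)) \<le> 101/100 * (n * p)) \<and>
         (\<exists>F. witness E F \<and> \<epsilon>0 * ((real n)\<^sup>2 * p) < real (card F)))
       \<le> exp (- (\<sigma> / 2 * ((real n)\<^sup>2 * p))) + exp (- (p\<^sup>2 * card ?S)) / \<beta> + exp (3 * \<sigma> * ((real n)\<^sup>2 * p)) * b"
      proof (rule large_witness_prob[OF p, where \<alpha> = \<eta> and \<eta> = \<eta> and \<epsilon> = \<epsilon> and X = ?X and Y = ?Y])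
        have sum_le: "101/100 * (x + y) + z / 2 \<le> z" if "x \<le> z / 8" "y \<le> z / 8" "0 \<le> z" for x y z :: real
        proof -
          have "x + y \<le> z / 4" using that by simp
          then have "101/100 * (x + y) \<le> 101/100 * (z / 4)" by (rule mult_left_mono) simp
          also have "\<dots> \<le> z / 2" using that by simp
          finally have "101/100 * (x + y) + z / 2 \<le> z / 2 + z / 2" by (rule add_right_mono)
          then show ?thesis by (simp only: field_sum_of_halves)
        qed
        have "s \<le> \<epsilon>0 * n / 8" "m \<le> \<epsilon>0 * n / 8"
          using s m mult_right_mono[OF \<sigma>\<xi>, of n] by (auto simp: \<xi>_def)
        moreover have "0 \<le> \<epsilon>0 * n" using e0 by simp
        moreover have "card ?S = s" "card ?X = m" "\<epsilon> * n = \<epsilon>0 * n / 2" by (auto simp: \<epsilon>_def)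
        ultimately show "101/100 * (real (card ?S) + card ?X) + \<epsilon> * n \<le> \<epsilon>0 * n"
          using sum_le[of s "\<epsilon>0 * n" m] by (simp only:)
        fix E1 F1 :: "nat set set" assume und: "card (undetermined ?S E1 (?X \<union> ?Y)) \<le> \<beta> * (real n)\<^sup>2"
        show "prob p (cross ?X ?Y \<union> pairs ?Y) (exceptional p n \<eta> \<eta> \<epsilon> ?S ?X ?Y E1 F1) \<le> b"
          unfolding b_def
        proof (rule exceptional_prob[OF p _ _ _ _ _ _ _ und])
          show "4 * (\<eta> + \<beta> + \<eta>) \<le> \<epsilon>" using \<beta>\<eta> e0 by (simp add: \<epsilon>_def \<eta>_def)
          show "\<eta> / 2 * n \<ge> 4" "\<eta> / 2 * (n * p\<^sup>2) \<ge> 4" using nn np pos by (auto simp: field_simps)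
          have "2 \<le> \<eta> / 2 * (n * p) / 40" using np pos by (auto simp: field_simps)
          then show "3 \<le> exp (\<eta> / 2 * (n * p) / 40)"
            using exp_ge_add_one_self[of "\<eta> / 2 * (n * p) / 40"] by linarith
        qed (use smn m pos elim in \<open>auto simp: \<beta>_def\<close>)
      qed (use smn s m pos elim in \<open>auto simp: b_def\<close>)
      also have "\<dots> \<le> B n"
        unfolding B_def
      proof (intro add_mono)
        show "exp (- (\<sigma> / 2 * ?q)) \<le> exp (- (\<sigma> / 2 * n))" using q pos by simp
        have "\<sigma> * (5/4 * ln n) \<le> \<sigma> * (n * p\<^sup>2)" using x pos by (intro mult_left_mono) auto
        moreover have "p\<^sup>2 * (\<sigma> * n - 1) \<le> p\<^sup>2 * s" using s by (intro mult_left_mono) auto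
        then have "\<sigma> * (n * p\<^sup>2) - p\<^sup>2 \<le> p\<^sup>2 * s" by (simp add: algebra_simps)
        moreover have "p\<^sup>2 \<le> 1" using p by (simp add: power_le_one)
        ultimately have "- (p\<^sup>2 * card ?S) \<le> 1 - \<sigma> * (5/4 * ln n)" by simp
        then show "exp (- (p\<^sup>2 * card ?S)) / \<beta> \<le> exp (1 - \<sigma> * (5/4 * ln n)) / \<beta>"
          using pos by (intro divide_right_mono) auto
        have "b \<le> exp (- (\<kappa> * ?q)) + exp (- (\<kappa> * ?q)) + n * exp (- (\<kappa> * ?q))"
          unfolding b_def
        proof (intro add_mono mult_left_mono)
          have q0: "0 \<le> ?q" using p by simp
          show "exp (- (\<eta> / 2 * ?q)) \<le> exp (- (\<kappa> * ?q))" using mult_right_mono[OF \<kappa>\<eta> q0] by simp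
          show "exp (- (\<epsilon> / 2 * ?q)) \<le> exp (- (\<kappa> * ?q))" using mult_right_mono[OF \<kappa>\<epsilon> q0] by simp
          show "exp (- (\<eta> * \<xi> / 320 * ?q)) \<le> exp (- (\<kappa> * ?q))" by (simp add: \<kappa>_def)
        qed simp
        then have "b \<le> (real n + 2) * exp (- (\<kappa> * ?q))" by (simp add: algebra_simps)
        then have "exp (3 * \<sigma> * ?q) * b \<le> exp (3 * \<sigma> * ?q) * ((real n + 2) * exp (- (\<kappa> * ?q)))"
          by (rule mult_left_mono) simp
        also have "\<dots> = (real n + 2) * exp (3 * \<sigma> * ?q + - (\<kappa> * ?q))" by (simp only: exp_add mult_ac)
        also have "3 * \<sigma> * ?q + - (\<kappa> * ?q) = - (\<kappa> / 2 * ?q)" by (simp add: \<sigma>_def field_simps)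
        also have "(real n + 2) * exp (- (\<kappa> / 2 * ?q)) \<le> (real n + 2) * exp (- (\<kappa> / 2 * n))"
          using q pos by (intro mult_left_mono) auto
        finally show "exp (3 * \<sigma> * ?q) * b \<le> (real n + 2) * exp (- (\<kappa> / 2 * n))" .
      qed
      finally show "prob p (pairs {1..n}) (\<lambda>E. (\<forall>v\<in>{1..n}. real (card (nbr E v)) \<le> 101/100 * (n * p)) \<and>
         (\<exists>F. witness E F \<and> \<epsilon>0 * ((real n)\<^sup>2 * p) < real (card F))) \<le> \<delta>" using elim by linarith
    qed
  qed
qed

section \<open>Edges in no triangle\<close>

text \<open>Stated through e as a set, so that it can be summed over \<open>pairs\<close>. A vertex
  w in e always passes the test in a graph, since singletons are not edges.\<close>

definition lonely :: "nat set set \<Rightarrow> nat set \<Rightarrow> bool" where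
  "lonely E e \<longleftrightarrow> e \<in> E \<and> (\<forall>w. \<exists>v\<in>e. {w, v} \<notin> E)"

lemma lonely_doubleton:
  "lonely E {a, b} \<longleftrightarrow> {a, b} \<in> E \<and> (\<forall>w. \<not> ({w, a} \<in> E \<and> {w, b} \<in> E))"
  by (auto simp: lonely_def)

lemma not_lonely: "every_edge_in_triangle E \<Longrightarrow> \<not> lonely E e"
proof
  assume ev: "every_edge_in_triangle E" and l: "lonely E e"
  then obtain T where T: "T \<in> triangles E" "e \<in> T" by (auto simp: every_edge_in_triangle_def lonely_def)
  then obtain a b c where *: "T = {{a,b},{b,c},{a,c}}" "{a,b} \<in> E" "{b,c} \<in> E" "{a,c} \<in> E"
    by (auto simp: triangles_def)
  then consider "e = {a, b}" | "e = {b, c}" | "e = {a, c}" using T(2) by blast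
  then show False
    by cases (use l * in \<open>auto simp: lonely_doubleton insert_commute\<close>)
qed

lemma prob_superset:
  assumes "finite U" "A \<subseteq> U"
  shows "prob p U (\<lambda>E. A \<subseteq> E) = p ^ card A"
proof -
  have fin: "finite A" using assms finite_subset by blast
  have "prob p A (\<lambda>E. A \<subseteq> E) = p ^ card A"
    using fin
  proof (induction A rule: finite_induct)
    case (insert a A)
    have "prob p (insert a A) (\<lambda>E. insert a A \<subseteq> E)
       = p * expect p A (\<lambda>E. of_bool (insert a A \<subseteq> insert a E)) + (1 - p) * expect p A (\<lambda>E. of_bool (insert a A \<subseteq> E))"
      unfolding prob_def using insert by (simp add: expect_insert)
    also have "expect p A (\<lambda>E. of_bool (insert a A \<subseteq> insert a E)) = prob p A (\<lambda>E. A \<subseteq> E)"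
      unfolding prob_def by (rule expect_cong) (use insert in auto)
    also have "expect p A (\<lambda>E. of_bool (insert a A \<subseteq> E)) = expect p A (\<lambda>E. 0)"
      by (rule expect_cong) (use insert in auto)
    finally show ?case using insert by simp
  qed (simp add: prob_def)
  moreover have "prob p U (\<lambda>E. A \<subseteq> E \<inter> A) = prob p A (\<lambda>E. A \<subseteq> E)" by (rule prob_restrict[OF assms])
  ultimately show ?thesis by simp
qed

section \<open>Probabilities of triangles and of edges in no triangle\<close>

context
  fixes p :: real and n :: nat
  assumes p01: "0 \<le> p" "p \<le> 1"
begin

lemma triangle_prob:
  "prob p (pairs {1..n}) (\<lambda>E. triangles E \<noteq> {}) \<le> (n * p) ^ 3"
proof -
  let ?V = "{1..n}"
  let ?I = "{(a, b, c). a \<in> ?V \<and> b \<in> ?V \<and> c \<in> ?V \<and> a \<noteq> b \<and> b \<noteq> c \<and> a \<noteq> c}"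
  have sub: "?I \<subseteq> ?V \<times> ?V \<times> ?V" by auto
  have "prob p (pairs ?V) (\<lambda>E. triangles E \<noteq> {}) \<le> (real n) ^ 3 * p ^ 3"
  proof (rule prob_Bex_le[OF p01, where I = ?I and Q = "\<lambda>(a, b, c) E. {{a, b}, {b, c}, {a, c}} \<subseteq> E"])
    show "finite ?I" by (rule finite_subset[OF sub]) simp
    have "card ?I \<le> card (?V \<times> ?V \<times> ?V)" by (rule card_mono[OF _ sub]) simp
    then show "real (card ?I) \<le> (real n) ^ 3" by (simp add: card_cartesian_product power3_eq_cube flip: of_nat_mult)
    show "\<exists>i\<in>?I. (case i of (a, b, c) \<Rightarrow> \<lambda>E. {{a, b}, {b, c}, {a, c}} \<subseteq> E) E"
      if E: "E \<subseteq> pairs ?V" "triangles E \<noteq> {}" for E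
    proof -
      obtain a b c where abc: "{a, b} \<in> E" "{b, c} \<in> E" "{a, c} \<in> E" "a \<noteq> b" "b \<noteq> c" "a \<noteq> c"
        using E(2) by (auto simp: triangles_def)
      then have "{a, b} \<in> pairs ?V" "{b, c} \<in> pairs ?V" using E(1) by auto
      then have "(a, b, c) \<in> ?I" using abc by simp
      then show ?thesis using abc by (intro bexI[of _ "(a, b, c)"]) auto
    qed
    fix i assume "i \<in> ?I"
    then obtain a b c where i: "i = (a, b, c)" "a \<in> ?V" "b \<in> ?V" "c \<in> ?V" "a \<noteq> b" "b \<noteq> c" "a \<noteq> c" by auto
    have "card {{a, b}, {b, c}, {a, c}} = 3" using i by (auto simp: card_insert_if doubleton_eq_iff)
    moreover have "{{a, b}, {b, c}, {a, c}} \<subseteq> pairs ?V" using i by auto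
    ultimately show "prob p (pairs ?V) (case i of (a, b, c) \<Rightarrow> \<lambda>E. {{a, b}, {b, c}, {a, c}} \<subseteq> E) \<le> p ^ 3"
      using prob_superset[of "pairs ?V" "{{a, b}, {b, c}, {a, c}}" p] i by simp
  qed (use p01 in auto)
  then show ?thesis by (simp add: power_mult_distrib)
qed

lemma lonely_prob:
  assumes "a \<in> {1..n}" "b \<in> {1..n}" "a \<noteq> b"
  shows "prob p (pairs {1..n}) (\<lambda>E. lonely E {a, b}) = p * (1 - p\<^sup>2) ^ (n - 2)"
proof -
  let ?V = "{1..n}"
  \<comment> \<open>One independent block per possible common neighbour i; the index a, which cannot
    be one, carries the edge ab itself.\<close>
  let ?B = "\<lambda>i. if i = a then {{a, b}} else {{i, a}, {i, b}}"
  let ?P = "\<lambda>i E. if i = a then {a, b} \<in> E else \<not> ({i, a} \<in> E \<and> {i, b} \<in> E)"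
  have "prob p (pairs ?V) (\<lambda>E. lonely E {a, b}) = prob p (pairs ?V) (\<lambda>E. \<forall>i\<in>?V - {b}. ?P i (E \<inter> ?B i))"
  proof (rule prob_cong)
    fix E assume E: "E \<subseteq> pairs ?V"
    have ns: "{v} \<notin> E" for v using E by (metis singleton_notin_pairs subsetD)
    have out: "{w, v} \<notin> E" if "w \<notin> ?V" for v w using subsetD[OF E, of "{w, v}"] that by auto
    show "lonely E {a, b} \<longleftrightarrow> (\<forall>i\<in>?V - {b}. ?P i (E \<inter> ?B i))"
    proof
      assume "lonely E {a, b}"
      then show "\<forall>i\<in>?V - {b}. ?P i (E \<inter> ?B i)" by (auto simp: lonely_doubleton)
    next
      assume *: "\<forall>i\<in>?V - {b}. ?P i (E \<inter> ?B i)"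
      have "{a, b} \<in> E" using bspec[OF *, of a] assms by simp
      moreover have "\<not> ({w, a} \<in> E \<and> {w, b} \<in> E)" for w
      proof (cases "w \<in> ?V - {b} \<and> w \<noteq> a")
        case True
        then show ?thesis using bspec[OF *, of w] by simp
      next
        case False
        then show ?thesis using ns out by auto
      qed
      ultimately show "lonely E {a, b}" by (simp add: lonely_doubleton)
    qed
  qed
  also have "\<dots> = (\<Prod>i\<in>?V - {b}. prob p (?B i) (?P i))"
    by (rule prob_Ball_blocks) (use assms in \<open>auto simp: doubleton_eq_iff\<close>)
  also have "\<dots> = prob p (?B a) (?P a) * (\<Prod>i\<in>?V - {b} - {a}. prob p (?B i) (?P i))"
    using assms by (intro prod.remove) auto
  also have "prob p (?B a) (?P a) = p" by (simp add: prob_def expect_insert)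
  also have "(\<Prod>i\<in>?V - {b} - {a}. prob p (?B i) (?P i)) = (\<Prod>i\<in>?V - {b} - {a}. 1 - p\<^sup>2)"
  proof (rule prod.cong[OF refl])
    fix i assume "i \<in> ?V - {b} - {a}"
    then show "prob p (?B i) (?P i) = 1 - p\<^sup>2"
      using prob_not_both[of "{i, a}" "{i, b}" p] assms by (auto simp: doubleton_eq_iff)
  qed
  also have "\<dots> = (1 - p\<^sup>2) ^ (n - 2)" using assms by (simp add: card_Diff_subset numeral_2_eq_2)
  finally show ?thesis .
qed

text \<open>For an upper bound only the n - 4 vertices outside both edges are tested as common
  neighbours. Each has a block of four pairs and passes both tests with probability (1 -
  p^2)^2.\<close>

lemma lonely_prob_disjoint:
  assumes "{a, b, c, d} \<subseteq> {1..n}" "card {a, b, c, d} = 4"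
  shows "prob p (pairs {1..n}) (\<lambda>E. lonely E {a, b} \<and> lonely E {c, d}) \<le> p\<^sup>2 * (1 - p\<^sup>2) ^ (2 * (n - 4))"
proof -
  let ?V = "{1..n}"
  have ne: "a \<noteq> b" "a \<noteq> c" "a \<noteq> d" "b \<noteq> c" "b \<noteq> d" "c \<noteq> d" using assms(2) by (auto simp: card_insert_if split: if_splits)
  let ?B = "\<lambda>i. if i = a then {{a, b}, {c, d}} else {{i, a}, {i, b}, {i, c}, {i, d}}"
  let ?P = "\<lambda>i E. if i = a then {a, b} \<in> E \<and> {c, d} \<in> E
     else \<not> ({i, a} \<in> E \<and> {i, b} \<in> E) \<and> \<not> ({i, c} \<in> E \<and> {i, d} \<in> E)"
  have "prob p (pairs ?V) (\<lambda>E. lonely E {a, b} \<and> lonely E {c, d})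
     \<le> prob p (pairs ?V) (\<lambda>E. \<forall>i\<in>?V - {b, c, d}. ?P i (E \<inter> ?B i))"
    by (rule prob_mono[OF p01]) (auto simp: lonely_doubleton)
  also have "\<dots> = (\<Prod>i\<in>?V - {b, c, d}. prob p (?B i) (?P i))"
    by (rule prob_Ball_blocks) (use assms ne in \<open>auto simp: doubleton_eq_iff\<close>)
  also have "\<dots> = prob p (?B a) (?P a) * (\<Prod>i\<in>?V - {b, c, d} - {a}. prob p (?B i) (?P i))"
    using assms ne by (intro prod.remove) auto
  also have "prob p (?B a) (?P a) = p\<^sup>2"
    using ne by (simp add: prob_def expect_insert doubleton_eq_iff power2_eq_square)
  also have "(\<Prod>i\<in>?V - {b, c, d} - {a}. prob p (?B i) (?P i)) = (\<Prod>i\<in>?V - {b, c, d} - {a}. (1 - p\<^sup>2)\<^sup>2)"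
  proof (rule prod.cong[OF refl])
    fix i assume "i \<in> ?V - {b, c, d} - {a}"
    then have i: "i \<noteq> a" "i \<noteq> b" "i \<noteq> c" "i \<noteq> d" by auto
    have "prob p {{i, a}, {i, b}, {i, c}, {i, d}} (\<lambda>E. \<not> ({i, a} \<in> E \<and> {i, b} \<in> E) \<and> \<not> ({i, c} \<in> E \<and> {i, d} \<in> E))
       = (1 - p\<^sup>2)\<^sup>2"
      using ne i by (simp add: prob_def expect_insert doubleton_eq_iff power2_eq_square algebra_simps)
    then show "prob p (?B i) (?P i) = (1 - p\<^sup>2)\<^sup>2" using i by simp
  qed
  also have "\<dots> = (1 - p\<^sup>2) ^ (2 * (n - 4))"
  proof -
    have "?V - {b, c, d} - {a} = ?V - {a, b, c, d}" by auto
    then have "card (?V - {b, c, d} - {a}) = n - 4" using assms by (simp add: card_Diff_subset)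
    then show ?thesis by (simp add: power_mult)
  qed
  finally show ?thesis .
qed

text \<open>A vertex i is a common neighbour for neither edge if ia is absent, or if ia is present
  and both ib and ic are absent: 1 - p + p(1 - p)^2 = 1 - 2p^2 + p^3.\<close>

lemma lonely_prob_adjacent:
  assumes "{a, b, c} \<subseteq> {1..n}" "card {a, b, c} = 3"
  shows "prob p (pairs {1..n}) (\<lambda>E. lonely E {a, b} \<and> lonely E {a, c}) \<le> p\<^sup>2 * (1 - 2 * p\<^sup>2 + p ^ 3) ^ (n - 3)"
proof -
  let ?V = "{1..n}"
  have ne: "a \<noteq> b" "a \<noteq> c" "b \<noteq> c" using assms(2) by (auto simp: card_insert_if split: if_splits)
  let ?B = "\<lambda>i. if i = a then {{a, b}, {a, c}} else {{i, a}, {i, b}, {i, c}}"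
  let ?P = "\<lambda>i E. if i = a then {a, b} \<in> E \<and> {a, c} \<in> E
     else \<not> ({i, a} \<in> E \<and> {i, b} \<in> E) \<and> \<not> ({i, a} \<in> E \<and> {i, c} \<in> E)"
  have "prob p (pairs ?V) (\<lambda>E. lonely E {a, b} \<and> lonely E {a, c})
     \<le> prob p (pairs ?V) (\<lambda>E. \<forall>i\<in>?V - {b, c}. ?P i (E \<inter> ?B i))"
    by (rule prob_mono[OF p01]) (auto simp: lonely_doubleton)
  also have "\<dots> = (\<Prod>i\<in>?V - {b, c}. prob p (?B i) (?P i))"
    by (rule prob_Ball_blocks) (use assms ne in \<open>auto simp: doubleton_eq_iff\<close>)
  also have "\<dots> = prob p (?B a) (?P a) * (\<Prod>i\<in>?V - {b, c} - {a}. prob p (?B i) (?P i))"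
    using assms ne by (intro prod.remove) auto
  also have "prob p (?B a) (?P a) = p\<^sup>2"
    using ne by (simp add: prob_def expect_insert doubleton_eq_iff power2_eq_square)
  also have "(\<Prod>i\<in>?V - {b, c} - {a}. prob p (?B i) (?P i)) = (\<Prod>i\<in>?V - {b, c} - {a}. 1 - 2 * p\<^sup>2 + p ^ 3)"
  proof (rule prod.cong[OF refl])
    fix i assume "i \<in> ?V - {b, c} - {a}"
    then have i: "i \<noteq> a" "i \<noteq> b" "i \<noteq> c" by auto
    have "prob p {{i, a}, {i, b}, {i, c}} (\<lambda>E. \<not> ({i, a} \<in> E \<and> {i, b} \<in> E) \<and> \<not> ({i, a} \<in> E \<and> {i, c} \<in> E))
       = 1 - 2 * p\<^sup>2 + p ^ 3"
      using ne i by (simp add: prob_def expect_insert doubleton_eq_iff power2_eq_square power3_eq_cube algebra_simps)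
    then show "prob p (?B i) (?P i) = 1 - 2 * p\<^sup>2 + p ^ 3" using i by simp
  qed
  also have "\<dots> = (1 - 2 * p\<^sup>2 + p ^ 3) ^ (n - 3)"
  proof -
    have "?V - {b, c} - {a} = ?V - {a, b, c}" by auto
    then have "card (?V - {b, c} - {a}) = n - 3" using assms by (simp add: card_Diff_subset)
    then show ?thesis by simp
  qed
  finally show ?thesis .
qed

end

text \<open>Chebyshev's inequality for the number Z of edges in no triangle. The terms with a, s and
  t account for equal, adjacent and disjoint pairs; an edge has at most 2n adjacent pairs.\<close>

lemma no_lonely_second_moment:
  fixes p N a s t :: real and n :: nat
  assumes p01: "0 < p" "p < 1" and n: "n \<ge> 2"
  defines "N \<equiv> real (card (pairs {1..n}))" and "a \<equiv> p * (1 - p\<^sup>2) ^ (n - 2)"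
    and "s \<equiv> p\<^sup>2 * (1 - 2 * p\<^sup>2 + p ^ 3) ^ (n - 3)" and "t \<equiv> p\<^sup>2 * (1 - p\<^sup>2) ^ (2 * (n - 4))"
  shows "prob p (pairs {1..n}) (\<lambda>E. \<forall>e. \<not> lonely E e) \<le> N * (a + 2 * n * s + N * t) / (N * a)\<^sup>2 - 1"
proof -
  let ?V = "{1..n}" and ?U = "pairs {1..n}"
  have p: "0 \<le> p" "p \<le> 1" using p01 by auto
  have "{1, 2} \<in> ?U" using n by simp
  then have "?U \<noteq> {}" by blast
  then have "N > 0" unfolding N_def by (simp add: card_gt_0_iff)
  have p2: "0 < 1 - p\<^sup>2" using p01 by (simp add: power_less_one_iff)
  have "0 \<le> 1 - p + p * (1 - p)\<^sup>2" using p by simp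
  then have q0: "0 \<le> 1 - 2 * p\<^sup>2 + p ^ 3" by (simp add: power2_eq_square power3_eq_cube algebra_simps)
  have a0: "a > 0" and st0: "s \<ge> 0" "t \<ge> 0" unfolding a_def s_def t_def using p01 p2 q0 by auto
  define m where "m = N * a"
  have m0: "m > 0" unfolding m_def using a0 \<open>N > 0\<close> by simp
  define Z where "Z = (\<lambda>E. \<Sum>e\<in>?U. of_bool (lonely E e) :: real)"
  have EZ: "expect p ?U Z = m"
  proof -
    have "expect p ?U Z = (\<Sum>e\<in>?U. prob p ?U (\<lambda>E. lonely E e))" unfolding Z_def prob_def by (rule expect_sum)
    also have "\<dots> = (\<Sum>e\<in>?U. a)"
    proof (rule sum.cong[OF refl])
      fix e assume "e \<in> ?U"
      then show "prob p ?U (\<lambda>E. lonely E e) = a"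
        using lonely_prob[OF p] by (auto elim!: pairs_cases simp: a_def)
    qed
    finally show ?thesis by (simp add: m_def N_def)
  qed
  have EZ2: "expect p ?U (\<lambda>E. Z E * Z E) \<le> N * (a + 2 * n * s + N * t)"
  proof -
    have "expect p ?U (\<lambda>E. Z E * Z E) = (\<Sum>e\<in>?U. \<Sum>f\<in>?U. prob p ?U (\<lambda>E. lonely E e \<and> lonely E f))"
      unfolding Z_def prob_def sum_product expect_sum by (simp add: of_bool_conj)
    also have "\<dots> \<le> (\<Sum>e\<in>?U. a + 2 * n * s + N * t)"
    proof (rule sum_mono)
      fix e assume "e \<in> ?U"
      then obtain x y where e: "e = {x, y}" "x \<in> ?V" "y \<in> ?V" "x \<noteq> y" by (blast elim: pairs_cases)
      define A where "A = (\<lambda>w. {x, w}) ` ?V \<union> (\<lambda>w. {y, w}) ` ?V"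
      have "card A \<le> card ((\<lambda>w. {x, w}) ` ?V) + card ((\<lambda>w. {y, w}) ` ?V)" unfolding A_def by (rule card_Un_le)
      also have "\<dots> \<le> card ?V + card ?V" by (intro add_mono card_image_le) auto
      finally have cA: "card A \<le> 2 * n" by simp
      have finA: "finite A" unfolding A_def by simp
      have "(\<Sum>f\<in>?U. prob p ?U (\<lambda>E. lonely E e \<and> lonely E f))
        \<le> (\<Sum>f\<in>?U. (if f = e then a else 0) + (if f \<in> A then s else 0) + t)"
      proof (rule sum_mono)
        fix f assume "f \<in> ?U"
        then obtain c d where f: "f = {c, d}" "c \<in> ?V" "d \<in> ?V" "c \<noteq> d" by (blast elim: pairs_cases)
        let ?pr = "prob p ?U (\<lambda>E. lonely E e \<and> lonely E f)"
        have adj: "prob p ?U (\<lambda>E. lonely E {u, v} \<and> lonely E {u, w}) \<le> s"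
          if "u \<in> ?V" "v \<in> ?V" "w \<in> ?V" "u \<noteq> v" "u \<noteq> w" "v \<noteq> w" for u v w
          unfolding s_def by (rule lonely_prob_adjacent[OF p]) (use that in auto)
        consider "f = e" | "f \<noteq> e" "f \<inter> e \<noteq> {}" | "f \<inter> e = {}" by blast
        then show "?pr \<le> (if f = e then a else 0) + (if f \<in> A then s else 0) + t"
        proof cases
          case 1
          then have "?pr = a" using lonely_prob[OF p, of x n y] e by (simp add: a_def)
          then show ?thesis using 1 st0 by simp
        next
          case 2
          consider "c = x" | "d = x" | "c = y" | "d = y" using 2 e f by auto
          then have "?pr \<le> s \<and> f \<in> A"
          proof cases
            case 1
            then have "d \<noteq> y" using 2 e f by auto
            then show ?thesis using adj[of x y d] 1 e f by (auto simp: A_def)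
          next
            case c2: 2
            then have "c \<noteq> y" using 2 e f by (auto simp: insert_commute)
            then show ?thesis using adj[of x y c] c2 e f by (auto simp: A_def insert_commute)
          next
            case 3
            then have "d \<noteq> x" using 2 e f by (auto simp: insert_commute)
            then show ?thesis using adj[of y x d] 3 e f by (auto simp: A_def insert_commute)
          next
            case 4
            then have "c \<noteq> x" using 2 e f by auto
            then show ?thesis using adj[of y x c] 4 e f by (auto simp: A_def insert_commute)
          qed
          then show ?thesis using st0 a0 by auto
        next
          case 3
          then have "?pr \<le> t" unfolding t_def e(1) f(1)
            by (intro lonely_prob_disjoint[OF p]) (use e f in auto)
          then show ?thesis using st0 a0 by auto
        qed
      qed
      also have "\<dots> = a + card (?U \<inter> A) * s + N * t"
        using \<open>e \<in> ?U\<close> by (simp add: sum.distrib sum.If_cases N_def)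
      also have "card (?U \<inter> A) * s \<le> 2 * n * s"
      proof (rule mult_right_mono)
        have "card (?U \<inter> A) \<le> card A" using finA by (intro card_mono) auto
        then show "real (card (?U \<inter> A)) \<le> real (2 * n)" using cA by linarith
      qed (use st0 in auto)
      finally show "(\<Sum>f\<in>?U. prob p ?U (\<lambda>E. lonely E e \<and> lonely E f)) \<le> a + 2 * n * s + N * t" by simp
    qed
    finally show ?thesis by (simp add: N_def)
  qed
  \<comment> \<open>If Z = 0 then (Z/m - 1)^2 = 1, so the mean of this square bounds the
    probability; with E Z = m it is E Z^2 / m^2 - 1.\<close>
  have "prob p ?U (\<lambda>E. \<forall>e. \<not> lonely E e) \<le> expect p ?U (\<lambda>E. 1 / m\<^sup>2 * (Z E * Z E) + (- 2 / m) * Z E + 1)"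
  proof (rule prob_markov[OF p])
    fix E
    have "0 \<le> (Z E / m - 1)\<^sup>2" by simp
    also have "\<dots> = 1 / m\<^sup>2 * (Z E * Z E) + (- 2 / m) * Z E + 1"
      using m0 by (simp add: power2_eq_square field_simps)
    finally show "0 \<le> 1 / m\<^sup>2 * (Z E * Z E) + (- 2 / m) * Z E + 1" .
    assume "\<forall>e. \<not> lonely E e"
    then have "Z E = 0" unfolding Z_def by (intro sum.neutral) auto
    then show "1 \<le> 1 / m\<^sup>2 * (Z E * Z E) + (- 2 / m) * Z E + 1" by simp
  qed
  also have "\<dots> = 1 / m\<^sup>2 * expect p ?U (\<lambda>E. Z E * Z E) + (- 2 / m) * m + 1"
    by (simp only: expect_add expect_cmult EZ expect_const finite_pairs finite_atLeastAtMost)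
  also have "\<dots> \<le> 1 / m\<^sup>2 * (N * (a + 2 * n * s + N * t)) + (- 2 / m) * m + 1"
    using EZ2 m0 by (intro add_right_mono mult_left_mono) auto
  also have "\<dots> = N * (a + 2 * n * s + N * t) / m\<^sup>2 - 1" using m0 by simp
  finally show ?thesis unfolding m_def .
qed

text \<open>The summands stem from equal, adjacent and disjoint pairs. By np^3 \<le> 1 adjacency
  raises the joint probability only by a constant factor over independence, and adjacent pairs are
  rarer than all pairs by a factor of order n.\<close>

lemma no_lonely_prob:
  fixes p :: real and n :: nat
  assumes p: "0 < p" "p\<^sup>2 \<le> 1/8" "n * p ^ 3 \<le> 1" and n: "n \<ge> 4"
  shows "prob p (pairs {1..n}) (\<lambda>E. \<forall>e. \<not> lonely E e)
    \<le> 1 / ((real n)\<^sup>2 / 4 * (p * (1 - p\<^sup>2) ^ n)) + 32 * exp 4 / n + 8 * p\<^sup>2"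
proof -
  define D where "D = 1 - p\<^sup>2"
  define N where "N = real (card (pairs {1..n}))"
  define a where "a = p * D ^ (n - 2)"
  define q where "q = 1 - 2 * p\<^sup>2 + p ^ 3"
  have "p < 1"
  proof (rule ccontr)
    assume "\<not> p < 1"
    then have "1 \<le> p\<^sup>2" using one_le_power[of p 2] by simp
    then show False using p by simp
  qed
  have D: "7/8 \<le> D" "D \<le> 1" using p by (auto simp: D_def)
  have "2 * N = n * (real n - 1)" unfolding N_def using card_pairs[of "{1..n}"] by simp
  moreover have "n * (real n / 2) \<le> n * (real n - 1)" using n by (intro mult_left_mono) auto
  ultimately have N: "(real n)\<^sup>2 / 4 \<le> N" by (simp add: power2_eq_square)
  have n0: "0 < (real n)\<^sup>2 / 4" using n by simp
  have N0: "N > 0" using N n0 by linarith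
  have a0: "a > 0" using p D by (simp add: a_def)
  have "prob p (pairs {1..n}) (\<lambda>E. \<forall>e. \<not> lonely E e)
     \<le> N * (a + 2 * n * (p\<^sup>2 * q ^ (n - 3)) + N * (p\<^sup>2 * D ^ (2 * (n - 4)))) / (N * a)\<^sup>2 - 1"
    unfolding N_def a_def D_def q_def by (rule no_lonely_second_moment) (use p \<open>p < 1\<close> n in auto)
  also have "\<dots> = 1 / (N * a) + (2 * n / N) * (p\<^sup>2 * q ^ (n - 3) / a\<^sup>2) + (p\<^sup>2 * D ^ (2 * (n - 4)) / a\<^sup>2 - 1)"
    using N0 a0 by (simp add: power2_eq_square field_simps)
  also have "\<dots> \<le> 1 / ((real n)\<^sup>2 / 4 * (p * D ^ n)) + (8 / n) * (4 * exp 4) + 8 * p\<^sup>2"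
  proof (intro add_mono)
    have "D ^ n \<le> D ^ (n - 2)" using D by (intro power_decreasing) auto
    then have "p * D ^ n \<le> a" unfolding a_def using p by simp
    then have "(real n)\<^sup>2 / 4 * (p * D ^ n) \<le> N * a" using N N0 p D by (intro mult_mono) auto
    moreover have "0 < (real n)\<^sup>2 / 4 * (p * D ^ n)" using n0 p D by simp
    ultimately show "1 / (N * a) \<le> 1 / ((real n)\<^sup>2 / 4 * (p * D ^ n))" by (intro divide_left_mono) (use N0 a0 in auto)
    have a2: "a\<^sup>2 = p\<^sup>2 * D ^ (2 * (n - 2))" unfolding a_def by (simp add: power_mult_distrib power_mult[symmetric] mult.commute)
    have q0: "0 \<le> q" using p by (simp add: q_def)
    have D2: "1 / 4 \<le> D\<^sup>2" using power_mono[OF D(1), of 2] by (simp add: power2_eq_square)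
    \<comment> \<open>The relative excess of q over D^2 is at most 4p^3; over n - 3 vertices it
      accumulates to at most exp 4.\<close>
    have "q = D\<^sup>2 - (p\<^sup>2)\<^sup>2 + p ^ 3" unfolding q_def D_def by (simp add: power2_eq_square algebra_simps)
    also have "\<dots> \<le> D\<^sup>2 + p ^ 3" by simp
    also have "\<dots> \<le> D\<^sup>2 * (1 + 4 * p ^ 3)" using mult_right_mono[OF D2, of "4 * p ^ 3"] p by (simp add: algebra_simps)
    also have "\<dots> \<le> D\<^sup>2 * exp (4 * p ^ 3)" by (intro mult_left_mono) auto
    finally have "q ^ (n - 3) \<le> (D\<^sup>2 * exp (4 * p ^ 3)) ^ (n - 3)" using q0 by (rule power_mono)
    also have "\<dots> = D ^ (2 * (n - 3)) * exp ((n - 3) * (4 * p ^ 3))"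
      unfolding power_mult_distrib exp_of_nat_mult[symmetric] by (simp add: power_mult)
    also have "\<dots> \<le> D ^ (2 * (n - 3)) * exp 4"
    proof -
      have "real (n - 3) * (4 * p ^ 3) \<le> n * (4 * p ^ 3)" using p by (intro mult_right_mono) auto
      also have "\<dots> \<le> 4" using p by simp
      finally show ?thesis using D by (intro mult_left_mono) auto
    qed
    finally have q1: "q ^ (n - 3) \<le> D ^ (2 * (n - 3)) * exp 4" .
    have "D ^ (2 * (n - 3)) = D ^ (2 * (n - 3)) * 1" by simp
    also have "\<dots> \<le> D ^ (2 * (n - 3)) * (4 * D\<^sup>2)" using D2 D by (intro mult_left_mono) auto
    also have "\<dots> = 4 * D ^ (2 * (n - 2))"
    proof -
      have "2 * (n - 2) = 2 * (n - 3) + 2" using n by simp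
      then show ?thesis by (simp add: power_add power2_eq_square)
    qed
    finally have "D ^ (2 * (n - 3)) * exp 4 \<le> 4 * D ^ (2 * (n - 2)) * exp 4" by (rule mult_right_mono) simp
    then have "q ^ (n - 3) \<le> 4 * D ^ (2 * (n - 2)) * exp 4" using q1 by linarith
    then have "p\<^sup>2 * q ^ (n - 3) \<le> p\<^sup>2 * (4 * D ^ (2 * (n - 2)) * exp 4)" by (rule mult_left_mono) simp
    then have "p\<^sup>2 * q ^ (n - 3) \<le> 4 * exp 4 * a\<^sup>2" unfolding a2 by (simp add: mult_ac)
    then have "p\<^sup>2 * q ^ (n - 3) / a\<^sup>2 \<le> 4 * exp 4" using a0 by (simp add: divide_le_eq)
    moreover have "2 * n / N \<le> 8 / n"
    proof -
      have "2 * n / N \<le> 2 * n / ((real n)\<^sup>2 / 4)" using N n0 N0 by (intro divide_left_mono) auto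
      also have "\<dots> = 8 / n" using n by (simp add: power2_eq_square field_simps)
      finally show ?thesis .
    qed
    ultimately show "(2 * n / N) * (p\<^sup>2 * q ^ (n - 3) / a\<^sup>2) \<le> (8 / n) * (4 * exp 4)"
      using N0 q0 a0 p by (intro mult_mono) auto
    have "2 * (n - 2) = 2 * (n - 4) + 4" using n by simp
    then have "p\<^sup>2 * D ^ (2 * (n - 4)) / a\<^sup>2 = 1 / D ^ 4"
      unfolding a2 using p D by (simp add: power_add)
    \<comment> \<open>Bernoulli gives D^4 \<ge> 1 - 4p^2, and (1 - 4p^2)(1 + 8p^2) \<ge> 1 holds
      because p^2 \<le> 1/8.\<close>
    also have "\<dots> \<le> 1 + 8 * p\<^sup>2"
    proof -
      have "1 - 4 * p\<^sup>2 \<le> D ^ 4"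
        using Bernoulli_inequality[of "- p\<^sup>2" 4] p by (simp add: D_def)
      moreover have "1 \<le> (1 - 4 * p\<^sup>2) * (1 + 8 * p\<^sup>2)"
      proof -
        have "32 * p\<^sup>2 * p\<^sup>2 \<le> 32 * p\<^sup>2 * (1/8)" using p by (intro mult_left_mono) auto
        then show ?thesis by (simp add: algebra_simps)
      qed
      ultimately have "1 \<le> D ^ 4 * (1 + 8 * p\<^sup>2)"
        by (meson mult_right_mono order_trans add_nonneg_nonneg mult_nonneg_nonneg zero_le_power2 zero_le_one zero_le_numeral)
      then show ?thesis using D by (simp add: divide_le_eq mult.commute)
    qed
    finally show "p\<^sup>2 * D ^ (2 * (n - 4)) / a\<^sup>2 - 1 \<le> 8 * p\<^sup>2" by simp
  qed
  finally show ?thesis by (simp add: D_def)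
qed

lemma subcritical_whp:
  fixes \<delta> :: real
  assumes \<delta>: "\<delta> > 0"
  shows "\<forall>\<^sub>F n in sequentially. \<forall>p::real. 0 \<le> p \<longrightarrow> p \<le> 1 \<longrightarrow> n * p\<^sup>2 \<le> 5/4 * ln n \<longrightarrow>
     prob p (pairs {1..n}) (\<lambda>E. every_edge_in_triangle E \<and> triangles E \<noteq> {}) \<le> \<delta>"
proof -
  define B where "B = (\<lambda>n::nat. 4 * exp 2 * n powr (-3/4) + 4 * exp 1 * n powr (-1/4) + 32 * exp 4 / n + 8 * (5/4 * ln n / n))"
  have "B \<longlonglongrightarrow> 0" unfolding B_def by real_asymp
  then have "\<forall>\<^sub>F n in sequentially. B n < \<delta>" using \<delta> by (rule order_tendstoD)
  moreover have "\<forall>\<^sub>F n::nat in sequentially. 5/4 * ln n / n \<le> 1/8" by real_asymp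
  moreover have "\<forall>\<^sub>F n::nat in sequentially. (5/4 * ln n) ^ 3 / n \<le> 1" by real_asymp
  moreover have "\<forall>\<^sub>F n::nat in sequentially. (5/4 * ln n) ^ 2 / n \<le> 1/2" by real_asymp
  moreover have "\<forall>\<^sub>F n::nat in sequentially. n \<ge> 4" by (rule eventually_ge_at_top)
  ultimately show ?thesis
  proof eventually_elim
    case (elim n)
    show ?case
    proof (intro allI impI)
      fix p :: real assume p: "0 \<le> p" "p \<le> 1" and x: "n * p\<^sup>2 \<le> 5/4 * ln n"
      let ?P = "prob p (pairs {1..n}) (\<lambda>E. every_edge_in_triangle E \<and> triangles E \<noteq> {})"
      have n: "real n > 0" "n \<ge> 4" using elim by auto
      have B3: "0 \<le> 4 * exp 2 * n powr (-3/4)" "0 \<le> 4 * exp 1 * n powr (-1/4)" "0 \<le> 32 * exp 4 / n"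
          "0 \<le> 8 * (5/4 * ln n / n)" using n by auto
      have "?P \<le> B n"
      \<comment> \<open>An exponent between -2 and -1: below the cut-off (np)^3 tends to 0, so
        triangles are unlikely; above it n^2 p tends to infinity, so edges in no triangle are
        abundant while np^2 is bounded.\<close>
      proof (cases "p \<le> n powr (-5/4)")
        case True
        have "?P \<le> prob p (pairs {1..n}) (\<lambda>E. triangles E \<noteq> {})" by (rule prob_mono[OF p]) blast
        also have "\<dots> \<le> (n * p) ^ 3" by (rule triangle_prob[OF p])
        also have "\<dots> \<le> (n * n powr (-5/4)) ^ 3" using True p by (intro power_mono mult_left_mono) auto
        also have "n * n powr (-5/4) = n powr (-1/4)" using n powr_mult_base[of "real n" "-5/4"] by simp
        also have "(n powr (-1/4)) ^ 3 = n powr (-3/4)" by (simp add: power3_eq_cube flip: powr_add)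
        also have "\<dots> \<le> 4 * exp 2 * n powr (-3/4)"
        proof -
          have "1 \<le> 4 * exp (2::real)" using exp_ge_add_one_self[of 2] by simp
          then show ?thesis using mult_right_mono[of 1 "4 * exp 2" "n powr (-3/4)"] by simp
        qed
        finally show ?thesis unfolding B_def using B3 by linarith
      next
        case False
        then have p54: "n powr (-5/4) \<le> p" by simp
        have "0 < n powr (-5/4)" using n by simp
        then have p0: "p > 0" using p54 by linarith
        have y: "p\<^sup>2 \<le> 5/4 * ln n / n" using x n by (simp add: field_simps)
        then have y8: "p\<^sup>2 \<le> 1/8" using elim by linarith
        have x0: "0 \<le> n * p\<^sup>2" using p by simp
        have p3: "n * p ^ 3 \<le> 1"
        proof -
          have "(n * p\<^sup>2) ^ 3 \<le> (5/4 * ln n) ^ 3" using x x0 by (rule power_mono)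
          then have "(n * p\<^sup>2) ^ 3 / n \<le> (5/4 * ln n) ^ 3 / n" using n by (intro divide_right_mono) auto
          then have "(n * p\<^sup>2) ^ 3 / n \<le> 1" using elim by linarith
          moreover have "(n * p\<^sup>2) ^ 3 / n = (n * p ^ 3)\<^sup>2" using n by (simp add: power2_eq_square power3_eq_cube field_simps)
          ultimately show ?thesis using p by (simp add: abs_square_le_1[of "n * p ^ 3"])
        qed
        have "?P \<le> prob p (pairs {1..n}) (\<lambda>E. \<forall>e. \<not> lonely E e)" by (rule prob_mono[OF p]) (use not_lonely in blast)
        also have "\<dots> \<le> 1 / ((real n)\<^sup>2 / 4 * (p * (1 - p\<^sup>2) ^ n)) + 32 * exp 4 / n + 8 * p\<^sup>2"
          by (rule no_lonely_prob[OF p0 y8 p3 n(2)])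
        also have "1 / ((real n)\<^sup>2 / 4 * (p * (1 - p\<^sup>2) ^ n)) \<le> 4 * exp 2 * n powr (-3/4) + 4 * exp 1 * n powr (-1/4)"
        proof -
          have Dn: "exp (- (n * p\<^sup>2) - 1) \<le> (1 - p\<^sup>2) ^ n"
          proof -
            have "- p\<^sup>2 - 2 * (p\<^sup>2)\<^sup>2 \<le> ln (1 - p\<^sup>2)" by (rule ln_one_minus_pos_lower_bound) (use y8 in auto)
            then have "n * (- p\<^sup>2 - 2 * (p\<^sup>2)\<^sup>2) \<le> n * ln (1 - p\<^sup>2)" by (rule mult_left_mono) simp
            moreover have "n * (2 * (p\<^sup>2)\<^sup>2) \<le> 1"
            proof -
              have "(n * p\<^sup>2)\<^sup>2 \<le> (5/4 * ln n)\<^sup>2" using x x0 by (rule power_mono)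
              then have "(n * p\<^sup>2)\<^sup>2 / n \<le> (5/4 * ln n)\<^sup>2 / n" using n by (intro divide_right_mono) auto
              then have "(n * p\<^sup>2)\<^sup>2 / n \<le> 1/2" using elim by linarith
              moreover have "(n * p\<^sup>2)\<^sup>2 / n = n * (p\<^sup>2)\<^sup>2" using n by (simp add: power2_eq_square)
              ultimately show ?thesis by simp
            qed
            ultimately have "- (n * p\<^sup>2) - 1 \<le> n * ln (1 - p\<^sup>2)" by (simp add: algebra_simps)
            then have "exp (- (n * p\<^sup>2) - 1) \<le> exp (n * ln (1 - p\<^sup>2))" by simp
            also have "\<dots> = (1 - p\<^sup>2) ^ n" unfolding exp_of_nat_mult using y8 by simp
            finally show ?thesis .
          qed
          have n2: "(real n)\<^sup>2 = n powr 2" using n by simp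
          have m0: "0 < (1 - p\<^sup>2) ^ n" using y8 by (intro zero_less_power) simp
          show ?thesis
          \<comment> \<open>The mean has order at least n^2 p exp(-np^2). If np^2 \<le> 1, the
            cut-off for p gives n^(3/4); otherwise p \<ge> n^(-1/2) and exp(-np^2) \<ge> n^(-5/4)
            give n^(2 - 1/2 - 5/4) = n^(1/4). Here 5/4 has to be smaller than 3/2.\<close>
          proof (cases "n * p\<^sup>2 \<le> 1")
            case True
            have "n powr (-5/4) * exp (- 2) \<le> p * (1 - p\<^sup>2) ^ n"
            proof (rule mult_mono)
              show "exp (- 2) \<le> (1 - p\<^sup>2) ^ n" by (rule order_trans[OF _ Dn]) (use True in auto)
            qed (use p p54 in auto)
            then have "(real n)\<^sup>2 / 4 * (n powr (-5/4) * exp (- 2)) \<le> (real n)\<^sup>2 / 4 * (p * (1 - p\<^sup>2) ^ n)"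
              by (intro mult_left_mono) auto
            moreover have "(real n)\<^sup>2 / 4 * (n powr (-5/4) * exp (- 2)) = n powr (3/4) * exp (- 2) / 4"
            proof -
              have k: "(real n)\<^sup>2 * n powr (-5/4) = n powr (3/4)" unfolding n2 powr_add[symmetric] by simp
              show ?thesis unfolding k[symmetric] by simp
            qed
            ultimately have "n powr (3/4) * exp (- 2) / 4 \<le> (real n)\<^sup>2 / 4 * (p * (1 - p\<^sup>2) ^ n)" by linarith
            then have "1 / ((real n)\<^sup>2 / 4 * (p * (1 - p\<^sup>2) ^ n)) \<le> 1 / (n powr (3/4) * exp (- 2) / 4)"
              using m0 p0 n by (intro divide_left_mono mult_pos_pos) auto
            also have "\<dots> = 4 * exp 2 * n powr (-3/4)" by (simp add: exp_minus powr_minus field_simps)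
            finally show ?thesis using B3 by linarith
          next
            case False
            have "n powr (-1/2) \<le> p"
            proof (rule power2_le_imp_le)
              have "(n powr (-1/2))\<^sup>2 = 1 / n" using n by (simp add: power2_eq_square powr_minus_divide flip: powr_add)
              also have "\<dots> \<le> p\<^sup>2" using False n by (simp add: field_simps)
              finally show "(n powr (-1/2))\<^sup>2 \<le> p\<^sup>2" .
            qed (use p in auto)
            moreover have "exp (- (5/4 * ln n) - 1) \<le> (1 - p\<^sup>2) ^ n"
              by (rule order_trans[OF _ Dn]) (use x in auto)
            moreover have "exp (- (5/4 * ln n) - 1) = n powr (-5/4) * exp (- 1)"
              using n by (simp add: powr_def flip: exp_add)
            ultimately have "n powr (-1/2) * (n powr (-5/4) * exp (- 1)) \<le> p * (1 - p\<^sup>2) ^ n"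
              using p by (intro mult_mono) auto
            then have "(real n)\<^sup>2 / 4 * (n powr (-1/2) * (n powr (-5/4) * exp (- 1))) \<le> (real n)\<^sup>2 / 4 * (p * (1 - p\<^sup>2) ^ n)"
              by (intro mult_left_mono) auto
            moreover have "(real n)\<^sup>2 / 4 * (n powr (-1/2) * (n powr (-5/4) * exp (- 1))) = n powr (1/4) * exp (- 1) / 4"
            proof -
              have k: "(real n)\<^sup>2 * (n powr (-1/2) * n powr (-5/4)) = n powr (1/4)"
                unfolding n2 powr_add[symmetric] by simp
              show ?thesis unfolding k[symmetric] by simp
            qed
            ultimately have "n powr (1/4) * exp (- 1) / 4 \<le> (real n)\<^sup>2 / 4 * (p * (1 - p\<^sup>2) ^ n)" by linarith
            then have "1 / ((real n)\<^sup>2 / 4 * (p * (1 - p\<^sup>2) ^ n)) \<le> 1 / (n powr (1/4) * exp (- 1) / 4)"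
              using m0 p0 n by (intro divide_left_mono mult_pos_pos) auto
            also have "\<dots> = 4 * exp 1 * n powr (-1/4)" by (simp add: exp_minus powr_minus field_simps)
            finally show ?thesis using B3 by linarith
          qed
        qed
        finally show ?thesis unfolding B_def using y by linarith
      qed
      then show "?P \<le> \<delta>" using elim by linarith
    qed
  qed
qed

section \<open>Conclusion\<close>

text \<open>The cut of {v} is the star of v. Adding it to F exchanges the F-edges at v for the other
  edges at v, which by minimality are not fewer.\<close>

lemma witness_degree_le_half:
  assumes w: "witness E F" and E: "E \<subseteq> pairs V" and V: "finite V"
  shows "2 * card (nbr F v) \<le> card (nbr E v)"
proof -
  let ?g = "\<lambda>w. {v, w}"
  have F: "F \<subseteq> E" and min: "card F \<le> card (sym_diff F (cut E {v}))" using w by (auto simp: witness_def)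
  have finE: "finite E" using E V finite_pairs finite_subset by blast
  then have fin: "finite F" "finite (cut E {v})" using F by (auto simp: cut_def intro: finite_subset)
  have inj: "inj ?g" by (auto simp: inj_def doubleton_eq_iff)
  have cut: "cut E {v} = ?g ` nbr E v"
  proof (intro equalityI subsetI)
    fix e assume "e \<in> cut E {v}"
    then have e: "e \<in> E" "odd (card (e \<inter> {v}))" by (auto simp: cut_def)
    then have "v \<in> e" by (cases "v \<in> e") auto
    moreover obtain x y where "e = {x, y}" using e(1) E by (blast elim: pairs_cases)
    ultimately show "e \<in> ?g ` nbr E v" using e(1) by (auto simp: nbr_iff insert_commute image_iff)
  qed (auto simp: cut_def nbr_iff)
  have c1: "card (cut E {v}) = card (nbr E v)" unfolding cut using inj by (simp add: card_image inj_on_subset)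
  have "F \<inter> cut E {v} = ?g ` nbr F v" unfolding cut using F by (auto simp: nbr_iff)
  then have c2: "card (F \<inter> cut E {v}) = card (nbr F v)" using inj by (simp add: card_image inj_on_subset)
  have "card (sym_diff F (cut E {v})) = card (F - cut E {v}) + card (cut E {v} - F)"
    unfolding sym_diff_def using fin by (intro card_Un_disjoint) auto
  moreover have "card (F - cut E {v}) + card (F \<inter> cut E {v}) = card F"
    using card_Int_Diff[OF fin(1), of "cut E {v}"] by simp
  moreover have "card (cut E {v} - F) + card (F \<inter> cut E {v}) = card (cut E {v})"
    using card_Int_Diff[OF fin(2), of F] by (simp add: Int_commute)
  ultimately show ?thesis using min c1 c2 by linarith
qed

text \<open>The threshold is that of \<open>no_small_witness\<close> with m = \<eta> n and d = np: a
  smaller F has at most \<eta> n vertices of F-degree above c np.\<close>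

lemma typical_no_small_witness:
  fixes n :: nat and p c c' \<epsilon> \<eta> :: real
  assumes E: "E \<subseteq> pairs {1..n}" and ty: "typical n p c c' \<epsilon> \<eta> E" and w: "witness E F"
    and tri: "every_edge_in_triangle E" and pos: "0 < p" "n \<ge> 1" "c > 0" "c' > 0" "\<epsilon> > 0"
    and cc: "100 * c' \<le> c" "\<epsilon> \<le> 1/20000"
  shows "\<eta> * c / 2 * ((real n)\<^sup>2 * p) < card F"
proof (rule ccontr)
  assume "\<not> \<eta> * c / 2 * ((real n)\<^sup>2 * p) < card F"
  then have small: "2 * real (card F) \<le> \<eta> * n * (c * (n * p))" by (simp add: power2_eq_square mult_ac)
  let ?V = "{1..n}" and ?L = "n * p\<^sup>2"
  have L: "?L > 0" "n * p > 0" using pos by auto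
  show False
  proof (rule no_small_witness[where V = ?V and E = E and F = F and L = ?L and d = "n * p" and c = c and c' = c'
        and \<epsilon> = \<epsilon> and \<gamma> = "1/200" and m = "\<eta> * n"])
    show "2 * card (nbr F v) \<le> card (nbr E v)" for v by (rule witness_degree_le_half[OF w E]) simp
    show "\<exists>z. {x, z} \<in> E \<and> {y, z} \<in> E" if "{x, y} \<in> E" for x y
      using not_lonely[OF tri, of "{x, y}"] that by (auto simp: lonely_doubleton insert_commute)
    have P2: "2 * real (card (E \<inter> pairs D)) \<le> \<epsilon> * ?L * card D" if "D \<subseteq> ?V" "card D \<le> c * (n * p)" for D
      using ty that unfolding typical_def by blast
    then show "2 * real (card (E \<inter> pairs D)) \<le> \<epsilon> * ?L * card D" if "D \<subseteq> ?V" "card D \<le> c * (n * p)" for D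
      using that by blast
    show "2 * real (card (E \<inter> pairs D)) \<le> 0.8 * ?L * card D"
      if "v \<in> ?V" "D \<subseteq> nbr E v" "2 * card D \<le> card (nbr E v)" for v D
    \<comment> \<open>The half-neighbourhood property of typical graphs speaks only of sets larger
      than c np; smaller ones satisfy the much stronger sparsity bound \<open>P2\<close>.\<close>
    proof (cases "c * (n * p) < card D")
      case True
      then show ?thesis using ty that unfolding typical_def by blast
    next
      case False
      have "D \<subseteq> ?V" using that nbr_subset[OF E] by blast
      then have "2 * real (card (E \<inter> pairs D)) \<le> \<epsilon> * ?L * card D" using P2 False by simp
      also have "\<dots> \<le> 0.8 * ?L * card D" using cc L by (intro mult_right_mono) auto
      finally show ?thesis .
    qed
    show "real (card (E \<inter> pairs A)) \<le> c' * (n * p) * card A" if "A \<subseteq> ?V" "card A \<le> \<eta> * n" for A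
      using ty that unfolding typical_def by blast
    show "real (card {w \<in> nbr E v. codeg E v w < 0.9 * ?L}) \<le> c' * (n * p)" if "v \<in> ?V" for v
      using ty that unfolding typical_def by blast
    show "w = w'" if "v \<in> ?V" "w \<in> nbr E v" "w' \<in> nbr E v" "codeg E v w < 1/200 * ?L" "codeg E v w' < 1/200 * ?L" for v w w'
      using ty that unfolding typical_def by blast
  qed (use w E small L pos cc in \<open>auto simp: witness_def\<close>)
qed

lemma supercritical_whp:
  fixes \<delta> :: real
  assumes \<delta>: "\<delta> > 0"
  shows "\<forall>\<^sub>F n in sequentially. \<forall>p::real. 0 \<le> p \<longrightarrow> p \<le> 1 \<longrightarrow> n * p\<^sup>2 \<ge> 5/4 * ln n \<longrightarrow>
     prob p (pairs {1..n}) (\<lambda>E. every_edge_in_triangle E \<and> triangle_space E \<noteq> cycle_space E) \<le> \<delta>"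
proof -
  \<comment> \<open>The order of choice matters: \<epsilon> is a hundredth of the poor threshold
    1/200, c is determined by \<epsilon>, c' is small against c, and \<eta> is determined by c'. At
    size \<eta> c / 2 times n^2 p the deterministic argument hands over to
    \<open>large_witness_whp\<close>.\<close>
  define \<epsilon> c c' \<eta> :: real where "\<epsilon> = 1/20000" and "c = exp (- 6 / \<epsilon>)" and "c' = c / 100 * (1/2)" and "\<eta> = exp (- 3 / c')"
  have pos: "\<epsilon> > 0" "c > 0" "c' > 0" "\<eta> > 0" by (auto simp: \<epsilon>_def c_def c'_def \<eta>_def)
  have c1: "c \<le> 1" unfolding c_def using pos by simp
  have \<eta>1: "\<eta> \<le> 1" unfolding \<eta>_def using pos by simp
  have c'1: "c' \<le> 1/200" "100 * c' \<le> c" using c1 pos by (auto simp: c'_def)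
  have "\<eta> * c \<le> 1 * 1" using c1 \<eta>1 pos by (intro mult_mono) auto
  then have e0: "0 < \<eta> * c / 2" "\<eta> * c / 2 \<le> 1" using pos by auto
  have d2: "\<delta> / 2 > 0" using \<delta> by simp
  have "\<forall>\<^sub>F n::nat in sequentially. 5/4 * ln n > 0" by real_asymp
  moreover have "\<forall>\<^sub>F n::nat in sequentially. n \<ge> 1" by (rule eventually_ge_at_top)
  ultimately show ?thesis
    using typical_whp[OF c_def pos(1,3) c'1(1) \<eta>_def d2] large_witness_whp[OF e0 d2]
  proof eventually_elim
    case (elim n)
    show ?case
    proof (intro allI impI)
      fix p :: real assume p: "0 \<le> p" "p \<le> 1" and x: "n * p\<^sup>2 \<ge> 5/4 * ln n"
      have "n * p\<^sup>2 > 0" using x elim(1) by linarith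
      then have p0: "p > 0" using p by (cases "p = 0") auto
      let ?T = "\<lambda>E. \<not> typical n p c c' \<epsilon> \<eta> E"
      let ?W = "\<lambda>E. (\<forall>v\<in>{1..n}. real (card (nbr E v)) \<le> 101/100 * (n * p)) \<and>
          (\<exists>F. witness E F \<and> \<eta> * c / 2 * ((real n)\<^sup>2 * p) < real (card F))"
      have "prob p (pairs {1..n}) (\<lambda>E. every_edge_in_triangle E \<and> triangle_space E \<noteq> cycle_space E)
        \<le> prob p (pairs {1..n}) ?T + prob p (pairs {1..n}) ?W"
      proof (rule prob_disj[OF p])
        fix E assume E: "E \<subseteq> pairs {1..n}" and Q: "every_edge_in_triangle E \<and> triangle_space E \<noteq> cycle_space E"
        show "?T E \<or> ?W E"
        proof (cases "typical n p c c' \<epsilon> \<eta> E")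
          case True
          obtain F where F: "witness E F"
            using exists_witness[of E n] E Q by (auto simp: all_edges_eq_pairs)
          have "\<eta> * c / 2 * ((real n)\<^sup>2 * p) < card F"
            by (rule typical_no_small_witness[OF E True F]) (use Q p0 elim pos c'1 in \<open>auto simp: \<epsilon>_def\<close>)
          moreover have "\<forall>v\<in>{1..n}. real (card (nbr E v)) \<le> 101/100 * (n * p)"
            using True unfolding typical_def by blast
          ultimately show ?thesis using F by blast
        qed blast
      qed
      also have "prob p (pairs {1..n}) ?T \<le> \<delta> / 2" using elim(3) p x by blast
      also have "prob p (pairs {1..n}) ?W \<le> \<delta> / 2" using elim(4) p x by blast
      finally show "prob p (pairs {1..n}) (\<lambda>E. every_edge_in_triangle E \<and> triangle_space E \<noteq> cycle_space E) \<le> \<delta>"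
        by simp
    qed
  qed
qed

theorem theorem1p3:
  shows "(\<lambda>n. SUP p\<in>{0..1::real}. gnp_prob n p
            (\<lambda>E. every_edge_in_triangle E \<and> triangle_space E \<noteq> cycle_space E))
         \<longlonglongrightarrow> 0"
proof (rule tendstoI)
  fix e :: real assume "e > 0"
  then have d: "e / 2 > 0" by simp
  let ?Q = "\<lambda>E. every_edge_in_triangle E \<and> triangle_space E \<noteq> cycle_space E"
  let ?f = "\<lambda>n p. gnp_prob n p ?Q"
  show "\<forall>\<^sub>F n in sequentially. dist (SUP p\<in>{0..1}. ?f n p) 0 < e"
    using supercritical_whp[OF d] subcritical_whp[OF d]
  proof eventually_elim
    case (elim n)
    have f: "?f n p = prob p (pairs {1..n}) ?Q" for p
      by (simp add: gnp_prob_eq_prob all_edges_eq_pairs)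
    have le: "?f n p \<le> e / 2" if "p \<in> {0..1}" for p
    proof (cases "5/4 * ln n \<le> n * p\<^sup>2")
      case True
      then show ?thesis using elim(1) that unfolding f by auto
    next
      case False
      have p: "0 \<le> p" "p \<le> 1" using that by auto
      have "?f n p \<le> prob p (pairs {1..n}) (\<lambda>E. every_edge_in_triangle E \<and> triangles E \<noteq> {})"
        unfolding f
      proof (rule prob_mono[OF p])
        fix E assume E: "E \<subseteq> pairs {1..n}" and Q: "?Q E"
        then obtain F where "witness E F" using exists_witness[of E n] by (auto simp: all_edges_eq_pairs)
        \<comment> \<open>A witness is nonempty, so the graph has an edge and hence, by Q, a
          triangle; this is the event bounded in the sparse range.\<close>
        then have "E \<noteq> {}" by (auto simp: witness_def)
        then show "every_edge_in_triangle E \<and> triangles E \<noteq> {}" using Q by (auto simp: every_edge_in_triangle_def)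
      qed
      also have "\<dots> \<le> e / 2" using elim(2) p False by (simp add: not_le)
      finally show ?thesis .
    qed
    have "(SUP p\<in>{0..1}. ?f n p) \<le> e / 2" by (rule cSUP_least) (use le in auto)
    moreover have "0 \<le> (SUP p\<in>{0..1}. ?f n p)"
    \<comment> \<open>A real supremum is controlled only for bounded sets; with boundedness, the
      value at p = 0 shows that it is not negative.\<close>
    proof (rule cSUP_upper2[where x = 0])
      show "bdd_above (?f n ` {0..1})" using le by (auto intro!: bdd_aboveI[of _ "e / 2"])
      show "0 \<le> ?f n 0" unfolding f by (rule prob_nonneg) auto
    qed simp
    ultimately show ?case using \<open>e > 0\<close> by (simp add: dist_real_def)
  qed
qed

end
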